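(* Let $k$ be a perfect field, $G=\mathrm{GL}_3\times\mathrm{GL}_3\times\mathrm{GL}_2$ and $V=\mathbb{A}^3\otimes\mathbb{A}^3\otimes\mathbb{A}^2$ with the natural action of $G$. Let $\{S_\beta\}_{\beta\in\mathfrak{B}}$ be the strata of the GIT stratification of $V$ (see context). Then there are exactly $16$ elements $\beta\in\mathfrak{B}$ such that $S_\beta\neq\emptyset$. Moreover, there is one $\beta_0\in\mathfrak B$ with $S_{\beta_0}\ne\emptyset$ such that for every $\beta\in\mathfrak{B}$ with $\beta\neq\beta_0$ and $S_\beta\neq\emptyset$ the set $G_k\backslash S_{\beta\,k}$ consists of a single point, whereas $G_k\backslash S_{\beta_0\,k}$ is in bijective correspondence with $\mathrm{Ex}_2(k)$.
   Context: $k$ is a perfect field with algebraic closure $\bar k$. $\mathrm{Ex}_2(k)$ is the set of isomorphism classes of separable field extensions of $k$ of degree up to two ($k$ itself included). Setting. $G=\mathrm{GL}_3\times\mathrm{GL}_3\times\mathrm{GL}_2$, $V=\mathbb{A}^3\otimes\mathbb{A}^3\otimes\mathbb{A}^2$, $G_{\mathrm{st}}=\mathrm{SL}_3\times\mathrm{SL}_3\times\mathrm{SL}_2$. $V$ has basis $e_{ijl}=\mathbb{e}_i\otimes\mathbb{e}_j\otimes\mathbb{f}_l$ ($i,j=1,2,3$, $l=1,2$) formed from the standard bases. Let $\mathfrak{t}^*=\{(a_{11},a_{12},a_{13},a_{21},a_{22},a_{23},a_{31},a_{32})\in\mathbb{R}^8\mid \sum_i a_{1i}=\sum_i a_{2i}=\sum_i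 a_{3i}=0\}$ with the standard inner product $(\ ,\ )_*$ of $\mathbb{R}^8$, and let $\mathfrak{t}^*_+$ be the set of those elements with $a_{11}\le a_{12}\le a_{13}$, $a_{21}\le a_{22}\le a_{23}$, $a_{31}\le a_{32}$. The weight $\gamma_{ijl}\in\mathfrak{t}^*$ of $e_{ijl}$ is the orthogonal projection to $\mathfrak{t}^*$ of the vector with entry $1$ at the positions $1i$, $2j$, $3l$ and $0$ elsewhere. GIT stratification. $\mathfrak{B}$ is the (finite) set of all non-zero $\beta\in\mathfrak{t}^*_+$ such that $\beta$ is the point closest to the origin of the convex hull of some non-empty set of weights $\gamma_{ijl}$. For $\beta=(b_{11},\dots,b_{32})\in\mathfrak{B}$: - $Z_\beta$ (resp. $W_\beta$) is the span of the $e_{ijl}$ with $(\gamma_{ijl},\beta)_*=(\beta,\beta)_*$ (resp. $>(\beta,\beta)_*$), and $Y_\beta=Z_\beta\oplus W_\beta$. - $P_\beta\subset G$ (resp. $M_\beta\subset G$) consists of the $(g_1,g_2,g_3)$ such that, for each $m=1,2,3$, the $(i,j)$-entry of $g_m$ is $0$ unless $b_{mi}\ge b_{mj}$ (resp. unless $b_{mi}=b_{mj}$). Thus $P_\beta$ is a lower block triangular parabolic subgroup with Levi subgroup $M_\beta$. - $\chi_\beta$ is the indivisible character of $M_\beta$ proportional (with positive factor) to $\beta$, i.e. a product of the determinants of the diagonal blocks raised to powers proportional to the corresponding entries of $\beta$. $G_{\mathrm{st},\beta}$ is the identity component of $\{g\in M_\beta\cap G_{\mathrm{st}}\mid\chi_\beta(g)=1\}$.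 - $Z_\beta^{\mathrm{ss}}$ is the set of points of $Z_\beta$ (over $\bar k$) at which some non-constant homogeneous $G_{\mathrm{st},\beta}$-invariant polynomial on $Z_\beta$ does not vanish. $Y_\beta^{\mathrm{ss}}=\{z+w\mid z\in Z_\beta^{\mathrm{ss}},\ w\in W_\beta\}$. - The stratum is $S_\beta=G\cdot Y_\beta^{\mathrm{ss}}\subset V$. $S_{\beta\,k}$ is its set of $k$-rational points. It is known that, as $k$ is perfect, $S_{\beta\,k}=G_k\cdot Y^{\mathrm{ss}}_{\beta\,k}\cong G_k\times_{P_{\beta\,k}}Y^{\mathrm{ss}}_{\beta\,k}$. A subscript $k$ denotes the set of $k$-rational points. *)

theory Defs
  imports "HOL-Analysis.Analysis" "HOL-Algebra.Algebraic_Closure_Type"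
begin

section \<open>Fields and extensions of degree at most two\<close>

definition perfect_field :: "'k::field itself \<Rightarrow> bool" where
  "perfect_field _ \<longleftrightarrow> CHAR('k) = 0 \<or> surj (\<lambda>x::'k. x ^ CHAR('k))"

interpretation ext: vector_space "\<lambda>(c::'k::field) (x::'k alg_closure). to_ac c * x"
  by unfold_locales (simp_all add: algebra_simps)

definition intermediate_field :: "'k::field alg_closure set \<Rightarrow> bool" where
  "intermediate_field F \<longleftrightarrow> range to_ac \<subseteq> F \<and>
     (\<forall>x\<in>F. \<forall>y\<in>F. x + y \<in> F \<and> x - y \<in> F \<and> x * y \<in> F) \<and> (\<forall>x\<in>F. inverse x \<in> F)"

text \<open>An element of the algebraic closure is separable if its minimal polynomial has no
  repeated root there.\<close>
definition separable_element :: "'k::field alg_closure \<Rightarrow> bool" where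
  "separable_element x \<longleftrightarrow> (\<exists>p::'k poly. Factorial_Ring.irreducible p \<and>
     poly (map_poly to_ac p) x = 0 \<and> rsquarefree (map_poly to_ac p))"

text \<open>A finite extension of \<open>k\<close> embeds over \<open>k\<close> into the algebraic closure, so the subextensions
  of the latter represent all isomorphism classes. As \<^term>\<open>ext.dim F\<close> is \<open>0\<close> if \<open>F\<close> has infinite
  degree, the degree condition has to be written as membership in \<open>{1, 2}\<close>.\<close>
definition separable_ext_le2 :: "'k::field alg_closure set \<Rightarrow> bool" where
  "separable_ext_le2 F \<longleftrightarrow>
     intermediate_field F \<and> ext.dim F \<in> {1, 2} \<and> (\<forall>x\<in>F. separable_element x)"

definition ext_iso :: "'k::field alg_closure set \<Rightarrow> 'k alg_closure set \<Rightarrow> bool" where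
  "ext_iso F F' \<longleftrightarrow> (\<exists>\<phi>. bij_betw \<phi> F F' \<and> (\<forall>c. \<phi> (to_ac c) = to_ac c) \<and>
     (\<forall>x\<in>F. \<forall>y\<in>F. \<phi> (x + y) = \<phi> x + \<phi> y \<and> \<phi> (x * y) = \<phi> x * \<phi> y))"

definition Ex2 :: "'k::field alg_closure set set set" where
  "Ex2 = {F. separable_ext_le2 F} //
     {(F, F'). separable_ext_le2 F \<and> separable_ext_le2 F' \<and> ext_iso F F'}"

section \<open>Polynomial functions and the Zariski topology\<close>

text \<open>Polynomial functions in the coordinate functions \<open>C\<close>. They are only used over
  algebraically closed, hence infinite, fields, where they are the same as polynomials.\<close>
inductive polynomial_fun :: "('v \<Rightarrow> 'a::field) set \<Rightarrow> ('v \<Rightarrow> 'a) \<Rightarrow> bool"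
  for C where
    const: "polynomial_fun C (\<lambda>_. a)"
  | coord: "c \<in> C \<Longrightarrow> polynomial_fun C c"
  | add: "polynomial_fun C f \<Longrightarrow> polynomial_fun C h \<Longrightarrow> polynomial_fun C (\<lambda>x. f x + h x)"
  | mult: "polynomial_fun C f \<Longrightarrow> polynomial_fun C h \<Longrightarrow> polynomial_fun C (\<lambda>x. f x * h x)"

inductive homogeneous_polynomial_fun ::
    "('v \<Rightarrow> 'a::field) set \<Rightarrow> nat \<Rightarrow> ('v \<Rightarrow> 'a) \<Rightarrow> bool"
  for C where
    const: "homogeneous_polynomial_fun C 0 (\<lambda>_. a)"
  | zero: "homogeneous_polynomial_fun C d (\<lambda>_. 0)"
  | coord: "c \<in> C \<Longrightarrow> homogeneous_polynomial_fun C 1 c"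
  | add: "homogeneous_polynomial_fun C d f \<Longrightarrow> homogeneous_polynomial_fun C d h \<Longrightarrow>
      homogeneous_polynomial_fun C d (\<lambda>x. f x + h x)"
  | mult: "homogeneous_polynomial_fun C d f \<Longrightarrow> homogeneous_polynomial_fun C e h \<Longrightarrow>
      homogeneous_polynomial_fun C (d + e) (\<lambda>x. f x * h x)"

definition zariski :: "('v \<Rightarrow> 'a::field) set \<Rightarrow> 'v topology" where
  "zariski C = topology_generated_by {{x. f x \<noteq> 0} | f. polynomial_fun C f}"

section \<open>The representation\<close>

type_synonym 'a grp = "('a^3^3) \<times> ('a^3^3) \<times> ('a^2^2)"
type_synonym 'a tensor = "'a^(3 \<times> 3 \<times> 2)"

definition GL332 :: "'a::field grp set" where
  "GL332 = {(g1, g2, g3). invertible g1 \<and> invertible g2 \<and> invertible g3}"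

definition SL332 :: "'a::field grp set" where
  "SL332 = {(g1, g2, g3). det g1 = 1 \<and> det g2 = 1 \<and> det g3 = 1}"

definition act :: "'a::field grp \<Rightarrow> 'a tensor \<Rightarrow> 'a tensor" where
  "act = (\<lambda>(g1, g2, g3) x. \<chi> p. case p of (i, j, l) \<Rightarrow>
     (\<Sum>i'\<in>UNIV. \<Sum>j'\<in>UNIV. \<Sum>l'\<in>UNIV. g1$i$i' * g2$j$j' * g3$l$l' * x$(i', j', l')))"

definition e_tensor :: "3 \<Rightarrow> 3 \<Rightarrow> 2 \<Rightarrow> 'a::field tensor" where
  "e_tensor i j l = axis (i, j, l) 1"

definition tensor_coords :: "('a::field tensor \<Rightarrow> 'a) set" where
  "tensor_coords = {(\<lambda>x. x$p) | p. True}"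

definition grp_coords :: "('a::field grp \<Rightarrow> 'a) set" where
  "grp_coords = {(\<lambda>(g1, g2, g3). g1$i$j) | i j. True} \<union> {(\<lambda>(g1, g2, g3). g2$i$j) | i j. True} \<union>
     {(\<lambda>(g1, g2, g3). g3$i$j) | i j. True}"

section \<open>Weights\<close>

text \<open>The inner product of the product type is the standard one of \<open>\<real>\<^sup>8\<close>.\<close>
type_synonym wt = "(real^3) \<times> (real^3) \<times> (real^2)"

definition t_star :: "wt set" where
  "t_star = {(a1, a2, a3). (\<Sum>i\<in>UNIV. a1$i) = 0 \<and> (\<Sum>i\<in>UNIV. a2$i) = 0 \<and> (\<Sum>i\<in>UNIV. a3$i) = 0}"

definition t_star_plus :: "wt set" where
  "t_star_plus = {(a1, a2, a3). (a1, a2, a3) \<in> t_star \<and>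
     a1$1 \<le> a1$2 \<and> a1$2 \<le> a1$3 \<and> a2$1 \<le> a2$2 \<and> a2$2 \<le> a2$3 \<and> a3$1 \<le> a3$2}"

definition weight :: "3 \<Rightarrow> 3 \<Rightarrow> 2 \<Rightarrow> wt" where
  "weight i j l = (THE w. w \<in> t_star \<and>
     (\<forall>t\<in>t_star. orthogonal ((axis i 1, axis j 1, axis l 1) - w) t))"

definition \<BB> :: "wt set" where
  "\<BB> = {\<beta> \<in> t_star_plus. \<beta> \<noteq> 0 \<and>
     (\<exists>S. S \<subseteq> {weight i j l | i j l. True} \<and> S \<noteq> {} \<and> \<beta> = closest_point (convex hull S) 0)}"

section \<open>The strata\<close>

definition Z_beta :: "wt \<Rightarrow> 'a::field tensor set" where
  "Z_beta \<beta> = vec.span {e_tensor i j l | i j l. inner (weight i j l) \<beta> = inner \<beta> \<beta>}"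

definition W_beta :: "wt \<Rightarrow> 'a::field tensor set" where
  "W_beta \<beta> = vec.span {e_tensor i j l | i j l. inner (weight i j l) \<beta> > inner \<beta> \<beta>}"

definition M_beta :: "wt \<Rightarrow> 'a::field grp set" where
  "M_beta = (\<lambda>(b1, b2, b3). {(g1, g2, g3) \<in> GL332.
     (\<forall>i j. b1$i \<noteq> b1$j \<longrightarrow> g1$i$j = 0) \<and> (\<forall>i j. b2$i \<noteq> b2$j \<longrightarrow> g2$i$j = 0) \<and>
     (\<forall>i j. b3$i \<noteq> b3$j \<longrightarrow> g3$i$j = 0)})"

text \<open>The determinant of the diagonal block of \<open>g\<close> on the index set where \<open>b\<close> takes the value \<open>t\<close>
  (completed by an identity matrix outside the block).\<close>
definition block_det :: "real^'n \<Rightarrow> real \<Rightarrow> 'a::field^'n^'n \<Rightarrow> 'a" where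
  "block_det b t g =
     det (\<chi> i j. if b$i = t \<and> b$j = t then g$i$j else if i = j then 1 else 0)"

definition entries :: "wt \<Rightarrow> real set" where
  "entries = (\<lambda>(b1, b2, b3). range (($) b1) \<union> range (($) b2) \<union> range (($) b3))"

text \<open>The positive factor which turns \<open>\<beta>\<close> into a primitive integral vector. The characters of
  \<open>M_beta \<beta>\<close> form the free abelian group on the determinants of the diagonal blocks, so primitivity of
  the vector of exponents is indivisibility of the character.\<close>
definition chi_scale :: "wt \<Rightarrow> real" where
  "chi_scale \<beta> = (THE c. c > 0 \<and> (\<forall>t\<in>entries \<beta>. c * t \<in> \<int>) \<and>
     Gcd ((\<lambda>t. \<lfloor>c * t\<rfloor>) ` entries \<beta>) = 1)"

definition chi :: "wt \<Rightarrow> 'a::field grp \<Rightarrow> 'a" where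
  "chi \<beta> g = (case \<beta> of (b1, b2, b3) \<Rightarrow> case g of (g1, g2, g3) \<Rightarrow>
     (\<Prod>t\<in>range (($) b1). block_det b1 t g1 powi \<lfloor>chi_scale \<beta> * t\<rfloor>) *
     (\<Prod>t\<in>range (($) b2). block_det b2 t g2 powi \<lfloor>chi_scale \<beta> * t\<rfloor>) *
     (\<Prod>t\<in>range (($) b3). block_det b3 t g3 powi \<lfloor>chi_scale \<beta> * t\<rfloor>))"

text \<open>From here up to the strata, \<open>'a\<close> is the algebraically closed field.\<close>
definition G_st_beta :: "wt \<Rightarrow> 'a::alg_closed_field grp set" where
  "G_st_beta \<beta> = connected_component_of_set
     (subtopology (zariski grp_coords) {g \<in> M_beta \<beta> \<inter> SL332. chi \<beta> g = 1}) (mat 1, mat 1, mat 1)"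

text \<open>The polynomials on \<open>Z_beta \<beta>\<close> are the restrictions of the polynomials on the whole space. A
  homogeneous polynomial of positive degree with a non-zero value is not constant.\<close>
definition Z_ss :: "wt \<Rightarrow> 'a::alg_closed_field tensor set" where
  "Z_ss \<beta> = {z \<in> Z_beta \<beta>. \<exists>d f. d > 0 \<and> homogeneous_polynomial_fun tensor_coords d f \<and>
     (\<forall>g\<in>G_st_beta \<beta>. \<forall>x\<in>Z_beta \<beta>. f (act g x) = f x) \<and> f z \<noteq> 0}"

definition Y_ss :: "wt \<Rightarrow> 'a::alg_closed_field tensor set" where
  "Y_ss \<beta> = {z + w | z w. z \<in> Z_ss \<beta> \<and> w \<in> W_beta \<beta>}"

definition stratum :: "wt \<Rightarrow> 'a::alg_closed_field tensor set" where
  "stratum \<beta> = {act g y | g y. g \<in> GL332 \<and> y \<in> Y_ss \<beta>}"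

definition rational_stratum :: "wt \<Rightarrow> 'k::field tensor set" where
  "rational_stratum \<beta> = {v. (\<chi> p. to_ac (v$p)) \<in> stratum \<beta>}"

definition G_orbits :: "'k::field tensor set \<Rightarrow> 'k tensor set set" where
  "G_orbits S = (\<lambda>v. {act g v | g. g \<in> GL332}) ` S"

end

theory Submission
  imports Defs
begin

text \<open>A point of \<open>Y\<^sub>\<beta>\<close> is supported on weights in the half space \<open>(\<gamma>, \<beta>) \<ge> (\<beta>, \<beta>)\<close>. If it is semistable, then \<open>\<beta>\<close>
  lies in the convex hull of the support of each of its translates under lower triangular matrices (otherwise a one-parameter
  subgroup orthogonal to \<open>\<beta>\<close> would move its component in \<open>Z\<^sub>\<beta>\<close> to \<open>0\<close>), so \<open>\<beta>\<close> is the point of this hull closest to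
  the origin. By the Bruhat decomposition, points of \<open>Y\<^sub>\<beta>\<close> and \<open>Y\<^sub>\<beta>\<^sub>'\<close> in the same orbit have lower triangular
  translates which differ by a permutation of the basis, and \<open>\<beta> = \<beta>'\<close> follows: every vector lies in at most one stratum.

  An element of \<open>V\<close> is a pencil \<open>s A + t B\<close> of \<open>3 \<times> 3\<close> matrices. On \<open>Y\<^sub>\<beta>\<close> the binary cubic \<open>det (s A + t B)\<close> is divisible by
  \<open>t\<^sup>2\<close>, so on a stratum it has a double root, which is rational as \<open>k\<close> is perfect. With this root moved to \<open>A\<close>, the matrix
  \<open>A\<close> is singular and row and column operations bring every non-zero pencil to one of 15 normal forms or to
  \<open>s I + t C\<close> with \<open>C\<close> a \<open>2 \<times> 2\<close> matrix whose characteristic polynomial is separable. For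
  each of the 16 types there is an explicit semi-invariant which is invariant under \<open>G\<^sub>s\<^sub>t\<^sub>,\<^sub>\<beta>\<close> for a suitable \<open>\<beta>\<close>. In the
  last case the members of rank one of the pencil generate the splitting field of the characteristic polynomial, which
  determines the orbit.\<close>

text \<open>\<open>\<BB>\<close> is never enumerated. Which strata are empty is read off from the
  orbits: every vector of a stratum has a normal form, each normal form is placed in one stratum by
  an explicit invariant, and the strata are disjoint. One half of the Hilbert-Mumford criterion is
  enough for this: a non-vanishing invariant forces \<open>\<beta>\<close> into the convex hull of
  the support. The obstacle is that \<open>G_st_beta\<close> is an identity component in the Zariski
  topology, cut out by a character that involves a \<open>THE\<close>. Hence the weights in
  \<open>\<BB>\<close> are shown to be rational, so that \<open>chi_scale\<close> exists, and the
  curves traced by one-parameter subgroups are shown to be connected. The repeated root of the cubic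
  is at first known over the closure only. It is recorded as the vanishing of the discriminant, a
  polynomial in the entries that can be read over \<open>k\<close>, where the normal form is then
  found. Perfectness enters once more in the last type: over an imperfect field of characteristic 2
  the matrix \<open>C\<close> could have an irreducible characteristic polynomial with a double
  root.\<close>

no_notation fps_nth (infixl "$" 75)

section \<open>Weights\<close>

text \<open>For \<open>\<beta>\<close> in \<open>t_star\<close> this is the inner product of
  \<open>\<beta>\<close> with the weight of \<open>p\<close>, because projecting to
  \<open>t_star\<close> does not change inner products with elements of
  \<open>t_star\<close>.\<close>

definition pairing :: "wt \<Rightarrow> 3 \<times> 3 \<times> 2 \<Rightarrow> real" where
  "pairing \<beta> p = (case p of (i, j, l) \<Rightarrow> fst \<beta> $ i + fst (snd \<beta>) $ j + snd (snd \<beta>) $ l)"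

definition wgt :: "3 \<times> 3 \<times> 2 \<Rightarrow> wt" where
  "wgt p = (case p of (i, j, l) \<Rightarrow> weight i j l)"

definition rat_wt :: "wt \<Rightarrow> bool" where
  "rat_wt \<beta> \<longleftrightarrow> (\<forall>i. fst \<beta> $ i \<in> \<rat>) \<and> (\<forall>i. fst (snd \<beta>) $ i \<in> \<rat>) \<and> (\<forall>i. snd (snd \<beta>) $ i \<in> \<rat>)"

lemma t_star_iff:
  "\<beta> \<in> t_star \<longleftrightarrow> (\<Sum>i\<in>UNIV. fst \<beta> $ i) = 0 \<and> (\<Sum>i\<in>UNIV. fst (snd \<beta>) $ i) = 0 \<and>
     (\<Sum>i\<in>UNIV. snd (snd \<beta>) $ i) = 0"
  by (cases \<beta>) (auto simp: t_star_def)

lemma weight_eq: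
  "weight i j l = ((\<chi> m. (if m = i then 1 else 0) - 1/3), (\<chi> m. (if m = j then 1 else 0) - 1/3),
     (\<chi> m. (if m = l then 1 else 0) - 1/2))" (is "_ = ?w")
proof -
  have w: "?w \<in> t_star"
    by (auto simp: t_star_def sum_subtractf)
  have o: "inner ((axis i 1, axis j 1, axis l 1) - ?w) t = 0" if "t \<in> t_star" for t
  proof -
    have "(axis i 1, axis j 1, axis l 1) - ?w = ((\<chi> m. 1/3), (\<chi> m. 1/3), (\<chi> m. 1/2))"
      by (auto simp: vec_eq_iff axis_def)
    then show ?thesis using that
      by (cases t) (auto simp: inner_Pair t_star_def inner_vec_def sum_divide_distrib[symmetric])
  qed
  show ?thesis unfolding weight_def
  proof (rule the_equality)
    show "?w \<in> t_star \<and> (\<forall>t\<in>t_star. orthogonal ((axis i 1, axis j 1, axis l 1) - ?w) t)"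
      using w o by (auto simp: orthogonal_def)
  next
    fix v assume v: "v \<in> t_star \<and> (\<forall>t\<in>t_star. orthogonal ((axis i 1, axis j 1, axis l 1) - v) t)"
    have d: "v - ?w \<in> t_star"
      using v w by (auto simp: t_star_iff sum_subtractf simp del: fst_conv snd_conv)
    let ?e = "(axis i 1, axis j 1, axis l 1) :: wt"
    have "inner (?e - v) (v - ?w) = 0" "inner (?e - ?w) (v - ?w) = 0"
      using v d o[OF d] by (auto simp: orthogonal_def)
    then have "inner ((?e - ?w) - (?e - v)) (v - ?w) = 0"
      by (simp only: inner_diff_left)
    moreover have "(?e - ?w) - (?e - v) = v - ?w"
      by (simp only: diff_diff_eq2 diff_add_eq) simp
    ultimately have "inner (v - ?w) (v - ?w) = 0"
      by metis
    then show "v = ?w" by (simp only: inner_eq_zero_iff right_minus_eq)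
  qed
qed

lemma weight_in_t_star: "weight i j l \<in> t_star"
  by (auto simp: t_star_def weight_eq sum_subtractf)

lemma inner_wgt: "t \<in> t_star \<Longrightarrow> inner (wgt p) t = pairing t p"
  by (cases p; cases t)
     (simp add: wgt_def pairing_def weight_eq inner_Pair inner_vec_def left_diff_distrib sum_subtractf
        if_distrib[of "\<lambda>x. x * _"] t_star_def sum_divide_distrib[symmetric] cong: if_cong)

lemma weight_in_t_star': "wgt p \<in> t_star"
  by (cases p) (simp add: wgt_def weight_in_t_star)

lemma rat_wgt: "rat_wt (wgt p)"
  by (cases p) (auto simp: rat_wt_def wgt_def weight_eq)

lemma t_star_convex: "convex t_star"
  by (auto simp: convex_def t_star_iff sum.distrib sum_distrib_left[symmetric])

lemma hull_wgt_t_star: "convex hull (wgt ` S) \<subseteq> t_star"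
  by (intro hull_minimal t_star_convex) (auto simp: weight_in_t_star')

lemma t_star_combine: "a \<in> t_star \<Longrightarrow> b \<in> t_star \<Longrightarrow> a - c *\<^sub>R b \<in> t_star"
  by (auto simp: t_star_iff sum_subtractf sum_distrib_left[symmetric])

section \<open>Rationality of the closest point\<close>

text \<open>A rational-linear retraction of the reals onto the rationals fixes a point that is the unique
  solution of a linear system with rational coefficients.\<close>
lemma ex_rational_retraction:
  "\<exists>\<phi>::real \<Rightarrow> real. (\<forall>x y. \<phi> (x + y) = \<phi> x + \<phi> y) \<and> (\<forall>q\<in>\<rat>. \<forall>x. \<phi> (q * x) = q * \<phi> x) \<and>
     (\<forall>x. \<phi> x \<in> \<rat>) \<and> \<phi> 1 = 1"
proof -
  interpret V: vector_space "\<lambda>(q::rat) (x::real). of_rat q * x"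
    by unfold_locales (simp_all add: algebra_simps of_rat_add of_rat_mult)
  interpret R: vector_space "\<lambda>(q::rat) (x::rat). q * x"
    by unfold_locales (simp_all add: algebra_simps)
  interpret P: vector_space_pair "\<lambda>(q::rat) (x::real). of_rat q * x" "\<lambda>(q::rat) (x::rat). q * x" ..
  have ind: "V.independent {1::real}" by simp
  \<comment> \<open>\<open>construct\<close> sends the other members of a rational basis containing
    1 to 0, so \<open>h\<close> is the coordinate at 1.\<close>
  define h where "h = P.construct {1::real} (\<lambda>_. 1::rat)"
  have lin: "Vector_Spaces.linear (\<lambda>(q::rat) (x::real). of_rat q * x) (\<lambda>(q::rat) (x::rat). q * x) h"
    unfolding h_def by (rule P.linear_construct[OF ind])
  interpret h: Vector_Spaces.linear "\<lambda>(q::rat) (x::real). of_rat q * x" "\<lambda>(q::rat) (x::rat). q * x" h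
    by (rule lin)
  have h1: "h 1 = 1" unfolding h_def using P.construct_basis[OF ind, of 1 "\<lambda>_. 1"] by simp
  show ?thesis
  proof (intro exI[of _ "\<lambda>x. of_rat (h x)"] conjI allI ballI)
    fix q x :: real assume "q \<in> \<rat>"
    then obtain r where "q = of_rat r" by (auto simp: Rats_def)
    then show "of_rat (h (q * x)) = q * of_rat (h x)"
      using h.scale[of r x] by (simp add: of_rat_mult)
  qed (auto simp: h.add of_rat_add h1)
qed

text \<open>Applying the retraction \<open>\<phi>\<close> to the coefficients \<open>u\<close> of
  \<open>\<beta>\<close> gives the point \<open>\<Phi> \<beta>\<close>. The coefficients of
  \<open>\<Phi> \<beta> - \<beta>\<close> add up to 0, and its inner product is the same with every
  \<open>x\<close> for which \<open>u x\<close> is non-zero, because such \<open>x\<close> lie on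
  the supporting hyperplane of \<open>\<beta>\<close>. So the difference is orthogonal to
  itself.\<close>

lemma rat_wt_min_norm_point:
  assumes fin: "finite S" and rat: "\<And>x. x \<in> S \<Longrightarrow> rat_wt x" and \<beta>: "\<beta> \<in> convex hull S"
    and min: "\<And>x. x \<in> S \<Longrightarrow> inner x \<beta> \<ge> inner \<beta> \<beta>"
  shows "rat_wt \<beta>"
proof -
  obtain \<phi> :: "real \<Rightarrow> real" where add: "\<And>x y. \<phi> (x + y) = \<phi> x + \<phi> y"
    and scale: "\<And>q x. q \<in> \<rat> \<Longrightarrow> \<phi> (q * x) = q * \<phi> x" and ratv: "\<And>x. \<phi> x \<in> \<rat>" and one: "\<phi> 1 = 1"
    using ex_rational_retraction by metis
  have zero: "\<phi> 0 = 0" using add[of 0 0] by simp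
  have sumphi: "\<phi> (\<Sum>x\<in>A. f x) = (\<Sum>x\<in>A. \<phi> (f x))" for f and A :: "'x set"
    by (induction A rule: infinite_finite_induct) (auto simp: zero add)
  obtain u where u0: "\<And>x. x \<in> S \<Longrightarrow> 0 \<le> u x" and u1: "sum u S = 1" and ub: "(\<Sum>x\<in>S. u x *\<^sub>R x) = \<beta>"
    using \<beta> unfolding convex_hull_finite[OF fin] by auto
  define \<Phi> :: "wt \<Rightarrow> wt" where
    "\<Phi> = (\<lambda>b. ((\<chi> i. \<phi> (fst b $ i)), (\<chi> i. \<phi> (fst (snd b) $ i)), (\<chi> i. \<phi> (snd (snd b) $ i))))"
  have \<Phi>add: "\<Phi> (a + b) = \<Phi> a + \<Phi> b" for a b
    by (simp add: \<Phi>_def add vec_eq_iff)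
  have \<Phi>scale: "\<Phi> (c *\<^sub>R b) = \<phi> c *\<^sub>R b" if "rat_wt b" for c b
  proof -
    have "\<phi> (c * q) = \<phi> c * q" if "q \<in> \<rat>" for q
      using scale[OF that, of c] by (simp add: mult.commute)
    then show ?thesis using that by (cases b) (auto simp: \<Phi>_def vec_eq_iff rat_wt_def)
  qed
  have \<Phi>0: "\<Phi> 0 = 0" by (simp add: \<Phi>_def zero vec_eq_iff zero_prod_def)
  have \<Phi>sum: "\<Phi> (\<Sum>x\<in>A. f x) = (\<Sum>x\<in>A. \<Phi> (f x))" for f and A :: "wt set"
    by (induction A rule: infinite_finite_induct) (auto simp: \<Phi>0 \<Phi>add)
  have inn: "inner x (\<Phi> b) = \<phi> (inner x b)" if "rat_wt x" for x b
    using that by (cases x; cases b)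
      (auto simp: \<Phi>_def inner_Pair inner_vec_def add sumphi scale rat_wt_def)
  have \<Phi>\<beta>: "\<Phi> \<beta> = (\<Sum>x\<in>S. \<phi> (u x) *\<^sub>R x)"
    unfolding ub[symmetric] \<Phi>sum by (intro sum.cong refl \<Phi>scale rat)
  \<comment> \<open>Complementary slackness: the terms are non-negative and add up to 0.\<close>
  have "(\<Sum>x\<in>S. u x * (inner x \<beta> - inner \<beta> \<beta>)) = inner (\<Sum>x\<in>S. u x *\<^sub>R x) \<beta> - sum u S * inner \<beta> \<beta>"
    by (simp add: inner_sum_left right_diff_distrib sum_subtractf sum_distrib_right)
  also have "\<dots> = 0" by (simp add: ub u1)
  finally have eq: "u x * (inner x \<beta> - inner \<beta> \<beta>) = 0" if "x \<in> S" for x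
    using that fin u0 min by (subst (asm) sum_nonneg_eq_0_iff) auto
  let ?s = "inner \<beta> \<beta>"
  let ?d = "\<Phi> \<beta> - \<beta>"
  have d: "?d = (\<Sum>x\<in>S. (\<phi> (u x) - u x) *\<^sub>R x)"
    unfolding \<Phi>\<beta> scaleR_left_diff_distrib sum_subtractf ub ..
  have "(\<phi> (u x) - u x) * inner x ?d = (\<phi> (u x) - u x) * (\<phi> ?s - ?s)" if x: "x \<in> S" for x
  proof (cases "u x = 0")
    case False
    then have "inner x \<beta> = ?s" using eq[OF x] by simp
    then show ?thesis by (simp add: inner_diff_right inn[OF rat[OF x]])
  qed (simp add: zero)
  then have "inner ?d ?d = (\<Sum>x\<in>S. (\<phi> (u x) - u x) * (\<phi> ?s - ?s))"
    by (subst (1) d) (simp only: inner_sum_left inner_scaleR_left cong: sum.cong)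
  also have "\<dots> = (\<phi> (sum u S) - sum u S) * (\<phi> ?s - ?s)"
    unfolding sumphi sum_distrib_right[symmetric] sum_subtractf ..
  also have "\<dots> = 0" by (simp add: u1 one)
  finally have "\<Phi> \<beta> = \<beta>" by simp
  moreover have "rat_wt (\<Phi> \<beta>)" by (simp add: rat_wt_def \<Phi>_def ratv)
  ultimately show ?thesis by simp
qed

section \<open>The indivisible multiple of a rational weight\<close>

lemma common_denominator:
  assumes "finite A" "A \<subseteq> \<rat>"
  shows "\<exists>N>0. \<forall>x\<in>A. of_nat N * (x::real) \<in> \<int>"
  using assms
proof (induction A rule: finite_induct)
  case (insert a A)
  then obtain N where N: "N > 0" "\<forall>x\<in>A. of_nat N * x \<in> \<int>" by auto
  obtain m n where mn: "n \<noteq> 0" "\<bar>a\<bar> = real m / real n"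
    using insert.prems Rats_abs_nat_div_natE[of a] by (metis insert_subset)
  have na: "real n * \<bar>a\<bar> = of_nat m" using mn by simp
  have nz: "real n * a \<in> \<int>"
  proof (cases "a \<ge> 0")
    case False
    then have "real n * a = - of_nat m" using na by simp
    then show ?thesis by simp
  qed (use na in simp)
  have "real N * (real n * a) \<in> \<int>" by (rule Ints_mult[OF Ints_of_nat nz])
  moreover have "real n * (real N * x) \<in> \<int>" if "x \<in> A" for x
    using Ints_mult[OF Ints_of_nat, of "real N * x" n] N(2) that by blast
  ultimately show ?case
    using N(1) mn(1) by (intro exI[of _ "N * n"]) (simp add: mult_ac)
qed auto

text \<open>This makes the description in \<open>chi_scale\<close> meaningful. For uniqueness, the
  entry \<open>t0\<close> shows that two scales have a rational ratio \<open>p / q\<close> in lowest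
  terms. Then \<open>p\<close> divides all entries scaled by \<open>c1\<close> and \<open>q\<close>
  all those scaled by \<open>c2\<close>, so both are 1.\<close>

lemma primitive_scale:
  assumes "finite E" "E \<subseteq> \<rat>" "t0 \<in> E" "t0 \<noteq> 0"
  shows "\<exists>!c::real. c > 0 \<and> (\<forall>t\<in>E. c * t \<in> \<int>) \<and> Gcd ((\<lambda>t. \<lfloor>c * t\<rfloor>) ` E) = 1"
proof -
  obtain N where N: "N > 0" "\<And>x. x \<in> E \<Longrightarrow> real N * x \<in> \<int>" using common_denominator[OF assms(1,2)] by auto
  define g where "g = Gcd ((\<lambda>t. \<lfloor>real N * t\<rfloor>) ` E)"
  have fl: "of_int \<lfloor>real N * t\<rfloor> = real N * t" if "t \<in> E" for t
    using N(2)[OF that] by (simp add: Ints_def)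
  have "\<lfloor>real N * t0\<rfloor> \<noteq> 0"
    using fl[OF assms(3)] N(1) assms(4) by (metis mult_eq_0_iff of_int_0 of_nat_0_eq_iff less_irrefl)
  then have "g \<noteq> 0" using assms(3) by (auto simp: g_def)
  moreover have "g \<ge> 0" by (simp add: g_def)
  ultimately have g: "g > 0" by simp
  define c where "c = real N / of_int g"
  have ci: "c * t = of_int (\<lfloor>real N * t\<rfloor> div g)" if "t \<in> E" for t
  proof -
    have "g dvd \<lfloor>real N * t\<rfloor>" using that by (auto simp: g_def)
    then have "real_of_int (\<lfloor>real N * t\<rfloor> div g) = real N * t / of_int g"
      by (simp only: real_of_int_div fl[OF that])
    then show ?thesis by (simp add: c_def)
  qed
  have "(\<lambda>t. \<lfloor>real N * t\<rfloor>) ` E = (*) g ` ((\<lambda>t. \<lfloor>c * t\<rfloor>) ` E)"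
    unfolding image_image
  proof (intro image_cong refl)
    fix t assume "t \<in> E"
    then show "\<lfloor>real N * t\<rfloor> = g * \<lfloor>c * t\<rfloor>"
      unfolding ci[OF \<open>t \<in> E\<close>] by (simp add: g_def)
  qed
  then have "g = normalize (g * Gcd ((\<lambda>t. \<lfloor>c * t\<rfloor>) ` E))"
    unfolding g_def by (metis Gcd_mult)
  then have G1: "Gcd ((\<lambda>t. \<lfloor>c * t\<rfloor>) ` E) = 1"
    using g by (simp add: normalize_mult)
  have uniq: "c1 = c2" if c1: "c1 > 0" "\<forall>t\<in>E. c1 * t \<in> \<int>" "Gcd ((\<lambda>t. \<lfloor>c1 * t\<rfloor>) ` E) = 1"
    and c2: "c2 > 0" "\<forall>t\<in>E. c2 * t \<in> \<int>" "Gcd ((\<lambda>t. \<lfloor>c2 * t\<rfloor>) ` E) = 1" for c1 c2 :: real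
  proof -
    have f1: "of_int \<lfloor>c1 * t\<rfloor> = c1 * t" "of_int \<lfloor>c2 * t\<rfloor> = c2 * t" if "t \<in> E" for t
      using bspec[OF c1(2) that] bspec[OF c2(2) that] by (metis Ints_cases floor_of_int)+
    have "c1 / c2 = (c1 * t0) / (c2 * t0)" using assms(4) by simp
    also have "\<dots> \<in> \<rat>" by (metis f1[OF assms(3)] Rats_of_int Rats_divide)
    finally obtain p q where pq: "q \<noteq> 0" "\<bar>c1 / c2\<bar> = real p / real q" "coprime p q"
      using Rats_abs_nat_div_natE by metis
    then have e: "c1 * real q = c2 * real p" using c1 c2 by (simp add: field_simps)
    have e2: "\<lfloor>c1 * t\<rfloor> * int q = \<lfloor>c2 * t\<rfloor> * int p" if "t \<in> E" for t
    proof -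
      have "of_int (\<lfloor>c1 * t\<rfloor> * int q) = (of_int (\<lfloor>c2 * t\<rfloor> * int p) :: real)"
        unfolding of_int_mult f1[OF that] of_int_of_nat_eq
        using arg_cong[OF e, of "\<lambda>x. x * t"] by (simp add: mult_ac)
      then show ?thesis by (simp only: of_int_eq_iff)
    qed
    have "int p dvd \<lfloor>c1 * t\<rfloor>" if "t \<in> E" for t
    proof -
      have "int p dvd \<lfloor>c1 * t\<rfloor> * int q" unfolding e2[OF that] by simp
      then show ?thesis using pq(3) by (simp add: coprime_dvd_mult_left_iff)
    qed
    then have "int p dvd Gcd ((\<lambda>t. \<lfloor>c1 * t\<rfloor>) ` E)" by (auto intro!: Gcd_greatest)
    then have "p = 1" using c1(3) by simp
    have "int q dvd \<lfloor>c2 * t\<rfloor>" if "t \<in> E" for t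
    proof -
      have "int q dvd \<lfloor>c2 * t\<rfloor> * int p" unfolding e2[OF that, symmetric] by simp
      then show ?thesis using pq(3) by (simp add: coprime_dvd_mult_left_iff coprime_commute)
    qed
    then have "int q dvd Gcd ((\<lambda>t. \<lfloor>c2 * t\<rfloor>) ` E)" by (auto intro!: Gcd_greatest)
    then have "q = 1" using c2(3) by simp
    show ?thesis using e \<open>p = 1\<close> \<open>q = 1\<close> by simp
  qed
  have "c > 0 \<and> (\<forall>t\<in>E. c * t \<in> \<int>) \<and> Gcd ((\<lambda>t. \<lfloor>c * t\<rfloor>) ` E) = 1"
    using G1 N(1) g ci by (auto simp: c_def)
  then show ?thesis using uniq by blast
qed

lemma entries_nonzero:
  assumes "\<beta> \<noteq> 0"
  shows "\<exists>t\<in>entries \<beta>. t \<noteq> 0"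
proof (rule ccontr)
  assume "\<not> ?thesis"
  then have "fst \<beta> = 0" "fst (snd \<beta>) = 0" "snd (snd \<beta>) = 0"
    by (cases \<beta>; force simp: entries_def vec_eq_iff)+
  then show False using assms by (metis prod.collapse zero_prod_def)
qed

lemma finite_entries: "finite (entries \<beta>)"
  by (cases \<beta>) (auto simp: entries_def)

lemma entries_rat: "rat_wt \<beta> \<Longrightarrow> entries \<beta> \<subseteq> \<rat>"
  by (cases \<beta>) (auto simp: entries_def rat_wt_def)

lemma chi_scale_eqI:
  assumes "c > 0" "\<forall>t\<in>entries \<beta>. c * t \<in> \<int>" "Gcd ((\<lambda>t. \<lfloor>c * t\<rfloor>) ` entries \<beta>) = 1" "\<beta> \<noteq> 0" "rat_wt \<beta>"
  shows "chi_scale \<beta> = c"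
proof -
  obtain t0 where "t0 \<in> entries \<beta>" "t0 \<noteq> 0" using entries_nonzero[OF assms(4)] by blast
  then show ?thesis unfolding chi_scale_def
    using primitive_scale[OF finite_entries entries_rat[OF assms(5)]] assms(1-3) by (intro the1_equality) auto
qed

lemma chi_scale_integral:
  assumes "rat_wt \<beta>" "\<beta> \<noteq> 0" "t \<in> entries \<beta>"
  shows "chi_scale \<beta> * t \<in> \<int>"
proof -
  obtain t0 where "t0 \<in> entries \<beta>" "t0 \<noteq> 0" using entries_nonzero[OF assms(2)] by blast
  from theI'[OF primitive_scale[OF finite_entries entries_rat[OF assms(1)] this]] assms(3)
  show ?thesis unfolding chi_scale_def by blast
qed

section \<open>Separation by integral cocharacters\<close>

lemma rational_point_in_open:
  fixes U :: "wt set"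
  assumes "open U" "x \<in> U"
  shows "\<exists>q\<in>U. rat_wt q"
proof -
  obtain e where e: "e > 0" "ball x e \<subseteq> U" using assms open_contains_ball by blast
  obtain a b where ab: "\<forall>i\<in>Basis. a \<bullet> i \<in> \<rat> \<and> b \<bullet> i \<in> \<rat>" "x \<in> box a b" "box a b \<subseteq> ball x e"
    using rational_boxes[OF e(1), of x] by auto
  define q where "q = (1/2) *\<^sub>R (a + b)"
  have "q \<in> box a b"
    using ab(2) by (auto simp: q_def mem_box inner_add_left field_simps)
  moreover have r: "q \<bullet> i \<in> \<rat>" if "i \<in> Basis" for i
    using ab(1) that by (simp add: q_def inner_add_left)
  have "rat_wt q" unfolding rat_wt_def
  proof (intro conjI allI)
    fix i
    have "(axis i 1, 0, 0) \<in> (Basis :: wt set)" by (simp add: Basis_prod_def image_iff axis_in_Basis_iff zero_prod_def)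
    from r[OF this] show "fst q $ i \<in> \<rat>" by (cases q) (simp add: inner_axis inner_Pair)
  next
    fix i
    have "(0, axis i 1, 0) \<in> (Basis :: wt set)" by (simp add: Basis_prod_def image_iff axis_in_Basis_iff zero_prod_def)
    from r[OF this] show "fst (snd q) $ i \<in> \<rat>" by (cases q) (simp add: inner_axis inner_Pair)
  next
    fix i
    have "(0, 0, axis i 1) \<in> (Basis :: wt set)" by (simp add: Basis_prod_def image_iff axis_in_Basis_iff zero_prod_def)
    from r[OF this] show "snd (snd q) $ i \<in> \<rat>" by (cases q) (simp add: inner_axis inner_Pair)
  qed
  ultimately show ?thesis using ab(3) e(2) by blast
qed

definition proj_t :: "wt \<Rightarrow> wt" where
  "proj_t a = ((\<chi> i. fst a $ i - (\<Sum>m\<in>UNIV. fst a $ m) / 3),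
     (\<chi> i. fst (snd a) $ i - (\<Sum>m\<in>UNIV. fst (snd a) $ m) / 3),
     (\<chi> i. snd (snd a) $ i - (\<Sum>m\<in>UNIV. snd (snd a) $ m) / 2))"

lemma proj_t_in: "proj_t a \<in> t_star"
  by (simp add: t_star_iff proj_t_def sum_subtractf)

lemma inner_proj_t: "t \<in> t_star \<Longrightarrow> inner (proj_t a) t = inner a t"
  by (cases a; cases t)
     (simp add: proj_t_def inner_Pair inner_vec_def t_star_def left_diff_distrib sum_subtractf
       sum_distrib_left[symmetric] sum_divide_distrib[symmetric])

lemma rat_proj_t: "rat_wt a \<Longrightarrow> rat_wt (proj_t a)"
  by (auto simp: rat_wt_def proj_t_def intro!: Rats_diff Rats_divide Rats_sum)

lemma rat_wt_combine: "rat_wt a \<Longrightarrow> rat_wt b \<Longrightarrow> q \<in> \<rat> \<Longrightarrow> rat_wt (a - q *\<^sub>R b)"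
  by (auto simp: rat_wt_def)

lemma inner_rat_wt: "rat_wt a \<Longrightarrow> rat_wt b \<Longrightarrow> inner a b \<in> \<rat>"
  by (cases a; cases b) (auto simp: rat_wt_def inner_Pair inner_vec_def intro!: Rats_add Rats_sum)

text \<open>A vector separating \<open>\<beta>\<close> from the hull is larger on \<open>S\<close>
  than on \<open>\<beta>\<close>. This is an open condition, so the vector can be taken rational.
  Projecting it to \<open>t_star\<close> and subtracting its component along \<open>\<beta>\<close>
  lowers its value at each weight of \<open>S\<close> by its value at \<open>\<beta>\<close>, so all
  values become positive. Clearing denominators gives integers.\<close>

lemma destabilizing_cocharacter:
  assumes \<beta>: "rat_wt \<beta>" "\<beta> \<in> t_star" and S: "\<And>p. p \<in> S \<Longrightarrow> pairing \<beta> p = inner \<beta> \<beta>"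
    and nin: "\<beta> \<notin> convex hull (wgt ` S)"
  obtains l1 l2 :: "3 \<Rightarrow> int" and l3 :: "2 \<Rightarrow> int" where
    "(\<Sum>i\<in>UNIV. l1 i) = 0" "(\<Sum>i\<in>UNIV. l2 i) = 0" "(\<Sum>i\<in>UNIV. l3 i) = 0"
    "(\<Sum>i\<in>UNIV. fst \<beta> $ i * of_int (l1 i)) + (\<Sum>i\<in>UNIV. fst (snd \<beta>) $ i * of_int (l2 i)) +
       (\<Sum>i\<in>UNIV. snd (snd \<beta>) $ i * of_int (l3 i)) = 0"
    "\<And>i j l. (i, j, l) \<in> S \<Longrightarrow> l1 i + l2 j + l3 l > 0"
proof -
  have "closed (convex hull (wgt ` S))"
    by (intro compact_imp_closed finite_imp_compact_convex_hull) simp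
  then obtain a b where ab: "inner a \<beta> < b" "\<forall>x\<in>convex hull (wgt ` S). inner a x > b"
    using separating_hyperplane_closed_point[OF convex_convex_hull _ nin] by auto
  define U where "U = (\<Inter>p\<in>S. {x. inner (wgt p - \<beta>) x > 0})"
  have "open U" unfolding U_def
    by (intro open_INT ballI open_halfspace_gt finite)
  moreover have "a \<in> U"
    unfolding U_def
  proof safe
    fix p assume "p \<in> S"
    then have "wgt p \<in> convex hull (wgt ` S)" by (intro hull_inc) auto
    then have "b < inner a (wgt p)" using ab(2) by blast
    then show "0 < inner (wgt p - \<beta>) a" using ab(1) by (simp add: inner_diff_left inner_diff_right inner_commute)
  qed
  ultimately obtain q where q: "q \<in> U" "rat_wt q" using rational_point_in_open by blast
  define k where "k = inner q \<beta> / inner \<beta> \<beta>"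
  define v where "v = proj_t q - k *\<^sub>R \<beta>"
  have vt: "v \<in> t_star" unfolding v_def by (intro t_star_combine proj_t_in \<beta>)
  have vr: "rat_wt v" unfolding v_def k_def
    by (intro rat_wt_combine rat_proj_t q \<beta> Rats_divide inner_rat_wt)
  \<comment> \<open>For \<open>\<beta> = 0\<close> the quotient \<open>k\<close> is 0 by convention
    and both sides vanish.\<close>
  have k: "k * inner \<beta> \<beta> = inner q \<beta>" by (cases "\<beta> = 0") (auto simp: k_def)
  have v\<beta>: "inner v \<beta> = 0"
    unfolding v_def inner_diff_left inner_proj_t[OF \<beta>(2)] inner_scaleR_left k by simp
  have vp: "pairing v p > 0" if "p \<in> S" for p
  proof -
    have "pairing v p = inner (proj_t q) (wgt p) - k * inner \<beta> (wgt p)"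
      unfolding inner_wgt[OF vt, symmetric] unfolding v_def by (simp add: inner_diff_right inner_commute)
    also have "\<dots> = inner q (wgt p) - k * inner \<beta> \<beta>"
      using S[OF that] inner_wgt[OF \<beta>(2), of p] inner_proj_t[OF weight_in_t_star'] by (simp add: inner_commute)
    also have "\<dots> = inner (wgt p - \<beta>) q" by (simp add: k inner_diff_left inner_diff_right inner_commute)
    finally show ?thesis using q(1) that unfolding U_def by auto
  qed
  obtain N where N: "N > 0" "\<And>x. x \<in> entries v \<Longrightarrow> real N * x \<in> \<int>"
    using common_denominator[of "entries v"] vr by (cases v) (auto simp: entries_def rat_wt_def image_subset_iff)
  have in_e: "fst v $ i \<in> entries v" "fst (snd v) $ i \<in> entries v" "snd (snd v) $ j \<in> entries v" for i j
    by (cases v; auto simp: entries_def)+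
  define l1 where "l1 = (\<lambda>i. \<lfloor>real N * fst v $ i\<rfloor>)"
  define l2 where "l2 = (\<lambda>i. \<lfloor>real N * fst (snd v) $ i\<rfloor>)"
  define l3 where "l3 = (\<lambda>i. \<lfloor>real N * snd (snd v) $ i\<rfloor>)"
  have l: "of_int (l1 i) = real N * fst v $ i" "of_int (l2 i) = real N * fst (snd v) $ i"
    "of_int (l3 j) = real N * snd (snd v) $ j" for i j
    unfolding l1_def l2_def l3_def using N(2)[OF in_e(1)] N(2)[OF in_e(2)] N(2)[OF in_e(3)]
    by (metis Ints_cases floor_of_int)+
  show ?thesis
  proof (rule that[of l1 l2 l3])
    have "of_int (\<Sum>i\<in>UNIV. l1 i) = (0::real)" "of_int (\<Sum>i\<in>UNIV. l2 i) = (0::real)"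
      "of_int (\<Sum>i\<in>UNIV. l3 i) = (0::real)"
      using vt by (simp_all add: l sum_distrib_left[symmetric] t_star_iff)
    then show "(\<Sum>i\<in>UNIV. l1 i) = 0" "(\<Sum>i\<in>UNIV. l2 i) = 0" "(\<Sum>i\<in>UNIV. l3 i) = 0"
      by (simp_all only: of_int_eq_0_iff)
    have "inner v \<beta> = (\<Sum>i\<in>UNIV. fst v $ i * fst \<beta> $ i) + (\<Sum>i\<in>UNIV. fst (snd v) $ i * fst (snd \<beta>) $ i) +
       (\<Sum>i\<in>UNIV. snd (snd v) $ i * snd (snd \<beta>) $ i)"
      by (cases v; cases \<beta>) (simp add: inner_Pair inner_vec_def)
    then have "real N * ((\<Sum>i\<in>UNIV. fst v $ i * fst \<beta> $ i) + (\<Sum>i\<in>UNIV. fst (snd v) $ i * fst (snd \<beta>) $ i) +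
       (\<Sum>i\<in>UNIV. snd (snd v) $ i * snd (snd \<beta>) $ i)) = 0" using v\<beta> by simp
    then show "(\<Sum>i\<in>UNIV. fst \<beta> $ i * of_int (l1 i)) + (\<Sum>i\<in>UNIV. fst (snd \<beta>) $ i * of_int (l2 i)) +
       (\<Sum>i\<in>UNIV. snd (snd \<beta>) $ i * of_int (l3 i)) = 0"
      by (simp add: l distrib_left sum_distrib_left mult_ac)
    fix i j l assume "(i, j, l) \<in> S"
    then have "real N * pairing v (i, j, l) > 0" using vp N(1) by simp
    also have "real N * pairing v (i, j, l) = real_of_int (l1 i + l2 j + l3 l)"
      by (simp only: of_int_add l pairing_def distrib_left prod.case)
    finally have "real_of_int (l1 i + l2 j + l3 l) > 0" .
    then show "l1 i + l2 j + l3 l > 0" by simp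
  qed
qed

section \<open>Characterization of the closest point\<close>

lemma min_norm_unique:
  fixes b b' :: "'a::real_inner"
  assumes "b \<in> convex hull S" "b' \<in> convex hull S" "\<And>x. x \<in> S \<Longrightarrow> inner x b \<ge> inner b b"
    "\<And>x. x \<in> S \<Longrightarrow> inner x b' \<ge> inner b' b'"
  shows "b = b'"
proof -
  have "convex hull S \<subseteq> {x. inner b x \<ge> inner b b}"
    by (intro hull_minimal convex_halfspace_ge subsetI) (use assms(3) in \<open>simp add: inner_commute\<close>)
  moreover have "convex hull S \<subseteq> {x. inner b' x \<ge> inner b' b'}"
    by (intro hull_minimal convex_halfspace_ge subsetI) (use assms(4) in \<open>simp add: inner_commute\<close>)
  ultimately have "inner b b' \<ge> inner b b" "inner b' b \<ge> inner b' b'" using assms(1,2) by auto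
  then have "inner (b - b') (b - b') \<le> 0" by (simp add: inner_diff inner_commute)
  then show ?thesis by (metis eq_iff_diff_eq_0 inner_eq_zero_iff inner_ge_zero order_antisym)
qed

lemma closest_point_zero_iff:
  fixes S :: "wt set"
  assumes "finite S" "S \<noteq> {}"
  shows "b = closest_point (convex hull S) 0 \<longleftrightarrow> b \<in> convex hull S \<and> (\<forall>x\<in>S. inner x b \<ge> inner b b)"
proof -
  have cl: "closed (convex hull S)" using assms by (intro compact_imp_closed finite_imp_compact_convex_hull)
  have ne: "convex hull S \<noteq> {}" using assms by simp
  let ?c = "closest_point (convex hull S) 0"
  have 1: "?c \<in> convex hull S" by (rule closest_point_in_set[OF cl ne])
  have 2: "inner x ?c \<ge> inner ?c ?c" if "x \<in> S" for x
    using closest_point_dot[OF convex_convex_hull cl, of x 0] hull_inc[OF that, of convex]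
    by (simp add: inner_diff_right inner_commute)
  show ?thesis using 1 2 min_norm_unique[where b = b and b' = ?c and S = S] by blast
qed

text \<open>The closest point is replaced by its variational inequality, which consists of linear
  conditions on the finitely many weights in \<open>S\<close>.\<close>

lemma BB_iff:
  "\<beta> \<in> \<BB> \<longleftrightarrow> \<beta> \<in> t_star_plus \<and> \<beta> \<noteq> 0 \<and>
     (\<exists>S. S \<noteq> {} \<and> \<beta> \<in> convex hull (wgt ` S) \<and> (\<forall>p\<in>S. pairing \<beta> p \<ge> inner \<beta> \<beta>))"
proof -
  have W: "{weight i j l | i j l. True} = range wgt"
    by (auto simp: wgt_def image_def)
  have c: "\<beta> = closest_point (convex hull (wgt ` S)) 0 \<longleftrightarrow> \<beta> \<in> convex hull (wgt ` S) \<and> (\<forall>p\<in>S. pairing \<beta> p \<ge> inner \<beta> \<beta>)"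
    if "S \<noteq> {}" "\<beta> \<in> t_star_plus" for S
  proof -
    have "\<beta> \<in> t_star" using that(2) by (auto simp: t_star_plus_def)
    then show ?thesis using that(1)
      by (subst closest_point_zero_iff) (auto simp: inner_wgt)
  qed
  show ?thesis unfolding \<BB>_def W subset_image_iff
    using c by (auto; blast)
qed

text \<open>Without rationality no multiple of \<open>\<beta>\<close> would be integral, and
  \<open>chi_scale \<beta>\<close> would be an unspecified number.\<close>

lemma BB_rat: "\<beta> \<in> \<BB> \<Longrightarrow> rat_wt \<beta>"
proof -
  assume "\<beta> \<in> \<BB>"
  then obtain S where S: "\<beta> \<in> convex hull (wgt ` S)" "\<forall>p\<in>S. pairing \<beta> p \<ge> inner \<beta> \<beta>" and "\<beta> \<in> t_star"
    unfolding BB_iff by (auto simp: t_star_plus_def)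
  then show ?thesis
    by (rule_tac rat_wt_min_norm_point[of "wgt ` S"]) (auto simp: rat_wgt inner_wgt)
qed

section \<open>Polynomials over an algebraically closed field\<close>

lemma infinite_alg_closed: "infinite (UNIV :: 'a::alg_closed_field set)"
proof
  assume f: "finite (UNIV :: 'a set)"
  \<comment> \<open>This product vanishes everywhere, so adding 1 gives a polynomial of positive
    degree without a root.\<close>
  let ?q = "(\<Prod>a\<in>UNIV. [:- a, 1:]) :: 'a poly"
  have "Polynomial.degree ?q = card (UNIV :: 'a set)"
    by (subst degree_prod_eq_sum_degree) auto
  then have d: "Polynomial.degree ?q > 0" using f by (simp add: card_gt_0_iff)
  then have "Polynomial.degree (?q + 1) > 0" using degree_add_eq_left[of 1 ?q] by simp
  then obtain x where "poly (?q + 1) x = 0" using alg_closed_imp_poly_has_root by blast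
  moreover have "poly ?q x = 0" using f by (simp add: poly_prod)
  ultimately show False by simp
qed

lemma poly_eq_0_off_zero:
  fixes p :: "'a::alg_closed_field poly"
  assumes "\<And>t. t \<noteq> 0 \<Longrightarrow> poly p t = 0"
  shows "p = 0"
proof (rule ccontr)
  assume "p \<noteq> 0"
  then have "finite {t. poly p t = 0}" by (rule poly_roots_finite)
  moreover have "UNIV \<subseteq> insert 0 {t. poly p t = 0}" using assms by auto
  ultimately show False using infinite_alg_closed by (metis finite.insertI finite_subset)
qed

section \<open>The group action\<close>

definition grp_mult :: "'a::field grp \<Rightarrow> 'a grp \<Rightarrow> 'a grp" where
  "grp_mult g h = (fst g ** fst h, fst (snd g) ** fst (snd h), snd (snd g) ** snd (snd h))"

abbreviation grp_one :: "'a::field grp" where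
  "grp_one \<equiv> (mat 1, mat 1, mat 1)"

text \<open>The matrix of \<open>g\<close> on the tensor space, a Kronecker product. With it the
  laws of the action reduce to those of matrix multiplication.\<close>

definition act_coeff :: "'a::field grp \<Rightarrow> 3 \<times> 3 \<times> 2 \<Rightarrow> 3 \<times> 3 \<times> 2 \<Rightarrow> 'a" where
  "act_coeff g p q = fst g $ fst p $ fst q * fst (snd g) $ fst (snd p) $ fst (snd q) *
     snd (snd g) $ snd (snd p) $ snd (snd q)"

lemma sum_triple: "(\<Sum>p\<in>UNIV. f p) = (\<Sum>i\<in>UNIV. \<Sum>j\<in>UNIV. \<Sum>l\<in>UNIV. f (i, j, l))"
  unfolding UNIV_Times_UNIV[symmetric] sum.cartesian_product' ..

lemma act_nth: "act g x $ p = (\<Sum>q\<in>UNIV. act_coeff g p q * x $ q)"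
  by (cases g; cases p) (simp add: act_def sum_triple act_coeff_def)

lemma act_coeff_mult: "act_coeff (grp_mult g h) p r = (\<Sum>q\<in>UNIV. act_coeff g p q * act_coeff h q r)"
proof -
  have s: "(\<Sum>i\<in>UNIV. a i) * (\<Sum>j\<in>UNIV. b j) * (\<Sum>l\<in>UNIV. c l) = (\<Sum>i\<in>UNIV. \<Sum>j\<in>UNIV. \<Sum>l\<in>UNIV. a i * b j * c l)"
    for a b :: "3 \<Rightarrow> 'a" and c :: "2 \<Rightarrow> 'a"
    by (simp only: mult.assoc sum_distrib_right) (simp only: sum_distrib_left)
  show ?thesis
    unfolding act_coeff_def grp_mult_def matrix_matrix_mult_def sum_triple
    by (simp add: s) (simp add: mult_ac)
qed

lemma act_act: "act g (act h x) = act (grp_mult g h) x"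
proof -
  have "act g (act h x) $ p = act (grp_mult g h) x $ p" for p
  proof -
    have "act g (act h x) $ p = (\<Sum>q\<in>UNIV. \<Sum>r\<in>UNIV. act_coeff g p q * act_coeff h q r * x $ r)"
      by (simp add: act_nth sum_distrib_left mult.assoc)
    also have "\<dots> = (\<Sum>r\<in>UNIV. \<Sum>q\<in>UNIV. act_coeff g p q * act_coeff h q r * x $ r)"
      by (rule sum.swap)
    also have "\<dots> = act (grp_mult g h) x $ p"
      by (simp add: act_nth act_coeff_mult sum_distrib_right)
    finally show ?thesis .
  qed
  then show ?thesis by (simp add: vec_eq_iff)
qed

lemma act_one: "act grp_one x = x"
proof -
  have "act_coeff grp_one p q = (if q = p then 1 else (0::'a))" for p q
    by (cases p; cases q) (auto simp: act_coeff_def mat_def)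
  then show ?thesis
    by (simp add: vec_eq_iff act_nth if_distrib[of "\<lambda>x. x * _"] del: split_paired_All cong: if_cong)
qed

lemma act_zero: "act g 0 = 0"
  by (simp add: vec_eq_iff act_nth del: split_paired_All)

definition grp_inv :: "'a::field grp \<Rightarrow> 'a grp \<Rightarrow> bool" where
  "grp_inv g h \<longleftrightarrow> grp_mult g h = grp_one \<and> grp_mult h g = grp_one"

lemma GL332_iff_inv: "g \<in> GL332 \<longleftrightarrow> (\<exists>h. grp_inv g h)"
proof
  assume "g \<in> GL332"
  then obtain h1 h2 h3 where "fst g ** h1 = mat 1" "h1 ** fst g = mat 1" "fst (snd g) ** h2 = mat 1"
    "h2 ** fst (snd g) = mat 1" "snd (snd g) ** h3 = mat 1" "h3 ** snd (snd g) = mat 1"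
    by (cases g) (auto simp: GL332_def invertible_def)
  then have "grp_inv g (h1, h2, h3)" by (simp add: grp_inv_def grp_mult_def)
  then show "\<exists>h. grp_inv g h" ..
qed (cases g; auto simp: GL332_def grp_inv_def grp_mult_def invertible_def)

lemma grp_inv_sym: "grp_inv g h \<Longrightarrow> grp_inv h g"
  by (simp add: grp_inv_def)

lemma GL332_mult: "g \<in> GL332 \<Longrightarrow> h \<in> GL332 \<Longrightarrow> grp_mult g h \<in> GL332"
  by (cases g; cases h) (auto simp: GL332_def grp_mult_def invertible_mult)

lemma act_inv: "grp_inv g h \<Longrightarrow> act h (act g x) = x"
  by (simp add: act_act grp_inv_def act_one)

section \<open>Coordinates of \<open>Z_beta\<close> and \<open>W_beta\<close>\<close>

lemma span_axis:
  "vec.span {axis p (1::'a::field) | p. P p} = {x. \<forall>p. x $ p \<noteq> 0 \<longrightarrow> P p}"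
proof (intro equalityI)
  show "vec.span {axis p (1::'a) | p. P p} \<subseteq> {x. \<forall>p. x $ p \<noteq> 0 \<longrightarrow> P p}"
  proof (rule vec.span_minimal)
    show "{axis p (1::'a) | p. P p} \<subseteq> {x. \<forall>p. x $ p \<noteq> 0 \<longrightarrow> P p}" by (auto simp: axis_def split: if_splits)
    show "vec.subspace {x. \<forall>p. x $ p \<noteq> (0::'a) \<longrightarrow> P p}"
      by (auto simp: vec.subspace_def) (metis add.right_neutral)
  qed
next
  show "{x. \<forall>p. x $ p \<noteq> 0 \<longrightarrow> P p} \<subseteq> vec.span {axis p (1::'a) | p. P p}"
  proof safe
    fix x :: "'a^'b" assume x: "\<forall>p. x $ p \<noteq> 0 \<longrightarrow> P p"
    have "(\<Sum>i\<in>UNIV. x $ i *s axis i 1) \<in> vec.span {axis p (1::'a) | p. P p}"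
    proof (rule vec.span_sum)
      fix i
      show "x $ i *s axis i 1 \<in> vec.span {axis p (1::'a) | p. P p}"
      proof (cases "x $ i = 0")
        case False
        then show ?thesis using x by (intro vec.span_scale vec.span_base) auto
      qed (simp add: vec.span_zero)
    qed
    then show "x \<in> vec.span {axis p (1::'a) | p. P p}" by (simp add: basis_expansion)
  qed
qed

lemma Z_beta_iff: "\<beta> \<in> t_star \<Longrightarrow> z \<in> Z_beta \<beta> \<longleftrightarrow> (\<forall>p. z $ p \<noteq> 0 \<longrightarrow> pairing \<beta> p = inner \<beta> \<beta>)"
proof -
  assume b: "\<beta> \<in> t_star"
  have "{e_tensor i j l | i j l. inner (weight i j l) \<beta> = inner \<beta> \<beta>} = {axis p (1::'a) | p. pairing \<beta> p = inner \<beta> \<beta>}"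
    using inner_wgt[OF b] by (auto simp: e_tensor_def wgt_def) (metis prod.collapse)+
  then show ?thesis unfolding Z_beta_def by (simp only: span_axis mem_Collect_eq)
qed

lemma W_beta_iff: "\<beta> \<in> t_star \<Longrightarrow> z \<in> W_beta \<beta> \<longleftrightarrow> (\<forall>p. z $ p \<noteq> 0 \<longrightarrow> pairing \<beta> p > inner \<beta> \<beta>)"
proof -
  assume b: "\<beta> \<in> t_star"
  have "{e_tensor i j l | i j l. inner (weight i j l) \<beta> > inner \<beta> \<beta>} = {axis p (1::'a) | p. pairing \<beta> p > inner \<beta> \<beta>}"
    using inner_wgt[OF b] by (auto simp: e_tensor_def wgt_def) (metis prod.collapse)+
  then show ?thesis unfolding W_beta_def by (simp only: span_axis mem_Collect_eq)
qed

section \<open>Block diagonal matrices\<close>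

definition block_diag :: "real^'n \<Rightarrow> 'a::field^'n^'n \<Rightarrow> bool" where
  "block_diag b g \<longleftrightarrow> (\<forall>i j. b $ i \<noteq> b $ j \<longrightarrow> g $ i $ j = 0)"

definition diag_mat :: "('n \<Rightarrow> 'a::field) \<Rightarrow> 'a^'n^'n" where
  "diag_mat f = (\<chi> i j. if i = j then f i else 0)"

lemma M_beta_iff:
  "g \<in> M_beta \<beta> \<longleftrightarrow> g \<in> GL332 \<and> block_diag (fst \<beta>) (fst g) \<and> block_diag (fst (snd \<beta>)) (fst (snd g)) \<and>
     block_diag (snd (snd \<beta>)) (snd (snd g))"
  by (cases \<beta>; cases g) (auto simp: M_beta_def block_diag_def)

lemma block_diag_mult: "block_diag b g \<Longrightarrow> block_diag b h \<Longrightarrow> block_diag b (g ** h)"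
  unfolding block_diag_def matrix_matrix_mult_def
  by (auto intro!: sum.neutral) metis

lemma block_diag_diag_mat: "block_diag b (diag_mat f)"
  by (auto simp: block_diag_def diag_mat_def)

lemma diag_mat_mult_left: "(diag_mat f ** g) $ i $ j = f i * g $ i $ j"
  by (simp add: diag_mat_def matrix_matrix_mult_def if_distrib[of "\<lambda>x. x * _"] cong: if_cong)

lemma diag_mat_mult_right: "(g ** diag_mat f) $ i $ j = g $ i $ j * f j"
  by (simp add: diag_mat_def matrix_matrix_mult_def if_distrib[of "\<lambda>x. _ * x"] cong: if_cong)

text \<open>Block diagonal matrices are those that commute with the projection \<open>E\<close> to
  each block, and commuting with \<open>E\<close> passes to the inverse.\<close>

lemma block_diag_inverse:
  fixes g h :: "'a::field^'n^'n"
  assumes gh: "g ** h = mat 1" "h ** g = mat 1" and g: "block_diag b g"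
  shows "block_diag b h"
  unfolding block_diag_def
proof (intro allI impI)
  fix i j assume ij: "b $ i \<noteq> b $ j"
  define E :: "'a^'n^'n" where "E = diag_mat (\<lambda>k. if b $ k = b $ i then 1 else 0)"
  have "g ** E = E ** g"
    using g by (auto simp: vec_eq_iff E_def diag_mat_mult_left diag_mat_mult_right block_diag_def)
  then have "h ** (g ** E) ** h = h ** (E ** g) ** h" by simp
  then have "(h ** g) ** E ** h = h ** E ** (g ** h)" by (simp add: matrix_mul_assoc)
  then have "E ** h = h ** E" by (simp add: gh)
  then have "(E ** h) $ i $ j = (h ** E) $ i $ j" by simp
  then show "h $ i $ j = 0" using ij by (simp add: E_def diag_mat_mult_left diag_mat_mult_right)
qed

lemma block_det_mult:
  fixes g h :: "'a::field^'n^'n"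
  assumes g: "block_diag b g" and h: "block_diag b h"
  shows "block_det b t (g ** h) = block_det b t g * block_det b t h"
proof -
  \<comment> \<open>The completion by an identity matrix from \<open>block_det\<close>; it is
    multiplicative on block diagonal matrices.\<close>
  define c :: "'a^'n^'n \<Rightarrow> 'a^'n^'n" where
    "c = (\<lambda>g. \<chi> i j. if b$i = t \<and> b$j = t then g$i$j else if i = j then 1 else 0)"
  have "(c g ** c h) $ i $ j = c (g ** h) $ i $ j" for i j
  proof (cases "b $ i = t")
    case i: True
    show ?thesis
    proof (cases "b $ j = t")
      case True
      have "c g $ i $ k * c h $ k $ j = g $ i $ k * h $ k $ j" for k
        using i True g unfolding c_def block_diag_def by (cases "b $ k = t") auto
      then show ?thesis using i True by (simp add: matrix_matrix_mult_def) (simp add: c_def matrix_matrix_mult_def)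
    next
      case False
      then have "c h $ k $ j = (if k = j then 1 else 0)" for k by (auto simp: c_def)
      then have "(c g ** c h) $ i $ j = c g $ i $ j"
        by (simp add: matrix_matrix_mult_def if_distrib[of "\<lambda>x. _ * x"] cong: if_cong)
      then show ?thesis using False by (auto simp: c_def)
    qed
  next
    case False
    then have "c g $ i $ k = (if i = k then 1 else 0)" for k by (auto simp: c_def)
    then have "(c g ** c h) $ i $ j = c h $ i $ j"
      by (simp add: matrix_matrix_mult_def if_distrib[of "\<lambda>x. x * _"] cong: if_cong)
    then show ?thesis using False by (auto simp: c_def)
  qed
  then have "c g ** c h = c (g ** h)" by (simp add: vec_eq_iff)
  then show ?thesis unfolding block_det_def c_def[symmetric]
    using det_mul[of "c g" "c h"] by (simp add: c_def)
qed

lemma block_det_diag_mat: "block_det b t (diag_mat f) = (\<Prod>i\<in>{i. b $ i = t}. f i)"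
proof -
  have "block_det b t (diag_mat f) = (\<Prod>i\<in>UNIV. if b $ i = t then f i else 1)"
    unfolding block_det_def by (subst det_diagonal) (auto simp: diag_mat_def intro!: prod.cong)
  then show ?thesis by (simp add: prod.If_cases)
qed

lemma block_det_one: "block_det b t (mat 1) = 1"
proof -
  have "mat 1 = diag_mat (\<lambda>_. 1)" by (simp add: mat_def diag_mat_def)
  then show ?thesis by (metis block_det_diag_mat prod.neutral_const)
qed

lemma block_det_conj:
  assumes nm: "n ** m = mat 1" "m ** n = mat 1" and m: "block_diag b m"
  shows "block_det b t (n ** diag_mat f ** m) = block_det b t (diag_mat f)"
proof -
  have n: "block_diag b n" using block_diag_inverse[OF nm(2,1) m] .
  have "block_det b t n * block_det b t m = 1"
    using block_det_mult[OF n m, of t] nm by (simp add: block_det_one)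
  then show ?thesis
    by (simp add: block_det_mult n m block_diag_mult block_diag_diag_mat mult_ac)
qed

lemma prod_powi_sum:
  fixes t :: "'a::Fields.field"
  assumes "t \<noteq> 0"
  shows "(\<Prod>i\<in>A. t powi f i) = t powi (\<Sum>i\<in>A. f i)"
  by (induction A rule: infinite_finite_induct) (use assms in \<open>auto simp: power_int_add\<close>)

text \<open>A character evaluated along a cocharacter is \<open>t\<close> to the power of their
  integral pairing; the product over blocks is regrouped as a product over positions.\<close>

lemma torus_character:
  fixes t :: "'a::field" and b :: "real^'n"
  assumes "t \<noteq> 0"
  shows "(\<Prod>s\<in>range (($) b). block_det b s (diag_mat (\<lambda>i. t powi l i)) powi k s) =
    t powi (\<Sum>i\<in>UNIV. l i * k (b $ i))"
proof -
  have "(\<Prod>s\<in>range (($) b). block_det b s (diag_mat (\<lambda>i. t powi l i)) powi k s) =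
     (\<Prod>s\<in>range (($) b). \<Prod>i\<in>{i\<in>UNIV. b $ i = s}. t powi (l i * k (b $ i)))"
  proof (intro prod.cong refl)
    fix s
    have "block_det b s (diag_mat (\<lambda>i. t powi l i)) powi k s = t powi ((\<Sum>i\<in>{i. b $ i = s}. l i) * k s)"
      using assms by (simp add: block_det_diag_mat prod_powi_sum power_int_mult)
    also have "\<dots> = (\<Prod>i\<in>{i\<in>UNIV. b $ i = s}. t powi (l i * k (b $ i)))"
      using assms by (simp add: prod_powi_sum sum_distrib_right)
    finally show "block_det b s (diag_mat (\<lambda>i. t powi l i)) powi k s = (\<Prod>i\<in>{i\<in>UNIV. b $ i = s}. t powi (l i * k (b $ i)))" .
  qed
  also have "\<dots> = (\<Prod>i\<in>UNIV. t powi (l i * k (b $ i)))"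
    by (rule prod.image_gen[symmetric]) simp
  also have "\<dots> = t powi (\<Sum>i\<in>UNIV. l i * k (b $ i))"
    using assms by (simp add: prod_powi_sum)
  finally show ?thesis .
qed

section \<open>Laurent curves in the Zariski topology\<close>

text \<open>Laurent polynomials as functions off 0; the value at 0 is left free, as the curves run
  over the punctured line.\<close>

definition laurent :: "('a::field \<Rightarrow> 'a) \<Rightarrow> bool" where
  "laurent h \<longleftrightarrow> (\<exists>p n. \<forall>t. t \<noteq> 0 \<longrightarrow> h t * t ^ n = poly p t)"

lemma laurent_const: "laurent (\<lambda>_. c)"
  unfolding laurent_def by (intro exI[of _ "[:c:]"] exI[of _ 0]) auto

lemma laurent_add: assumes "laurent f" "laurent h" shows "laurent (\<lambda>t. f t + h t)"
proof -
  obtain p n q m where pq: "\<And>t. t \<noteq> 0 \<Longrightarrow> f t * t ^ n = poly p t" "\<And>t. t \<noteq> 0 \<Longrightarrow> h t * t ^ m = poly q t"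
    using assms unfolding laurent_def by metis
  have "(f t + h t) * t ^ (n + m) = poly (p * Polynomial.monom 1 m + q * Polynomial.monom 1 n) t" if "t \<noteq> 0" for t
    using pq[OF that, symmetric] by (simp add: poly_monom power_add algebra_simps)
  then show ?thesis unfolding laurent_def by blast
qed

lemma laurent_mult: assumes "laurent f" "laurent h" shows "laurent (\<lambda>t. f t * h t)"
proof -
  obtain p n q m where pq: "\<And>t. t \<noteq> 0 \<Longrightarrow> f t * t ^ n = poly p t" "\<And>t. t \<noteq> 0 \<Longrightarrow> h t * t ^ m = poly q t"
    using assms unfolding laurent_def by metis
  have "(f t * h t) * t ^ (n + m) = poly (p * q) t" if "t \<noteq> 0" for t
    using pq[OF that, symmetric] by (simp add: power_add algebra_simps)
  then show ?thesis unfolding laurent_def by blast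
qed

lemma laurent_sum: "(\<And>i. i \<in> A \<Longrightarrow> laurent (f i)) \<Longrightarrow> laurent (\<lambda>t. \<Sum>i\<in>A. f i t)"
  by (induction A rule: infinite_finite_induct) (auto intro: laurent_const laurent_add)

lemma laurent_powi: "laurent (\<lambda>t. t powi k)"
proof (cases "k \<ge> 0")
  case True
  then show ?thesis unfolding laurent_def
    by (intro exI[of _ "Polynomial.monom 1 (nat k)"] exI[of _ 0]) (auto simp: poly_monom power_int_def)
next
  case False
  then show ?thesis unfolding laurent_def
    by (intro exI[of _ 1] exI[of _ "nat (- k)"]) (auto simp: power_int_def field_simps)
qed

lemma laurent_diag_conj: "laurent (\<lambda>t. (n ** diag_mat (\<lambda>i. t powi l i) ** m) $ i $ j)"
proof -
  have e: "(n ** diag_mat (\<lambda>i. t powi l i) ** m) $ i $ j = (\<Sum>k\<in>UNIV. n $ i $ k * t powi l k * m $ k $ j)" for t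
    unfolding matrix_matrix_mult_def[of "n ** _" m] by (simp add: diag_mat_mult_right)
  show ?thesis unfolding e by (intro laurent_sum laurent_mult laurent_const laurent_powi)
qed

lemma laurent_polynomial_fun:
  assumes "polynomial_fun C f" "\<And>c. c \<in> C \<Longrightarrow> laurent (\<lambda>t. c (\<phi> t))"
  shows "laurent (\<lambda>t. f (\<phi> t))"
  using assms by (induction rule: polynomial_fun.induct) (auto intro: laurent_const laurent_add laurent_mult)

text \<open>The non-vanishing sets are not only a subbasis: the intersection of two of them is the
  non-vanishing set of the product.\<close>

lemma zariski_basis:
  assumes "openin (zariski C) U" "x \<in> U"
  shows "\<exists>f. polynomial_fun C f \<and> f x \<noteq> 0 \<and> {y. f y \<noteq> 0} \<subseteq> U"
proof -
  have "generate_topology_on {{x. f x \<noteq> 0} | f. polynomial_fun C f} U"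
    using assms(1) by (simp add: zariski_def openin_topology_generated_by_iff)
  then show ?thesis using assms(2)
  proof (induction arbitrary: x rule: generate_topology_on.induct)
    case (Int a b)
    have x: "x \<in> a" "x \<in> b" using Int.prems by auto
    obtain f where f: "polynomial_fun C f" "f x \<noteq> 0" "{y. f y \<noteq> 0} \<subseteq> a"
      using Int.IH(1)[OF x(1)] by blast
    obtain h where h: "polynomial_fun C h" "h x \<noteq> 0" "{y. h y \<noteq> 0} \<subseteq> b"
      using Int.IH(2)[OF x(2)] by blast
    show ?case
      using f h by (intro exI[of _ "\<lambda>x. f x * h x"] conjI polynomial_fun.mult) auto
  next
    case (UN K)
    then obtain k where "k \<in> K" "x \<in> k" by blast
    then show ?case using UN.IH[of k x] by blast
  qed auto
qed

lemma topspace_zariski: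
  fixes C :: "('a \<Rightarrow> 'b::Fields.field) set"
  shows "topspace (zariski C) = UNIV"
proof -
  have "UNIV = {x. (\<lambda>_. 1) x \<noteq> (0::'b)}" by simp
  then have "UNIV \<in> {{x. f x \<noteq> 0} | f. polynomial_fun C f}"
    using polynomial_fun.const[of C 1] by (intro CollectI exI[of _ "\<lambda>_. 1"]) simp
  then show ?thesis unfolding zariski_def topology_generated_by_topspace by blast
qed

text \<open>The punctured line is irreducible: two functions that are not identically zero on the
  curve become non-zero polynomials in \<open>t\<close>, whose product is non-zero at some
  \<open>t\<close> other than 0. Two open sets that meet the curve therefore meet each other on
  it.\<close>

lemma connectedin_laurent_curve:
  fixes \<phi> :: "'a::alg_closed_field \<Rightarrow> 'v"
  assumes "\<And>c. c \<in> C \<Longrightarrow> laurent (\<lambda>t. c (\<phi> t))"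
  shows "connectedin (zariski C) (\<phi> ` (- {0}))"
  unfolding connectedin
proof (intro conjI notI)
  assume "\<exists>E1 E2. openin (zariski C) E1 \<and> openin (zariski C) E2 \<and> \<phi> ` (- {0}) \<subseteq> E1 \<union> E2 \<and>
    E1 \<inter> E2 \<inter> \<phi> ` (- {0}) = {} \<and> E1 \<inter> \<phi> ` (- {0}) \<noteq> {} \<and> E2 \<inter> \<phi> ` (- {0}) \<noteq> {}"
  then obtain E1 E2 t1 t2 where E: "openin (zariski C) E1" "openin (zariski C) E2"
    "E1 \<inter> E2 \<inter> \<phi> ` (- {0}) = {}" and t: "t1 \<noteq> 0" "\<phi> t1 \<in> E1" "t2 \<noteq> 0" "\<phi> t2 \<in> E2"
    by auto
  obtain f1 f2 where f: "polynomial_fun C f1" "f1 (\<phi> t1) \<noteq> 0" "{y. f1 y \<noteq> 0} \<subseteq> E1"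
    "polynomial_fun C f2" "f2 (\<phi> t2) \<noteq> 0" "{y. f2 y \<noteq> 0} \<subseteq> E2"
    using zariski_basis[OF E(1) t(2)] zariski_basis[OF E(2) t(4)] by auto
  have L: "laurent (\<lambda>t. f (\<phi> t))" if "polynomial_fun C f" for f
    using that assms by (rule laurent_polynomial_fun)
  obtain p1 n1 where p1: "\<And>t. t \<noteq> 0 \<Longrightarrow> f1 (\<phi> t) * t ^ n1 = poly p1 t"
    using L[OF f(1)] unfolding laurent_def by auto
  obtain p2 n2 where p2: "\<And>t. t \<noteq> 0 \<Longrightarrow> f2 (\<phi> t) * t ^ n2 = poly p2 t"
    using L[OF f(4)] unfolding laurent_def by auto
  note p = p1 p2
  have "p1 \<noteq> 0" "p2 \<noteq> 0"
    using p(1)[OF t(1)] p(2)[OF t(3)] f(2,5) t(1,3) by auto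
  then have "p1 * p2 \<noteq> 0" by simp
  then obtain t where "t \<noteq> 0" "poly (p1 * p2) t \<noteq> 0" using poly_eq_0_off_zero by blast
  then have "f1 (\<phi> t) \<noteq> 0" "f2 (\<phi> t) \<noteq> 0" using p[of t] by auto
  then show False using f(3,6) E(3) \<open>t \<noteq> 0\<close> by blast
qed (simp add: topspace_zariski)

text \<open>A limit for \<open>t\<close> tending to 0 without topology: the coordinates are
  polynomials in \<open>t\<close> with value 0 at 0, and a homogeneous polynomial of positive degree
  inherits this.\<close>

lemma homogeneous_along_curve:
  fixes x :: "'a::alg_closed_field \<Rightarrow> 'v"
  assumes "homogeneous_polynomial_fun C d f"
    and "\<And>c. c \<in> C \<Longrightarrow> \<exists>q. (\<forall>t. t \<noteq> 0 \<longrightarrow> c (x t) = poly q t) \<and> poly q 0 = 0"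
  shows "\<exists>q. (\<forall>t. t \<noteq> 0 \<longrightarrow> f (x t) = poly q t) \<and> (d > 0 \<longrightarrow> poly q 0 = 0)"
  using assms
proof (induction rule: homogeneous_polynomial_fun.induct)
  case (const a)
  show ?case by (intro exI[of _ "[:a:]"]) auto
next
  case (zero d)
  show ?case by (intro exI[of _ 0]) auto
next
  case (add d f h)
  then obtain p q where "(\<forall>t. t \<noteq> 0 \<longrightarrow> f (x t) = poly p t) \<and> (d > 0 \<longrightarrow> poly p 0 = 0)"
    "(\<forall>t. t \<noteq> 0 \<longrightarrow> h (x t) = poly q t) \<and> (d > 0 \<longrightarrow> poly q 0 = 0)" by metis
  then show ?case by (intro exI[of _ "p + q"]) auto
next
  case (mult d f e h)
  then obtain p q where "(\<forall>t. t \<noteq> 0 \<longrightarrow> f (x t) = poly p t) \<and> (d > 0 \<longrightarrow> poly p 0 = 0)"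
    "(\<forall>t. t \<noteq> 0 \<longrightarrow> h (x t) = poly q t) \<and> (e > 0 \<longrightarrow> poly q 0 = 0)" by metis
  then show ?case by (intro exI[of _ "p * q"]) auto
qed auto

lemma homogeneous_vanishes_on_null_curve:
  fixes x :: "'a::alg_closed_field \<Rightarrow> 'v"
  assumes "homogeneous_polynomial_fun C d f" "d > 0"
    and "\<And>c. c \<in> C \<Longrightarrow> \<exists>q. (\<forall>t. t \<noteq> 0 \<longrightarrow> c (x t) = poly q t) \<and> poly q 0 = 0"
    and "\<And>t. t \<noteq> 0 \<Longrightarrow> f (x t) = a"
  shows "a = 0"
proof -
  obtain q where q: "\<And>t. t \<noteq> 0 \<Longrightarrow> f (x t) = poly q t" "poly q 0 = 0"
    using homogeneous_along_curve[OF assms(1), of x] assms(2,3) by blast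
  have "q - [:a:] = 0"
    using q(1) assms(4) by (intro poly_eq_0_off_zero) simp
  then show ?thesis using q(2) by simp
qed

definition torus :: "(3 \<Rightarrow> int) \<Rightarrow> (3 \<Rightarrow> int) \<Rightarrow> (2 \<Rightarrow> int) \<Rightarrow> 'a::field \<Rightarrow> 'a grp" where
  "torus l1 l2 l3 t = (diag_mat (\<lambda>i. t powi l1 i), diag_mat (\<lambda>i. t powi l2 i), diag_mat (\<lambda>i. t powi l3 i))"

lemma act_torus: "t \<noteq> 0 \<Longrightarrow> act (torus l1 l2 l3 t) x $ (i, j, l) = t powi (l1 i + l2 j + l3 l) * x $ (i, j, l)"
proof -
  assume t: "t \<noteq> 0"
  have "act_coeff (torus l1 l2 l3 t) (i, j, l) q = (if q = (i, j, l) then t powi (l1 i + l2 j + l3 l) else 0)" for q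
    using t by (cases q) (auto simp: act_coeff_def torus_def diag_mat_def power_int_add)
  then show ?thesis by (simp add: act_nth if_distrib[of "\<lambda>x. x * _"] cong: if_cong)
qed

section \<open>Numerical criterion for semistability\<close>

declare split_paired_All[simp del] split_paired_Ex[simp del]

lemma det_diag_mat_powi:
  assumes "t \<noteq> (0::'a::Fields.field)"
  shows "det (diag_mat (\<lambda>i. t powi l i) :: 'a^'n^'n) = t powi (\<Sum>i\<in>UNIV. l i)"
  by (subst det_diagonal) (use assms in \<open>auto simp: diag_mat_def prod_powi_sum\<close>)

lemma chi_eq:
  "chi \<beta> g = (\<Prod>t\<in>range (($) (fst \<beta>)). block_det (fst \<beta>) t (fst g) powi \<lfloor>chi_scale \<beta> * t\<rfloor>) *
     (\<Prod>t\<in>range (($) (fst (snd \<beta>))). block_det (fst (snd \<beta>)) t (fst (snd g)) powi \<lfloor>chi_scale \<beta> * t\<rfloor>) *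
     (\<Prod>t\<in>range (($) (snd (snd \<beta>))). block_det (snd (snd \<beta>)) t (snd (snd g)) powi \<lfloor>chi_scale \<beta> * t\<rfloor>)"
  by (cases \<beta>; cases g) (simp add: chi_def)

text \<open>The whole curve over the non-zero \<open>t\<close> lies in the kernel that defines
  \<open>G_st_beta\<close>: the sums of the \<open>l\<close> make the determinants 1, and
  orthogonality to \<open>\<beta>\<close> makes \<open>chi\<close> equal to 1. The curve is
  connected and passes through the identity at \<open>t = 1\<close>, so it stays in the identity
  component.\<close>

lemma torus_conj_in_G_st_beta:
  fixes m n :: "'a::alg_closed_field grp"
  assumes \<beta>: "rat_wt \<beta>" "\<beta> \<noteq> 0" and m: "m \<in> M_beta \<beta>" and inv: "grp_inv m n"
    and l: "(\<Sum>i\<in>UNIV. l1 i) = 0" "(\<Sum>i\<in>UNIV. l2 i) = 0" "(\<Sum>i\<in>UNIV. l3 i) = 0"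
      "(\<Sum>i\<in>UNIV. fst \<beta> $ i * of_int (l1 i)) + (\<Sum>i\<in>UNIV. fst (snd \<beta>) $ i * of_int (l2 i)) +
       (\<Sum>i\<in>UNIV. snd (snd \<beta>) $ i * of_int (l3 i)) = 0"
    and t: "t \<noteq> 0"
  shows "grp_mult n (grp_mult (torus l1 l2 l3 t) m) \<in> G_st_beta \<beta>"
proof -
  define \<phi> where "\<phi> = (\<lambda>t. grp_mult n (grp_mult (torus l1 l2 l3 t) m))"
  obtain m1 m2 m3 where m_eq: "m = (m1, m2, m3)" by (cases m)
  obtain n1 n2 n3 where n_eq: "n = (n1, n2, n3)" by (cases n)
  obtain b1 b2 b3 where b_eq: "\<beta> = (b1, b2, b3)" by (cases \<beta>)
  have i: "m1 ** n1 = mat 1" "n1 ** m1 = mat 1" "m2 ** n2 = mat 1" "n2 ** m2 = mat 1"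
    "m3 ** n3 = mat 1" "n3 ** m3 = mat 1"
    using inv by (auto simp: grp_inv_def grp_mult_def m_eq n_eq)
  have bd: "block_diag b1 m1" "block_diag b2 m2" "block_diag b3 m3"
    using m by (auto simp: M_beta_iff m_eq b_eq)
  have bn: "block_diag b1 n1" "block_diag b2 n2" "block_diag b3 n3"
    using block_diag_inverse i bd by blast+
  have \<phi>: "\<phi> t = (n1 ** diag_mat (\<lambda>i. t powi l1 i) ** m1, n2 ** diag_mat (\<lambda>i. t powi l2 i) ** m2,
      n3 ** diag_mat (\<lambda>i. t powi l3 i) ** m3)" for t
    by (simp add: \<phi>_def grp_mult_def m_eq n_eq torus_def matrix_mul_assoc)
  have \<phi>1: "\<phi> 1 = grp_one"
  proof -
    have "diag_mat (\<lambda>_. 1 :: 'a) = (mat 1 :: 'a^3^3)" "diag_mat (\<lambda>_. 1 :: 'a) = (mat 1 :: 'a^2^2)"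
      by (simp_all add: diag_mat_def mat_def)
    then show ?thesis by (simp add: \<phi> i)
  qed
  have mem: "\<phi> t \<in> {g \<in> M_beta \<beta> \<inter> SL332. chi \<beta> g = 1}" if t: "t \<noteq> 0" for t
  proof -
    have dn: "det n1 * det m1 = 1" "det n2 * det m2 = 1" "det n3 * det m3 = 1"
      using i by (metis det_I det_mul)+
    have d: "det (n1 ** diag_mat (\<lambda>i. t powi l1 i) ** m1) = 1" "det (n2 ** diag_mat (\<lambda>i. t powi l2 i) ** m2) = 1"
      "det (n3 ** diag_mat (\<lambda>i. t powi l3 i) ** m3) = 1"
      using dn by (simp_all add: det_mul det_diag_mat_powi[OF t] l)
    define k where "k = (\<lambda>s. \<lfloor>chi_scale \<beta> * s\<rfloor>)"
    have k: "of_int (k s) = chi_scale \<beta> * s" if "s \<in> entries \<beta>" for s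
      using chi_scale_integral[OF \<beta> that] unfolding k_def by (metis Ints_cases floor_of_int)
    have e: "b1 $ i \<in> entries \<beta>" "b2 $ i \<in> entries \<beta>" "b3 $ j \<in> entries \<beta>" for i j
      by (auto simp: entries_def b_eq)
    \<comment> \<open>The floors in \<open>chi\<close> are exact by integrality, so the exponent of
      \<open>t\<close> is \<open>chi_scale \<beta>\<close> times the pairing of
      \<open>\<beta>\<close> with the cocharacter.\<close>
    have "of_int ((\<Sum>i\<in>UNIV. l1 i * k (b1 $ i)) + (\<Sum>i\<in>UNIV. l2 i * k (b2 $ i)) + (\<Sum>i\<in>UNIV. l3 i * k (b3 $ i)))
       = chi_scale \<beta> * ((\<Sum>i\<in>UNIV. b1 $ i * of_int (l1 i)) + (\<Sum>i\<in>UNIV. b2 $ i * of_int (l2 i)) +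
           (\<Sum>i\<in>UNIV. b3 $ i * of_int (l3 i)))"
      by (simp add: k e distrib_left sum_distrib_left mult_ac)
    also have "\<dots> = 0" using l(4) by (simp add: b_eq)
    finally have s0: "(\<Sum>i\<in>UNIV. l1 i * k (b1 $ i)) + (\<Sum>i\<in>UNIV. l2 i * k (b2 $ i)) + (\<Sum>i\<in>UNIV. l3 i * k (b3 $ i)) = 0"
      by (simp only: of_int_eq_0_iff)
    have "chi \<beta> (\<phi> t) = t powi ((\<Sum>i\<in>UNIV. l1 i * k (b1 $ i)) + (\<Sum>i\<in>UNIV. l2 i * k (b2 $ i)) + (\<Sum>i\<in>UNIV. l3 i * k (b3 $ i)))"
      unfolding chi_eq \<phi> using t
      by (simp add: block_det_conj[OF i(2,1) bd(1)] block_det_conj[OF i(4,3) bd(2)]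
          block_det_conj[OF i(6,5) bd(3)] torus_character[OF t] power_int_add k_def b_eq)
    then have chi: "chi \<beta> (\<phi> t) = 1" by (simp add: s0)
    have "\<phi> t \<in> M_beta \<beta>"
      using bd bn d by (auto simp: M_beta_iff b_eq \<phi> GL332_def invertible_det_nz intro!: block_diag_mult block_diag_diag_mat)
    then show ?thesis using chi d by (auto simp: \<phi> SL332_def)
  qed
  have "connectedin (zariski grp_coords) (\<phi> ` (- {0}))"
  proof (rule connectedin_laurent_curve)
    fix c :: "'a grp \<Rightarrow> 'a" assume "c \<in> grp_coords"
    then show "laurent (\<lambda>t. c (\<phi> t))"
      by (auto simp: grp_coords_def \<phi> intro: laurent_diag_conj)
  qed
  then have "connectedin (subtopology (zariski grp_coords) {g \<in> M_beta \<beta> \<inter> SL332. chi \<beta> g = 1}) (\<phi> ` (- {0}))"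
    unfolding connectedin_subtopology using mem by auto
  moreover have "grp_one \<in> \<phi> ` (- {0})" using \<phi>1 by (metis ComplI image_eqI singletonD zero_neq_one)
  ultimately have "\<phi> ` (- {0}) \<subseteq> G_st_beta \<beta>"
    unfolding G_st_beta_def by (rule connected_component_of_maximal)
  then show ?thesis using t by (auto simp: \<phi>_def)
qed

definition supp :: "'a::field tensor \<Rightarrow> (3 \<times> 3 \<times> 2) set" where
  "supp x = {p. x $ p \<noteq> 0}"

lemma act_coeff_M_beta:
  assumes "m \<in> M_beta \<beta>" "act_coeff m p q \<noteq> 0"
  shows "pairing \<beta> p = pairing \<beta> q"
  using assms by (cases p; cases q) (auto simp: M_beta_iff act_coeff_def block_diag_def pairing_def, metis+)

lemma act_M_beta_Z_beta:
  assumes "\<beta> \<in> t_star" "m \<in> M_beta \<beta>" "z \<in> Z_beta \<beta>"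
  shows "act m z \<in> Z_beta \<beta>"
  unfolding Z_beta_iff[OF assms(1)]
proof (intro allI impI)
  fix p assume "act m z $ p \<noteq> 0"
  then obtain q where "act_coeff m p q * z $ q \<noteq> 0" unfolding act_nth by (meson sum.neutral)
  then show "pairing \<beta> p = inner \<beta> \<beta>"
    using act_coeff_M_beta[OF assms(2), of p q] assms(3) by (auto simp: Z_beta_iff[OF assms(1)])
qed

text \<open>The numerical half of the Hilbert-Mumford criterion: if \<open>\<beta>\<close> were not in the convex hull, then a
  conjugate of a cocharacter orthogonal to \<open>\<beta>\<close> would move \<open>z\<close> to \<open>0\<close>, where the invariant vanishes.\<close>
lemma semistable_imp_in_hull:
  fixes z :: "'a::alg_closed_field tensor"
  assumes \<beta>: "rat_wt \<beta>" "\<beta> \<noteq> 0" "\<beta> \<in> t_star" and m: "m \<in> M_beta \<beta>" and z: "z \<in> Z_ss \<beta>"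
  shows "\<beta> \<in> convex hull (wgt ` supp (act m z))"
proof (rule ccontr)
  assume nin: "\<beta> \<notin> convex hull (wgt ` supp (act m z))"
  obtain d f where zZ: "z \<in> Z_beta \<beta>" and f: "d > 0" "homogeneous_polynomial_fun tensor_coords d f"
    "\<And>g x. g \<in> G_st_beta \<beta> \<Longrightarrow> x \<in> Z_beta \<beta> \<Longrightarrow> f (act g x) = f x" "f z \<noteq> 0"
    using z by (auto simp: Z_ss_def)
  have mz: "act m z \<in> Z_beta \<beta>" by (rule act_M_beta_Z_beta[OF \<beta>(3) m zZ])
  obtain n where inv: "grp_inv m n" using m by (auto simp: M_beta_iff GL332_iff_inv)
  have "\<And>p. p \<in> supp (act m z) \<Longrightarrow> pairing \<beta> p = inner \<beta> \<beta>"
    using mz by (simp add: Z_beta_iff[OF \<beta>(3)] supp_def)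
  from destabilizing_cocharacter[OF \<beta>(1,3) this nin]
  obtain l1 l2 l3 where l: "(\<Sum>i\<in>UNIV. l1 i) = 0" "(\<Sum>i\<in>UNIV. l2 i) = 0" "(\<Sum>i\<in>UNIV. l3 i) = 0"
    "(\<Sum>i\<in>UNIV. fst \<beta> $ i * of_int (l1 i)) + (\<Sum>i\<in>UNIV. fst (snd \<beta>) $ i * of_int (l2 i)) +
       (\<Sum>i\<in>UNIV. snd (snd \<beta>) $ i * of_int (l3 i)) = 0"
    and pos: "\<And>i j l. (i, j, l) \<in> supp (act m z) \<Longrightarrow> l1 i + l2 j + l3 l > 0" by auto
  \<comment> \<open>The orbit of \<open>z\<close> under the conjugated one-parameter subgroup: move
    \<open>z\<close> by \<open>m\<close>, contract by the torus, and move back by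
    \<open>n\<close>.\<close>
  define x where "x = (\<lambda>t. act (grp_mult n (grp_mult (torus l1 l2 l3 t) m)) z)"
  have "f z = 0"
  proof (rule homogeneous_vanishes_on_null_curve[OF f(2,1), of x])
    fix t :: 'a assume "t \<noteq> 0"
    then show "f (x t) = f z"
      unfolding x_def by (intro f(3) torus_conj_in_G_st_beta[OF \<beta>(1,2) m inv l] zZ)
  next
    fix c assume "c \<in> (tensor_coords :: ('a tensor \<Rightarrow> 'a) set)"
    then obtain p where c: "c = (\<lambda>x. x $ p)" by (auto simp: tensor_coords_def)
    \<comment> \<open>\<open>nat\<close> truncates nothing here: \<open>q\<close> only uses the
      support of \<open>act m z\<close>, where the exponent is positive.\<close>
    define e where "e = (\<lambda>(i, j, l). nat (l1 i + l2 j + l3 l))"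
    define q where "q = (\<Sum>r\<in>supp (act m z). Polynomial.monom (act_coeff n p r * act m z $ r) (e r))"
    have "c (x t) = poly q t" if t: "t \<noteq> 0" for t
    proof -
      have "c (x t) = (\<Sum>r\<in>UNIV. act_coeff n p r * act (torus l1 l2 l3 t) (act m z) $ r)"
        by (simp add: c x_def act_act[symmetric] act_nth[of n])
      also have "\<dots> = (\<Sum>r\<in>supp (act m z). act_coeff n p r * act (torus l1 l2 l3 t) (act m z) $ r)"
      proof (rule sum.mono_neutral_right)
        show "\<forall>r\<in>UNIV - supp (act m z). act_coeff n p r * act (torus l1 l2 l3 t) (act m z) $ r = 0"
          by (auto simp: act_torus[OF t] supp_def)
      qed auto
      also have "\<dots> = (\<Sum>r\<in>supp (act m z). poly (Polynomial.monom (act_coeff n p r * act m z $ r) (e r)) t)"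
      proof (intro sum.cong refl)
        fix r assume r: "r \<in> supp (act m z)"
        obtain i j l where "r = (i, j, l)" by (cases r)
        then show "act_coeff n p r * act (torus l1 l2 l3 t) (act m z) $ r = poly (Polynomial.monom (act_coeff n p r * act m z $ r) (e r)) t"
          using pos[of i j l] r by (simp add: act_torus[OF t] poly_monom e_def power_int_def)
      qed
      finally show ?thesis by (simp add: q_def poly_sum)
    qed
    moreover have "poly q 0 = 0"
      unfolding q_def poly_sum using pos by (intro sum.neutral) (auto simp: poly_monom e_def dest!: pos)
    ultimately show "\<exists>q. (\<forall>t. t \<noteq> 0 \<longrightarrow> c (x t) = poly q t) \<and> poly q 0 = 0" by blast
  qed
  then show False using f(4) by simp
qed

section \<open>Bruhat decomposition\<close>

text \<open>The type \<open>3\<close> has \<open>3 = 0\<close>, so its own order is not the order of the positions.\<close>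
definition pos3 :: "3 \<Rightarrow> nat" where "pos3 i = (if i = 1 then 1 else if i = 2 then 2 else 3)"
definition pos2 :: "2 \<Rightarrow> nat" where "pos2 i = (if i = 1 then 1 else 2)"

lemma inj_pos3: "inj pos3"
  unfolding inj_def forall_3 by (simp add: pos3_def)

lemma inj_pos2: "inj pos2"
  unfolding inj_def forall_2 by (simp add: pos2_def)

definition lower_triangular :: "('n \<Rightarrow> nat) \<Rightarrow> 'a::field^'n^'n \<Rightarrow> bool" where
  "lower_triangular pos g \<longleftrightarrow> (\<forall>i j. pos i < pos j \<longrightarrow> g $ i $ j = 0) \<and> (\<forall>i. g $ i $ i \<noteq> 0)"

text \<open>\<open>R i\<close> consists of the vectors obtained from row \<open>i\<close> of
  \<open>g\<close> by adding multiples of earlier rows. In each \<open>R i\<close> a vector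
  \<open>h i\<close> whose last non-zero position is as early as possible is chosen. Two rows with
  the same last position would allow the later one to be improved, so the positions
  \<open>\<sigma> i\<close> form a permutation.\<close>

lemma bruhat:
  fixes g :: "'a::field^'n^'n"
  assumes pos: "inj pos" and g: "invertible g"
  obtains u v \<sigma> where "lower_triangular pos u" "lower_triangular pos v" "bij \<sigma>"
    "u ** g = (\<chi> i j. if j = \<sigma> i then 1 else 0) ** v"
proof -
  define R where "R = (\<lambda>i. {r. \<exists>a. a i = 1 \<and> (\<forall>k. pos i < pos k \<longrightarrow> a k = 0) \<and> r = (\<chi> j. \<Sum>k\<in>UNIV. a k * g $ k $ j)})"
  define piv where "piv = (\<lambda>r::'a^'n. Max (pos ` {j. r $ j \<noteq> 0}))"
  have nz: "r \<noteq> 0" if rR: "r \<in> R i" for r i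
  proof
    assume "r = 0"
    obtain a where a: "a i = 1" and r: "r = (\<chi> j. \<Sum>k\<in>UNIV. a k * g $ k $ j)"
      using rR by (auto simp: R_def)
    have "(\<Sum>k\<in>UNIV. a k * g $ k $ j) = 0" for j
      using r \<open>r = 0\<close> by (metis vec_lambda_beta zero_index)
    note a = a this
    have "(\<chi> k. a k) v* g = 0" using a(2) by (simp add: vec_eq_iff vector_matrix_mult_def mult.commute)
    moreover obtain h where "g ** h = mat 1" using g by (auto simp: invertible_def)
    ultimately have "(\<chi> k. a k) = 0"
      by (metis vector_matrix_mul_assoc vector_matrix_mul_rid vector_matrix_mult_0)
    then show False using a(1) by (metis vec_lambda_beta zero_index zero_neq_one)
  qed
  have "\<exists>r. r \<in> R i \<and> (\<forall>s\<in>R i. piv r \<le> piv s)" for i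
  proof -
    have "(\<chi> j. \<Sum>k\<in>UNIV. (if k = i then 1 else 0) * g $ k $ j) \<in> R i"
      using pos unfolding R_def by (intro CollectI exI[of _ "\<lambda>k. if k = i then 1 else 0"]) auto
    then show ?thesis using ex_has_least_nat[of "\<lambda>r. r \<in> R i" _ piv] by blast
  qed
  then obtain h where h: "\<And>i. h i \<in> R i" "\<And>i s. s \<in> R i \<Longrightarrow> piv (h i) \<le> piv s" by metis
  have "\<exists>\<sigma>. h i $ \<sigma> \<noteq> 0 \<and> (\<forall>j. pos \<sigma> < pos j \<longrightarrow> h i $ j = 0) \<and> piv (h i) = pos \<sigma>" for i
  proof -
    have ne: "{j. h i $ j \<noteq> 0} \<noteq> {}" using nz[OF h(1), of i] by (auto simp: vec_eq_iff)
    then have "piv (h i) \<in> pos ` {j. h i $ j \<noteq> 0}" unfolding piv_def by (intro Max_in) auto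
    then obtain j where j: "h i $ j \<noteq> 0" "piv (h i) = pos j" by auto
    have "h i $ k = 0" if "pos j < pos k" for k
    proof (rule ccontr)
      assume "h i $ k \<noteq> 0"
      then have "pos k \<le> piv (h i)" unfolding piv_def by (intro Max_ge) auto
      then show False using that j by simp
    qed
    then show ?thesis using j by auto
  qed
  then obtain \<sigma> where \<sigma>: "\<And>i. h i $ \<sigma> i \<noteq> 0" "\<And>i j. pos (\<sigma> i) < pos j \<Longrightarrow> h i $ j = 0"
    "\<And>i. piv (h i) = pos (\<sigma> i)" by metis
  have ne: "\<sigma> i \<noteq> \<sigma> i'" if lt: "pos i' < pos i" for i i'
  proof
    assume eq: "\<sigma> i = \<sigma> i'"
    \<comment> \<open>Cancels the common pivot; as \<open>i'\<close> comes before \<open>i\<close>,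
      the difference is still in \<open>R i\<close>.\<close>
    define c where "c = h i $ \<sigma> i / h i' $ \<sigma> i"
    define r where "r = h i - c *s h i'"
    obtain a where a: "a i = 1" "\<And>k. pos i < pos k \<Longrightarrow> a k = 0" "h i = (\<chi> j. \<Sum>k\<in>UNIV. a k * g $ k $ j)"
      using h(1)[of i] by (auto simp: R_def)
    obtain a' where a': "\<And>k. pos i' < pos k \<Longrightarrow> a' k = 0" "h i' = (\<chi> j. \<Sum>k\<in>UNIV. a' k * g $ k $ j)"
      using h(1)[of i'] by (auto simp: R_def)
    have rR: "r \<in> R i" unfolding R_def
    proof (intro CollectI exI[of _ "\<lambda>k. a k - c * a' k"] conjI allI impI)
      show "r = (\<chi> j. \<Sum>k\<in>UNIV. (a k - c * a' k) * g $ k $ j)"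
        by (simp add: r_def a(3) a'(2) vec_eq_iff left_diff_distrib sum_subtractf sum_distrib_left mult.assoc)
    qed (use a a' lt in auto)
    have z: "r $ j = 0" if "pos (\<sigma> i) \<le> pos j" for j
    proof (cases "j = \<sigma> i")
      case True
      then show ?thesis using \<sigma>(1)[of i'] eq by (simp add: r_def c_def)
    next
      case False
      then have "pos (\<sigma> i) < pos j" using that pos by (metis injD order_le_less)
      then show ?thesis using \<sigma>(2)[of i j] \<sigma>(2)[of i' j] eq by (simp add: r_def)
    qed
    have "piv r \<in> pos ` {j. r $ j \<noteq> 0}"
      unfolding piv_def using nz[OF rR] by (intro Max_in) (auto simp: vec_eq_iff)
    then have "piv r < pos (\<sigma> i)" using z by (metis (mono_tags, lifting) imageE mem_Collect_eq not_le)
    then show False using h(2)[OF rR] \<sigma>(3)[of i] by simp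
  qed
  then have "inj \<sigma>" using pos by (metis injD injI linorder_neqE_nat)
  then have bij: "bij \<sigma>" by (simp add: bij_def finite_UNIV_inj_surj)
  obtain u where u: "\<And>i. u i i = 1" "\<And>i k. pos i < pos k \<Longrightarrow> u i k = 0" "\<And>i. h i = (\<chi> j. \<Sum>k\<in>UNIV. u i k * g $ k $ j)"
  proof -
    have "\<forall>i. \<exists>a. a i = 1 \<and> (\<forall>k. pos i < pos k \<longrightarrow> a k = 0) \<and> h i = (\<chi> j. \<Sum>k\<in>UNIV. a k * g $ k $ j)"
      using h(1) by (auto simp: R_def)
    from choice[OF this] show ?thesis using that by blast
  qed
  \<comment> \<open>The reduced rows sorted by their pivots, which puts the pivots on the
    diagonal.\<close>
  define v where "v = (\<chi> i. h (inv_into UNIV \<sigma> i))"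
  have "lower_triangular pos (\<chi> i j. u i j)" using u by (simp add: lower_triangular_def)
  moreover have "lower_triangular pos v"
    unfolding lower_triangular_def v_def using \<sigma>(1)[of "inv_into UNIV \<sigma> _"] \<sigma>(2)[of "inv_into UNIV \<sigma> _"] bij
    by (simp add: bij_is_surj surj_f_inv_f)
  moreover have "(\<chi> i j. u i j) ** g = (\<chi> i j. if j = \<sigma> i then 1 else 0) ** v"
    using bij by (simp add: vec_eq_iff matrix_matrix_mult_def v_def if_distrib[of "\<lambda>x. x * _"] bij_is_inj u(3)[symmetric] cong: if_cong)
  ultimately show ?thesis using that bij by blast
qed

section \<open>Disjointness of the strata\<close>

lemma det_lower_triangular_3:
  fixes g :: "'a::field^3^3"
  assumes "\<And>i j. pos3 i < pos3 j \<Longrightarrow> g $ i $ j = 0"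
  shows "det g = g $ 1 $ 1 * g $ 2 $ 2 * g $ 3 $ 3"
proof -
  have "g $ 1 $ 2 = 0" "g $ 1 $ 3 = 0" "g $ 2 $ 3 = 0"
    by (rule assms; simp add: pos3_def)+
  then show ?thesis by (simp add: det_3)
qed

lemma det_lower_triangular_2:
  fixes g :: "'a::field^2^2"
  assumes "\<And>i j. pos2 i < pos2 j \<Longrightarrow> g $ i $ j = 0"
  shows "det g = g $ 1 $ 1 * g $ 2 $ 2"
proof -
  have "g $ 1 $ 2 = 0" by (rule assms; simp add: pos2_def)
  then show ?thesis by (simp add: det_2)
qed

lemma lower_triangular_invertible_3: "lower_triangular pos3 g \<Longrightarrow> invertible g"
  unfolding lower_triangular_def invertible_det_nz by (subst det_lower_triangular_3) auto

lemma lower_triangular_invertible_2: "lower_triangular pos2 g \<Longrightarrow> invertible g"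
  unfolding lower_triangular_def invertible_det_nz by (subst det_lower_triangular_2) auto

definition lower_grp :: "'a::field grp \<Rightarrow> bool" where
  "lower_grp g \<longleftrightarrow> lower_triangular pos3 (fst g) \<and> lower_triangular pos3 (fst (snd g)) \<and> lower_triangular pos2 (snd (snd g))"

lemma lower_grp_GL: "lower_grp g \<Longrightarrow> g \<in> GL332"
  by (cases g) (auto simp: lower_grp_def GL332_def lower_triangular_invertible_3 lower_triangular_invertible_2)

definition perm_grp :: "(3 \<Rightarrow> 3) \<Rightarrow> (3 \<Rightarrow> 3) \<Rightarrow> (2 \<Rightarrow> 2) \<Rightarrow> 'a::field grp" where
  "perm_grp \<sigma> \<tau> \<rho> = ((\<chi> i j. if j = \<sigma> i then 1 else 0), (\<chi> i j. if j = \<tau> i then 1 else 0), (\<chi> i j. if j = \<rho> i then 1 else 0))"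

lemma act_perm_grp: "act (perm_grp \<sigma> \<tau> \<rho>) x $ (i, j, l) = x $ (\<sigma> i, \<tau> j, \<rho> l)"
proof -
  have "act_coeff (perm_grp \<sigma> \<tau> \<rho>) (i, j, l) q = (if q = (\<sigma> i, \<tau> j, \<rho> l) then 1 else (0::'a))" for q
    by (cases q) (auto simp: act_coeff_def perm_grp_def)
  then show ?thesis by (simp add: act_nth if_distrib[of "\<lambda>x. x * _"] cong: if_cong)
qed

lemma bruhat_grp:
  fixes g :: "'a::field grp"
  assumes "g \<in> GL332"
  obtains u v \<sigma> \<tau> \<rho> where "lower_grp u" "lower_grp v" "bij \<sigma>" "bij \<tau>" "bij \<rho>"
    "grp_mult u g = grp_mult (perm_grp \<sigma> \<tau> \<rho>) v"
proof -
  obtain g1 g2 g3 where g: "g = (g1, g2, g3)" "invertible g1" "invertible g2" "invertible g3"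
    using assms by (cases g) (auto simp: GL332_def)
  obtain u1 v1 \<sigma> where 1: "lower_triangular pos3 u1" "lower_triangular pos3 v1" "bij \<sigma>"
    "u1 ** g1 = (\<chi> i j. if j = \<sigma> i then 1 else 0) ** v1" using bruhat[OF inj_pos3 g(2)] .
  obtain u2 v2 \<tau> where 2: "lower_triangular pos3 u2" "lower_triangular pos3 v2" "bij \<tau>"
    "u2 ** g2 = (\<chi> i j. if j = \<tau> i then 1 else 0) ** v2" using bruhat[OF inj_pos3 g(3)] .
  obtain u3 v3 \<rho> where 3: "lower_triangular pos2 u3" "lower_triangular pos2 v3" "bij \<rho>"
    "u3 ** g3 = (\<chi> i j. if j = \<rho> i then 1 else 0) ** v3" using bruhat[OF inj_pos2 g(4)] .
  show ?thesis
    by (rule that[of "(u1, u2, u3)" "(v1, v2, v3)" \<sigma> \<tau> \<rho>])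
       (use 1 2 3 in \<open>auto simp: lower_grp_def grp_mult_def perm_grp_def g(1)\<close>)
qed

section \<open>Lower triangular elements acting on semistable points\<close>

definition levi_mat :: "real^'n \<Rightarrow> 'a::field^'n^'n \<Rightarrow> 'a^'n^'n" where
  "levi_mat b g = (\<chi> i j. if b $ i = b $ j then g $ i $ j else 0)"

text \<open>For \<open>g\<close> in the parabolic subgroup this is its component in the Levi
  subgroup \<open>M_beta \<beta>\<close>.\<close>

definition levi :: "wt \<Rightarrow> 'a::field grp \<Rightarrow> 'a grp" where
  "levi \<beta> g = (levi_mat (fst \<beta>) (fst g), levi_mat (fst (snd \<beta>)) (fst (snd g)), levi_mat (snd (snd \<beta>)) (snd (snd g)))"

lemma lower_triangular_levi_mat: "lower_triangular pos h \<Longrightarrow> lower_triangular pos (levi_mat b h)"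
  by (auto simp: lower_triangular_def levi_mat_def)

lemma GL332_one: "grp_one \<in> GL332"
  unfolding GL332_iff_inv by (intro exI[of _ grp_one]) (simp add: grp_inv_def grp_mult_def)

lemma lower_grp_one: "lower_grp grp_one"
  by (auto simp: lower_grp_def lower_triangular_def mat_def)

lemma levi_in_M_beta: "lower_grp g \<Longrightarrow> levi \<beta> g \<in> M_beta \<beta>"
proof -
  assume g: "lower_grp g"
  have "lower_grp (levi \<beta> g)" using g by (simp add: lower_grp_def levi_def lower_triangular_levi_mat)
  then show ?thesis using lower_grp_GL by (auto simp: M_beta_iff levi_def levi_mat_def block_diag_def)
qed

lemma t_star_plus_mono:
  assumes "\<beta> \<in> t_star_plus"
  shows "pos3 i \<le> pos3 j \<Longrightarrow> fst \<beta> $ i \<le> fst \<beta> $ j" "pos3 i \<le> pos3 j \<Longrightarrow> fst (snd \<beta>) $ i \<le> fst (snd \<beta>) $ j"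
    "pos2 k \<le> pos2 l \<Longrightarrow> snd (snd \<beta>) $ k \<le> snd (snd \<beta>) $ l"
proof -
  obtain a b c where \<beta>: "\<beta> = (a, b, c)" by (cases \<beta>)
  have o: "a $ 1 \<le> a $ 2" "a $ 2 \<le> a $ 3" "b $ 1 \<le> b $ 2" "b $ 2 \<le> b $ 3" "c $ 1 \<le> c $ 2"
    using assms by (auto simp: t_star_plus_def \<beta>)
  have 3: "i = 1 \<or> i = 2 \<or> i = 3" for i :: 3 by (metis exhaust_3)
  have 2: "i = 1 \<or> i = 2" for i :: 2 by (metis exhaust_2)
  show "pos3 i \<le> pos3 j \<Longrightarrow> fst \<beta> $ i \<le> fst \<beta> $ j" "pos3 i \<le> pos3 j \<Longrightarrow> fst (snd \<beta>) $ i \<le> fst (snd \<beta>) $ j"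
    using 3[of i] 3[of j] o by (elim disjE; simp add: \<beta> pos3_def)+
  show "pos2 k \<le> pos2 l \<Longrightarrow> snd (snd \<beta>) $ k \<le> snd (snd \<beta>) $ l"
    using 2[of k] 2[of l] o by (elim disjE; simp add: \<beta> pos2_def)
qed

text \<open>The entries of \<open>\<beta>\<close> are ascending, so a lower triangular matrix moves
  a basis vector only to basis vectors with at least the same pairing. If the pairing stays the
  same, none of the three factors has left its block.\<close>

lemma lower_act_coeff:
  assumes \<beta>: "\<beta> \<in> t_star_plus" and g: "lower_grp g" and nz: "act_coeff g p q \<noteq> 0"
  shows "pairing \<beta> q \<le> pairing \<beta> p"
    and "pairing \<beta> q = pairing \<beta> p \<Longrightarrow> act_coeff (levi \<beta> g) p q = act_coeff g p q"
proof -
  obtain i j l i' j' l' where pq: "p = (i, j, l)" "q = (i', j', l')" by (cases p; cases q)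
  have "fst g $ i $ i' \<noteq> 0" "fst (snd g) $ j $ j' \<noteq> 0" "snd (snd g) $ l $ l' \<noteq> 0"
    using nz by (auto simp: act_coeff_def pq)
  then have "pos3 i' \<le> pos3 i" "pos3 j' \<le> pos3 j" "pos2 l' \<le> pos2 l"
    using g unfolding lower_grp_def lower_triangular_def by (meson not_le)+
  then have le: "fst \<beta> $ i' \<le> fst \<beta> $ i" "fst (snd \<beta>) $ j' \<le> fst (snd \<beta>) $ j" "snd (snd \<beta>) $ l' \<le> snd (snd \<beta>) $ l"
    using t_star_plus_mono[OF \<beta>] by auto
  then show "pairing \<beta> q \<le> pairing \<beta> p" by (simp add: pairing_def pq)
  assume "pairing \<beta> q = pairing \<beta> p"
  then have "fst \<beta> $ i = fst \<beta> $ i'" "fst (snd \<beta>) $ j = fst (snd \<beta>) $ j'" "snd (snd \<beta>) $ l = snd (snd \<beta>) $ l'"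
    using le by (auto simp: pairing_def pq)
  then show "act_coeff (levi \<beta> g) p q = act_coeff g p q"
    by (simp add: act_coeff_def levi_def levi_mat_def pq)
qed

lemma BB_D: "\<beta> \<in> \<BB> \<Longrightarrow> \<beta> \<in> t_star_plus \<and> \<beta> \<in> t_star \<and> \<beta> \<noteq> 0"
  by (auto simp: BB_iff t_star_plus_def)

text \<open>At positions on the supporting hyperplane of \<open>\<beta>\<close>, the component in
  \<open>W_beta\<close> contributes nothing and \<open>g\<close> acts on the component in
  \<open>Z_beta\<close> through its Levi part. So the support of \<open>act g y\<close> contains
  that of \<open>act (levi \<beta> g) z\<close>, and the numerical criterion applies to the
  latter.\<close>

lemma lower_act_Y_ss:
  fixes y :: "'a::alg_closed_field tensor"
  assumes \<beta>: "\<beta> \<in> \<BB>" and y: "y \<in> Y_ss \<beta>" and g: "lower_grp g"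
  shows "\<And>p. p \<in> supp (act g y) \<Longrightarrow> pairing \<beta> p \<ge> inner \<beta> \<beta>"
    and "\<beta> \<in> convex hull (wgt ` supp (act g y))"
proof -
  have bp: "\<beta> \<in> t_star_plus" and bt: "\<beta> \<in> t_star" and b0: "\<beta> \<noteq> 0" using BB_D[OF \<beta>] by auto
  obtain z w where zw: "y = z + w" "z \<in> Z_ss \<beta>" "w \<in> W_beta \<beta>" using y by (auto simp: Y_ss_def)
  have zZ: "z \<in> Z_beta \<beta>" using zw by (simp add: Z_ss_def)
  have z0: "z $ q = 0" if "pairing \<beta> q \<noteq> inner \<beta> \<beta>" for q
    using zZ that unfolding Z_beta_iff[OF bt] by blast
  have w0: "w $ q = 0" if "\<not> pairing \<beta> q > inner \<beta> \<beta>" for q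
    using zw(3) that unfolding W_beta_iff[OF bt] by blast
  have yq: "pairing \<beta> q \<ge> inner \<beta> \<beta>" if "y $ q \<noteq> 0" for q
    using z0[of q] w0[of q] that zw(1) by fastforce
  show ge: "pairing \<beta> p \<ge> inner \<beta> \<beta>" if p: "p \<in> supp (act g y)" for p
  proof -
    have "\<exists>q. act_coeff g p q * y $ q \<noteq> 0"
      using p unfolding supp_def act_nth by (auto dest: sum.not_neutral_contains_not_neutral)
    then obtain q where q: "act_coeff g p q * y $ q \<noteq> 0" ..
    then show ?thesis using lower_act_coeff(1)[OF bp g, of p q] yq[of q] by auto
  qed
  have "supp (act (levi \<beta> g) z) \<subseteq> supp (act g y)"
  proof
    fix p assume p: "p \<in> supp (act (levi \<beta> g) z)"
    have "act (levi \<beta> g) z \<in> Z_beta \<beta>" by (rule act_M_beta_Z_beta[OF bt levi_in_M_beta[OF g] zZ])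
    then have pp: "pairing \<beta> p = inner \<beta> \<beta>" using p unfolding Z_beta_iff[OF bt] supp_def by blast
    have "act_coeff g p q * y $ q = act_coeff (levi \<beta> g) p q * z $ q" for q
    proof (cases "pairing \<beta> q" "inner \<beta> \<beta>" rule: linorder_cases)
      case less
      then show ?thesis using z0[of q] w0[of q] zw(1) by simp
    next
      case equal
      then have yz: "y $ q = z $ q" using w0[of q] zw(1) by simp
      show ?thesis
      proof (cases "act_coeff g p q = 0")
        case True
        then show ?thesis using yz by (cases p; cases q) (auto simp: act_coeff_def levi_def levi_mat_def)
      next
        case False
        then show ?thesis using lower_act_coeff(2)[OF bp g False] equal pp yz by simp
      qed
    next
      case greater
      then have "act_coeff g p q = 0" using lower_act_coeff(1)[OF bp g, of p q] pp by fastforce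
      then show ?thesis using z0[of q] greater by simp
    qed
    then have "act g y $ p = act (levi \<beta> g) z $ p" unfolding act_nth by simp
    then show "p \<in> supp (act g y)" using p by (simp add: supp_def)
  qed
  then have "convex hull (wgt ` supp (act (levi \<beta> g) z)) \<subseteq> convex hull (wgt ` supp (act g y))"
    by (intro hull_mono image_mono)
  then show "\<beta> \<in> convex hull (wgt ` supp (act g y))"
    using semistable_imp_in_hull[OF BB_rat[OF \<beta>] b0 bt levi_in_M_beta[OF g] zw(2)] by blast
qed

definition perm_wt :: "(3 \<Rightarrow> 3) \<Rightarrow> (3 \<Rightarrow> 3) \<Rightarrow> (2 \<Rightarrow> 2) \<Rightarrow> wt \<Rightarrow> wt" where
  "perm_wt \<sigma> \<tau> \<rho> b = ((\<chi> i. fst b $ \<sigma> i), (\<chi> i. fst (snd b) $ \<tau> i), (\<chi> i. snd (snd b) $ \<rho> i))"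

lemma sorted_perm_3:
  fixes a b :: "real^3"
  assumes a: "a $ 1 \<le> a $ 2" "a $ 2 \<le> a $ 3" and b: "b $ 1 \<le> b $ 2" "b $ 2 \<le> b $ 3"
    and \<sigma>: "bij \<sigma>" "\<And>i. b $ i = a $ \<sigma> i"
  shows "a = b"
proof -
  have inj: "\<sigma> 1 \<noteq> \<sigma> 2" "\<sigma> 1 \<noteq> \<sigma> 3" "\<sigma> 2 \<noteq> \<sigma> 3"
    using bij_is_inj[OF \<sigma>(1)] by (simp_all add: inj_eq)
  have c: "\<sigma> i = 1 \<or> \<sigma> i = 2 \<or> \<sigma> i = 3" for i by (metis exhaust_3)
  show ?thesis unfolding vec_eq_iff forall_3
    using c[of 1] c[of 2] c[of 3] inj \<sigma>(2)[of 1] \<sigma>(2)[of 2] \<sigma>(2)[of 3] a b by (elim disjE) auto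
qed

lemma sorted_perm_2:
  fixes a b :: "real^2"
  assumes a: "a $ 1 \<le> a $ 2" and b: "b $ 1 \<le> b $ 2" and \<sigma>: "bij \<sigma>" "\<And>i. b $ i = a $ \<sigma> i"
  shows "a = b"
proof -
  have inj: "\<sigma> 1 \<noteq> \<sigma> 2" using bij_is_inj[OF \<sigma>(1)] by (simp add: inj_eq)
  have c: "\<sigma> i = 1 \<or> \<sigma> i = 2" for i by (metis exhaust_2)
  show ?thesis unfolding vec_eq_iff forall_2
    using c[of 1] c[of 2] inj \<sigma>(2)[of 1] \<sigma>(2)[of 2] a b by (elim disjE) auto
qed

lemma strata_disjoint:
  fixes y y' :: "'a::alg_closed_field tensor"
  assumes \<beta>: "\<beta> \<in> \<BB>" "\<beta>' \<in> \<BB>" and y: "y \<in> Y_ss \<beta>" "y' \<in> Y_ss \<beta>'" and g: "g \<in> GL332" "y' = act g y"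
  shows "\<beta> = \<beta>'"
proof -
  obtain u v \<sigma> \<tau> \<rho> where uv: "lower_grp u" "lower_grp v" and bij: "bij \<sigma>" "bij \<tau>" "bij \<rho>"
    and e: "grp_mult u g = grp_mult (perm_grp \<sigma> \<tau> \<rho>) v"
    using bruhat_grp[OF g(1)] .
  have uy: "act u y' = act (perm_grp \<sigma> \<tau> \<rho>) (act v y)" by (simp add: g(2) act_act e)
  note A = lower_act_Y_ss[OF \<beta>(1) y(1) uv(2)]
  note B = lower_act_Y_ss[OF \<beta>(2) y(2) uv(1)]
  \<comment> \<open>The permutation of the weights belonging to \<open>perm_grp\<close>. The
    inverses occur because \<open>act_perm_grp\<close> permutes the arguments of the
    coordinates.\<close>
  let ?T = "perm_wt (inv_into UNIV \<sigma>) (inv_into UNIV \<tau>) (inv_into UNIV \<rho>)"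
  have lin: "linear ?T" by (auto intro!: linearI simp: perm_wt_def vec_eq_iff)
  have s: "(i, j, l) \<in> supp (act u y') \<longleftrightarrow> (\<sigma> i, \<tau> j, \<rho> l) \<in> supp (act v y)" for i j l
    by (simp add: supp_def uy act_perm_grp)
  have Tw: "?T (wgt (i, j, l)) = wgt (\<sigma> i, \<tau> j, \<rho> l)" for i j l
  proof -
    have "inv_into UNIV \<sigma> m = i \<longleftrightarrow> m = \<sigma> i" "inv_into UNIV \<tau> m = j \<longleftrightarrow> m = \<tau> j"
      "inv_into UNIV \<rho> n = l \<longleftrightarrow> n = \<rho> l" for m n
      using bij by (metis bij_inv_eq_iff)+
    then show ?thesis by (simp add: wgt_def weight_eq perm_wt_def vec_eq_iff)
  qed
  have Tpair: "pairing (?T b) (\<sigma> i, \<tau> j, \<rho> l) = pairing b (i, j, l)" for b i j l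
    using bij by (simp add: pairing_def perm_wt_def bij_is_inj)
  have Tinner: "inner (?T b) (?T b) = inner b b" for b
  proof -
    have r: "(\<Sum>i\<in>UNIV. f (inv_into UNIV \<pi> i)) = (\<Sum>i\<in>UNIV. f i)" if "bij \<pi>" for \<pi> :: "'n::finite \<Rightarrow> 'n" and f :: "'n \<Rightarrow> real"
      using sum.reindex_bij_betw[of "inv_into UNIV \<pi>" UNIV UNIV f] that bij_imp_bij_inv by auto
    show ?thesis
      using r[OF bij(1), of "\<lambda>i. fst b $ i * fst b $ i"] r[OF bij(2), of "\<lambda>i. fst (snd b) $ i * fst (snd b) $ i"]
        r[OF bij(3), of "\<lambda>i. snd (snd b) $ i * snd (snd b) $ i"]
      by (cases b) (simp add: perm_wt_def inner_Pair inner_vec_def)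
  qed
  have sv: "\<exists>i j l. p = (\<sigma> i, \<tau> j, \<rho> l)" for p
    using bij by (cases p) (metis bij_inv_eq_iff)
  have im: "?T ` (wgt ` supp (act u y')) = wgt ` supp (act v y)"
  proof (intro equalityI subsetI)
    fix x assume "x \<in> ?T ` (wgt ` supp (act u y'))"
    then obtain p where p: "p \<in> supp (act u y')" "x = ?T (wgt p)" by auto
    obtain i j l where "p = (i, j, l)" by (cases p)
    then show "x \<in> wgt ` supp (act v y)" using p s Tw by auto
  next
    fix x assume "x \<in> wgt ` supp (act v y)"
    then obtain p where p: "p \<in> supp (act v y)" "x = wgt p" by auto
    obtain i j l where "p = (\<sigma> i, \<tau> j, \<rho> l)" using sv by blast
    then show "x \<in> ?T ` (wgt ` supp (act u y'))"
      using p s[of i j l] Tw[of i j l] by (metis imageI)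
  qed
  have "?T \<beta>' \<in> ?T ` (convex hull (wgt ` supp (act u y')))" using B(2) by blast
  also have "\<dots> = convex hull (wgt ` supp (act v y))"
    using convex_hull_linear_image[OF lin, of "wgt ` supp (act u y')"] im by simp
  finally have h: "?T \<beta>' \<in> convex hull (wgt ` supp (act v y))" .
  have bt: "\<beta> \<in> t_star" "\<beta>' \<in> t_star" using BB_D \<beta> by auto
  have Tt: "?T \<beta>' \<in> t_star" using h hull_wgt_t_star by blast
  \<comment> \<open>Both are the closest point of the same hull, that of the support of
    \<open>act v y\<close>.\<close>
  have "\<beta> = ?T \<beta>'"
  proof (rule min_norm_unique[OF A(2) h])
    fix x assume "x \<in> wgt ` supp (act v y)"
    then show "inner x \<beta> \<ge> inner \<beta> \<beta>" using A(1) by (auto simp: inner_wgt[OF bt(1)])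
  next
    fix x assume "x \<in> wgt ` supp (act v y)"
    then obtain p where p: "p \<in> supp (act v y)" "x = wgt p" by auto
    obtain i j l where ijl: "p = (\<sigma> i, \<tau> j, \<rho> l)" using sv by blast
    then have "pairing \<beta>' (i, j, l) \<ge> inner \<beta>' \<beta>'" using B(1) p s by blast
    then show "inner x (?T \<beta>') \<ge> inner (?T \<beta>') (?T \<beta>')"
      by (simp add: p(2) inner_wgt[OF Tt] Tinner ijl Tpair)
  qed
  then have "fst \<beta> $ i = fst \<beta>' $ inv_into UNIV \<sigma> i" "fst (snd \<beta>) $ i = fst (snd \<beta>') $ inv_into UNIV \<tau> i"
    "snd (snd \<beta>) $ k = snd (snd \<beta>') $ inv_into UNIV \<rho> k" for i k
    by (auto simp: perm_wt_def dest!: arg_cong[of \<beta>])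
  note c = this
  obtain a1 a2 a3 b1 b2 b3 where ab: "\<beta> = (b1, b2, b3)" "\<beta>' = (a1, a2, a3)" by (cases \<beta>; cases \<beta>')
  have p: "\<beta> \<in> t_star_plus" "\<beta>' \<in> t_star_plus" using BB_D \<beta> by auto
  have "a1 = b1"
    by (rule sorted_perm_3[where \<sigma> = "inv_into UNIV \<sigma>"])
       (use p c(1) bij bij_imp_bij_inv in \<open>simp_all add: ab t_star_plus_def\<close>)
  moreover have "a2 = b2"
    by (rule sorted_perm_3[where \<sigma> = "inv_into UNIV \<tau>"])
       (use p c(2) bij bij_imp_bij_inv in \<open>simp_all add: ab t_star_plus_def\<close>)
  moreover have "a3 = b3"
    by (rule sorted_perm_2[where \<sigma> = "inv_into UNIV \<rho>"])
       (use p c(3) bij bij_imp_bij_inv in \<open>simp_all add: ab t_star_plus_def\<close>)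
  ultimately show ?thesis by (simp add: ab)
qed

lemma stratum_unique:
  fixes x :: "'a::alg_closed_field tensor"
  assumes "\<beta> \<in> \<BB>" "\<beta>' \<in> \<BB>" "x \<in> stratum \<beta>" "x \<in> stratum \<beta>'"
  shows "\<beta> = \<beta>'"
proof -
  obtain g y g' y' where x: "x = act g y" "g \<in> GL332" "y \<in> Y_ss \<beta>" "x = act g' y'" "g' \<in> GL332" "y' \<in> Y_ss \<beta>'"
    using assms(3,4) unfolding stratum_def by blast
  obtain h where h: "grp_inv g' h" using x(5) GL332_iff_inv by blast
  then have "y' = act (grp_mult h g) y" by (metis act_act act_inv x(1,4))
  moreover have "grp_mult h g \<in> GL332" using h x(2) GL332_iff_inv GL332_mult grp_inv_sym by blast
  ultimately show ?thesis using strata_disjoint[OF assms(1,2) x(3,6)] by blast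
qed

lemma stratum_act: "x \<in> stratum \<beta> \<Longrightarrow> g \<in> GL332 \<Longrightarrow> act g x \<in> stratum \<beta>"
  unfolding stratum_def using act_act GL332_mult by blast

lemma Z_ss_imp_stratum:
  fixes z :: "'a::alg_closed_field tensor"
  assumes "z \<in> Z_ss \<beta>"
  shows "z \<in> stratum \<beta>"
proof -
  have "z = act grp_one (z + 0)" by (simp add: act_one)
  moreover have "(0 :: 'a tensor) \<in> W_beta \<beta>" by (simp add: W_beta_def vec.span_zero)
  ultimately show ?thesis using assms GL332_one unfolding stratum_def Y_ss_def by blast
qed

lemma zero_not_in_stratum:
  assumes "\<beta> \<in> \<BB>"
  shows "(0 :: 'a::alg_closed_field tensor) \<notin> stratum \<beta>"
proof
  assume "(0 :: 'a tensor) \<in> stratum \<beta>"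
  then obtain g y where y: "y \<in> Y_ss \<beta>" "g \<in> GL332" "act g y = (0 :: 'a tensor)" unfolding stratum_def by force
  then obtain h where "grp_inv g h" using GL332_iff_inv by blast
  then have "y = 0" using y(3) by (metis act_inv act_zero)
  then have "\<beta> \<in> convex hull (wgt ` supp (0 :: 'a tensor))"
    using lower_act_Y_ss(2)[OF assms y(1) lower_grp_one] by (simp add: act_zero)
  then show False by (simp add: supp_def)
qed

text \<open>Any point with a non-vanishing invariant generates its own \<open>\<beta>\<close>, as the weights on its support
  all lie on the supporting hyperplane of \<open>\<beta>\<close>.\<close>
lemma Z_ss_imp_BB:
  fixes z :: "'a::alg_closed_field tensor"
  assumes \<beta>: "rat_wt \<beta>" "\<beta> \<noteq> 0" "\<beta> \<in> t_star_plus" and z: "z \<in> Z_ss \<beta>"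
  shows "\<beta> \<in> \<BB>"
proof -
  have bt: "\<beta> \<in> t_star" using \<beta> by (auto simp: t_star_plus_def)
  have "levi \<beta> (grp_one :: 'a grp) \<in> M_beta \<beta>" by (rule levi_in_M_beta[OF lower_grp_one])
  moreover have "levi \<beta> (grp_one :: 'a grp) = grp_one"
    by (auto simp: levi_def levi_mat_def mat_def vec_eq_iff)
  ultimately have h: "\<beta> \<in> convex hull (wgt ` supp z)"
    using semistable_imp_in_hull[OF \<beta>(1,2) bt _ z, of grp_one] by (simp add: act_one)
  moreover have "pairing \<beta> p = inner \<beta> \<beta>" if "p \<in> supp z" for p
    using z that by (auto simp: Z_ss_def Z_beta_iff[OF bt] supp_def)
  moreover have "supp z \<noteq> {}" using h by auto
  ultimately show ?thesis unfolding BB_iff using \<beta> by (intro conjI exI[of _ "supp z"]) auto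
qed

section \<open>Semi-invariants\<close>

text \<open>One factor of a character of the Levi subgroup. With exponents 1 it is the determinant,
  with the floors of \<open>chi_scale \<beta> * t\<close> it is a factor of
  \<open>chi\<close>.\<close>

definition block_prod :: "real^'n \<Rightarrow> (real \<Rightarrow> int) \<Rightarrow> 'a::field^'n^'n \<Rightarrow> 'a" where
  "block_prod b k g = (\<Prod>t\<in>range (($) b). block_det b t g powi k t)"

definition minor_23 :: "'a::field^3^3 \<Rightarrow> 'a" where
  "minor_23 g = g $ 2 $ 2 * g $ 3 $ 3 - g $ 2 $ 3 * g $ 3 $ 2"

definition minor_12 :: "'a::field^3^3 \<Rightarrow> 'a" where
  "minor_12 g = g $ 1 $ 1 * g $ 2 $ 2 - g $ 1 $ 2 * g $ 2 $ 1"

lemma range_vec_3: "range (($) (b :: real^3)) = {b $ 1, b $ 2, b $ 3}"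
  by (simp add: UNIV_3)

lemma range_vec_2: "range (($) (b :: real^2)) = {b $ 1, b $ 2}"
  by (simp add: UNIV_2)

text \<open>In this and the following names the digits record which entries of the weight agree,
  that is, the shape of the blocks.\<close>

lemma block_122:
  fixes g :: "'a::field^3^3"
  assumes "block_diag (vector [x, y, y]) g" "x \<noteq> y"
  shows "g $ 1 $ 2 = 0" "g $ 1 $ 3 = 0" "g $ 2 $ 1 = 0" "g $ 3 $ 1 = 0"
    "block_prod (vector [x, y, y]) k g = g $ 1 $ 1 powi k x * minor_23 g powi k y"
proof -
  show z: "g $ 1 $ 2 = 0" "g $ 1 $ 3 = 0" "g $ 2 $ 1 = 0" "g $ 3 $ 1 = 0"
    using assms by (simp_all add: block_diag_def forall_3)
  show "block_prod (vector [x, y, y]) k g = g $ 1 $ 1 powi k x * minor_23 g powi k y"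
    using assms(2) by (auto simp: block_prod_def range_vec_3 block_det_def det_3 minor_23_def)
qed

lemma block_112:
  fixes g :: "'a::field^3^3"
  assumes "block_diag (vector [x, x, y]) g" "x \<noteq> y"
  shows "g $ 1 $ 3 = 0" "g $ 2 $ 3 = 0" "g $ 3 $ 1 = 0" "g $ 3 $ 2 = 0"
    "block_prod (vector [x, x, y]) k g = minor_12 g powi k x * g $ 3 $ 3 powi k y"
proof -
  show z: "g $ 1 $ 3 = 0" "g $ 2 $ 3 = 0" "g $ 3 $ 1 = 0" "g $ 3 $ 2 = 0"
    using assms by (simp_all add: block_diag_def forall_3)
  show "block_prod (vector [x, x, y]) k g = minor_12 g powi k x * g $ 3 $ 3 powi k y"
    using assms(2) by (auto simp: block_prod_def range_vec_3 block_det_def det_3 minor_12_def)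
qed

lemma block_123:
  fixes g :: "'a::field^3^3"
  assumes "block_diag (vector [x, y, z]) g" "x \<noteq> y" "y \<noteq> z" "x \<noteq> z"
  shows "g $ 1 $ 2 = 0" "g $ 1 $ 3 = 0" "g $ 2 $ 1 = 0" "g $ 3 $ 1 = 0" "g $ 2 $ 3 = 0" "g $ 3 $ 2 = 0"
    "block_prod (vector [x, y, z]) k g = g $ 1 $ 1 powi k x * g $ 2 $ 2 powi k y * g $ 3 $ 3 powi k z"
proof -
  show z: "g $ 1 $ 2 = 0" "g $ 1 $ 3 = 0" "g $ 2 $ 1 = 0" "g $ 3 $ 1 = 0" "g $ 2 $ 3 = 0" "g $ 3 $ 2 = 0"
    using assms by (simp_all add: block_diag_def forall_3)
  show "block_prod (vector [x, y, z]) k g = g $ 1 $ 1 powi k x * g $ 2 $ 2 powi k y * g $ 3 $ 3 powi k z"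
    using assms(2-4) by (auto simp: block_prod_def range_vec_3 block_det_def det_3)
qed

lemma block_111:
  fixes g :: "'a::field^3^3"
  shows "block_prod (vector [x, x, x]) k g = det g powi k x"
  by (simp add: block_prod_def range_vec_3 block_det_def det_3)

lemma block_12:
  fixes g :: "'a::field^2^2"
  assumes "block_diag (vector [x, y]) g" "x \<noteq> y"
  shows "g $ 1 $ 2 = 0" "g $ 2 $ 1 = 0"
    "block_prod (vector [x, y]) k g = g $ 1 $ 1 powi k x * g $ 2 $ 2 powi k y"
proof -
  show z: "g $ 1 $ 2 = 0" "g $ 2 $ 1 = 0"
    using assms by (simp_all add: block_diag_def forall_2)
  show "block_prod (vector [x, y]) k g = g $ 1 $ 1 powi k x * g $ 2 $ 2 powi k y"
    using assms(2) by (auto simp: block_prod_def range_vec_2 block_det_def det_2)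
qed

lemma block_11:
  fixes g :: "'a::field^2^2"
  shows "block_prod (vector [x, x]) k g = det g powi k x"
  by (simp add: block_prod_def range_vec_2 block_det_def det_2)

lemma hom_coord: "homogeneous_polynomial_fun tensor_coords 1 (\<lambda>x. x $ p)"
  by (rule homogeneous_polynomial_fun.coord) (auto simp: tensor_coords_def)

lemma hom_cmult: "homogeneous_polynomial_fun C d f \<Longrightarrow> homogeneous_polynomial_fun C d (\<lambda>x. a * f x)"
  using homogeneous_polynomial_fun.mult[OF homogeneous_polynomial_fun.const] by fastforce

lemma hom_diff: "homogeneous_polynomial_fun C d f \<Longrightarrow> homogeneous_polynomial_fun C d h \<Longrightarrow>
    homogeneous_polynomial_fun C d (\<lambda>x. f x - h x)"
  using homogeneous_polynomial_fun.add[of C d f, OF _ hom_cmult[of C d h "-1"]] by simp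

lemma hom_power: "homogeneous_polynomial_fun C d f \<Longrightarrow> homogeneous_polynomial_fun C (n * d) (\<lambda>x. f x ^ n)"
proof (induction n)
  case 0
  show ?case using homogeneous_polynomial_fun.const[of C 1] by simp
next
  case (Suc n)
  then show ?case using homogeneous_polynomial_fun.mult[of C d f "n * d"] by simp
qed

lemma hom_numeral: "homogeneous_polynomial_fun C d f \<Longrightarrow> homogeneous_polynomial_fun C d (\<lambda>x. numeral n * f x)"
  by (rule hom_cmult)

lemmas hom_intros = hom_numeral hom_diff homogeneous_polynomial_fun.add hom_power homogeneous_polynomial_fun.mult hom_coord

definition mk_wt :: "real \<Rightarrow> real \<Rightarrow> real \<Rightarrow> real \<Rightarrow> real \<Rightarrow> real \<Rightarrow> real \<Rightarrow> real \<Rightarrow> wt" where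
  "mk_wt a1 a2 a3 b1 b2 b3 c1 c2 = (vector [a1, a2, a3], vector [b1, b2, b3], vector [c1, c2])"

definition tens :: "(3 \<times> 3 \<times> 2) set \<Rightarrow> 'a::field tensor" where
  "tens S = (\<chi> p. if p \<in> S then 1 else 0)"

lemma act_expand: "act (g1, g2, g3) x $ (i, j, l) = (\<Sum>i'\<in>UNIV. \<Sum>j'\<in>UNIV. \<Sum>l'\<in>UNIV. g1$i$i' * g2$j$j' * g3$l$l' * x$(i', j', l'))"
  by (simp add: act_def)

lemma mk_wt_t_star: "mk_wt a1 a2 a3 b1 b2 b3 c1 c2 \<in> t_star \<longleftrightarrow> a1 + a2 + a3 = 0 \<and> b1 + b2 + b3 = 0 \<and> c1 + c2 = 0"
  by (simp add: mk_wt_def t_star_def sum_3 sum_2)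

lemma mk_wt_t_star_plus: "mk_wt a1 a2 a3 b1 b2 b3 c1 c2 \<in> t_star_plus \<longleftrightarrow>
    a1 + a2 + a3 = 0 \<and> b1 + b2 + b3 = 0 \<and> c1 + c2 = 0 \<and> a1 \<le> a2 \<and> a2 \<le> a3 \<and> b1 \<le> b2 \<and> b2 \<le> b3 \<and> c1 \<le> c2"
  by (simp add: mk_wt_def t_star_plus_def t_star_def sum_3 sum_2)

lemma mk_wt_rat: "rat_wt (mk_wt a1 a2 a3 b1 b2 b3 c1 c2) \<longleftrightarrow>
    a1 \<in> \<rat> \<and> a2 \<in> \<rat> \<and> a3 \<in> \<rat> \<and> b1 \<in> \<rat> \<and> b2 \<in> \<rat> \<and> b3 \<in> \<rat> \<and> c1 \<in> \<rat> \<and> c2 \<in> \<rat>"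
  by (simp add: mk_wt_def rat_wt_def forall_3 forall_2)

lemma mk_wt_entries: "entries (mk_wt a1 a2 a3 b1 b2 b3 c1 c2) = {a1, a2, a3, b1, b2, b3, c1, c2}"
  by (auto simp: mk_wt_def entries_def range_vec_3 range_vec_2)

lemma mk_wt_eq: "mk_wt a1 a2 a3 b1 b2 b3 c1 c2 = mk_wt a1' a2' a3' b1' b2' b3' c1' c2' \<longleftrightarrow>
    a1 = a1' \<and> a2 = a2' \<and> a3 = a3' \<and> b1 = b1' \<and> b2 = b2' \<and> b3 = b3' \<and> c1 = c1' \<and> c2 = c2'"
  by (simp add: mk_wt_def vec_eq_iff forall_3 forall_2)

lemma mk_wt_eq_0: "mk_wt a1 a2 a3 b1 b2 b3 c1 c2 = 0 \<longleftrightarrow>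
    a1 = 0 \<and> a2 = 0 \<and> a3 = 0 \<and> b1 = 0 \<and> b2 = 0 \<and> b3 = 0 \<and> c1 = 0 \<and> c2 = 0"
  by (simp add: mk_wt_def vec_eq_iff forall_3 forall_2 zero_prod_def)

lemma mk_wt_inner: "inner (mk_wt a1 a2 a3 b1 b2 b3 c1 c2) (mk_wt a1 a2 a3 b1 b2 b3 c1 c2) =
   a1 * a1 + a2 * a2 + a3 * a3 + (b1 * b1 + b2 * b2 + b3 * b3) + (c1 * c1 + c2 * c2)"
  by (simp add: mk_wt_def inner_Pair inner_vec_def sum_3 sum_2)

lemma tens_Z_beta:
  assumes "\<beta> \<in> t_star" "\<And>p. p \<in> S \<Longrightarrow> pairing \<beta> p = inner \<beta> \<beta>"
  shows "tens S \<in> Z_beta \<beta>"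
  using assms by (auto simp: Z_beta_iff tens_def)

text \<open>The action is a composition of three actions on one index each, so semi-invariance can
  be checked factor by factor. The other two index types are left general, so that exchanging the
  first two indices turns \<open>act_1\<close> into \<open>act_2\<close>.\<close>

definition act_1 :: "'a::field^3^3 \<Rightarrow> (3 \<Rightarrow> 'b \<Rightarrow> 'c \<Rightarrow> 'a) \<Rightarrow> 3 \<Rightarrow> 'b \<Rightarrow> 'c \<Rightarrow> 'a" where
  "act_1 g y i j l = g $ i $ 1 * y 1 j l + g $ i $ 2 * y 2 j l + g $ i $ 3 * y 3 j l"

definition act_2 :: "'a::field^3^3 \<Rightarrow> ('b \<Rightarrow> 3 \<Rightarrow> 'c \<Rightarrow> 'a) \<Rightarrow> 'b \<Rightarrow> 3 \<Rightarrow> 'c \<Rightarrow> 'a" where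
  "act_2 g y i j l = g $ j $ 1 * y i 1 l + g $ j $ 2 * y i 2 l + g $ j $ 3 * y i 3 l"

definition act_3 :: "'a::field^2^2 \<Rightarrow> ('b \<Rightarrow> 'c \<Rightarrow> 2 \<Rightarrow> 'a) \<Rightarrow> 'b \<Rightarrow> 'c \<Rightarrow> 2 \<Rightarrow> 'a" where
  "act_3 g y i j l = g $ l $ 1 * y i j 1 + g $ l $ 2 * y i j 2"

lemma act_factor: "act (g1, g2, g3) x $ (i, j, l) = act_1 g1 (act_2 g2 (act_3 g3 (\<lambda>i j l. x $ (i, j, l)))) i j l"
  by (simp add: act_expand sum_3 sum_2 act_1_def act_2_def act_3_def algebra_simps)

definition vdet :: "(3 \<Rightarrow> 'a::field) \<Rightarrow> (3 \<Rightarrow> 'a) \<Rightarrow> (3 \<Rightarrow> 'a) \<Rightarrow> 'a" where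
  "vdet u v w = u 1 * (v 2 * w 3 - v 3 * w 2) - u 2 * (v 1 * w 3 - v 3 * w 1) + u 3 * (v 1 * w 2 - v 2 * w 1)"

text \<open>The Pluecker coordinates of the four columns form a \<open>2 \<times> 2\<close> matrix (up to signs), whose determinant is
  the invariant corresponding under castling to the determinant on \<open>2 \<times> 2\<close> matrices.\<close>
definition castling_inv :: "(3 \<Rightarrow> 3 \<Rightarrow> 2 \<Rightarrow> 'a::field) \<Rightarrow> 'a" where
  "castling_inv y =
     vdet (\<lambda>i. y i 2 2) (\<lambda>i. y i 3 1) (\<lambda>i. y i 3 2) * vdet (\<lambda>i. y i 2 1) (\<lambda>i. y i 2 2) (\<lambda>i. y i 3 1) -
     vdet (\<lambda>i. y i 2 1) (\<lambda>i. y i 3 1) (\<lambda>i. y i 3 2) * vdet (\<lambda>i. y i 2 1) (\<lambda>i. y i 2 2) (\<lambda>i. y i 3 2)"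

lemma vdet_act_1: "vdet (\<lambda>i. act_1 g y i a b) (\<lambda>i. act_1 g y i c d) (\<lambda>i. act_1 g y i e f) =
    det g * vdet (\<lambda>i. y i a b) (\<lambda>i. y i c d) (\<lambda>i. y i e f)"
  by (simp add: vdet_def act_1_def det_3 algebra_simps)

lemma castling_inv_act_1: "castling_inv (act_1 g y) = det g ^ 2 * castling_inv y"
  by (simp only: castling_inv_def vdet_act_1) (simp add: algebra_simps power2_eq_square)

text \<open>A factor of size two mixes the four columns in two pairs, and any three columns contain
  one full pair. That pair contributes a \<open>2 \<times> 2\<close> determinant; the digits give
  its position in \<open>vdet\<close>.\<close>

lemma vdet_pair_12:
  "vdet (\<lambda>i. a * u i + b * v i) (\<lambda>i. c * u i + d * v i) (\<lambda>i. e * s i + f * t i) =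
     (a * d - b * c) * (e * vdet u v s + f * vdet u v t)"
  by (simp add: vdet_def algebra_simps)

lemma vdet_pair_13:
  "vdet (\<lambda>i. a * u i + b * v i) (\<lambda>i. e * s i + f * t i) (\<lambda>i. c * u i + d * v i) =
     (a * d - b * c) * (e * vdet u s v + f * vdet u t v)"
  by (simp add: vdet_def algebra_simps)

lemma vdet_pair_23:
  "vdet (\<lambda>i. e * s i + f * t i) (\<lambda>i. a * u i + b * v i) (\<lambda>i. c * u i + d * v i) =
     (a * d - b * c) * (e * vdet s u v + f * vdet t u v)"
  by (simp add: vdet_def algebra_simps)

lemma castling_inv_act_2:
  assumes "g $ 2 $ 1 = 0" "g $ 3 $ 1 = 0"
  shows "castling_inv (act_2 g y) = minor_23 g ^ 3 * castling_inv y"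
proof -
  define v1 v2 v3 v4 where v: "v1 = (\<lambda>i. y i 2 1)" "v2 = (\<lambda>i. y i 2 2)" "v3 = (\<lambda>i. y i 3 1)" "v4 = (\<lambda>i. y i 3 2)"
  have a: "(\<lambda>i. act_2 g y i 2 1) = (\<lambda>i. g$2$2 * v1 i + g$2$3 * v3 i)" "(\<lambda>i. act_2 g y i 2 2) = (\<lambda>i. g$2$2 * v2 i + g$2$3 * v4 i)"
    "(\<lambda>i. act_2 g y i 3 1) = (\<lambda>i. g$3$2 * v1 i + g$3$3 * v3 i)" "(\<lambda>i. act_2 g y i 3 2) = (\<lambda>i. g$3$2 * v2 i + g$3$3 * v4 i)"
    by (auto simp: act_2_def assms v)
  \<comment> \<open>Brings the minors to increasing order of the columns, so that only four of them
    remain.\<close>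
  have s: "vdet v2 v4 v1 = vdet v1 v2 v4" "vdet v2 v4 v3 = - vdet v2 v3 v4" "vdet v1 v3 v2 = - vdet v1 v2 v3"
    "vdet v2 v1 v4 = - vdet v1 v2 v4" "vdet v3 v2 v4 = - vdet v2 v3 v4" "vdet v1 v4 v3 = - vdet v1 v3 v4"
    by (simp_all add: vdet_def algebra_simps)
  show ?thesis
    unfolding castling_inv_def a vdet_pair_12 vdet_pair_13 vdet_pair_23 v[symmetric] s minor_23_def
    by (simp add: algebra_simps power3_eq_cube)
qed

lemma castling_inv_act_3: "castling_inv (act_3 g y) = det g ^ 3 * castling_inv y"
proof -
  define v1 v2 v3 v4 where v: "v1 = (\<lambda>i. y i 2 1)" "v2 = (\<lambda>i. y i 2 2)" "v3 = (\<lambda>i. y i 3 1)" "v4 = (\<lambda>i. y i 3 2)"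
  have a: "(\<lambda>i. act_3 g y i 2 1) = (\<lambda>i. g$1$1 * v1 i + g$1$2 * v2 i)" "(\<lambda>i. act_3 g y i 2 2) = (\<lambda>i. g$2$1 * v1 i + g$2$2 * v2 i)"
    "(\<lambda>i. act_3 g y i 3 1) = (\<lambda>i. g$1$1 * v3 i + g$1$2 * v4 i)" "(\<lambda>i. act_3 g y i 3 2) = (\<lambda>i. g$2$1 * v3 i + g$2$2 * v4 i)"
    by (auto simp: act_3_def v)
  show ?thesis
    unfolding castling_inv_def a vdet_pair_12 vdet_pair_23 v[symmetric] det_2
    by (simp add: algebra_simps power3_eq_cube)
qed

lemma castling_inv_act_1_swap:
  assumes "g $ 2 $ 1 = 0" "g $ 3 $ 1 = 0"
  shows "castling_inv (\<lambda>j i. act_1 g y i j) = minor_23 g ^ 3 * castling_inv (\<lambda>j i. y i j)"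
proof -
  have "(\<lambda>j i. act_1 g y i j) = act_2 g (\<lambda>j i. y i j)" by (simp add: act_1_def act_2_def fun_eq_iff)
  then show ?thesis by (simp add: castling_inv_act_2 assms)
qed

lemma castling_inv_act_2_swap: "castling_inv (\<lambda>j i. act_2 g y i j) = det g ^ 2 * castling_inv (\<lambda>j i. y i j)"
proof -
  have "(\<lambda>j i. act_2 g y i j) = act_1 g (\<lambda>j i. y i j)" by (simp add: act_1_def act_2_def fun_eq_iff)
  then show ?thesis by (simp add: castling_inv_act_1)
qed

lemma castling_inv_act_3_swap: "castling_inv (\<lambda>j i. act_3 g y i j) = det g ^ 3 * castling_inv (\<lambda>j i. y i j)"
proof -
  have "(\<lambda>j i. act_3 g y i j) = act_3 g (\<lambda>j i. y i j)" by (simp add: act_3_def fun_eq_iff)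
  then show ?thesis by (simp add: castling_inv_act_3)
qed

text \<open>Cayley's hyperdeterminant of the \<open>2 \<times> 2 \<times> 2\<close> block: the discriminant of the binary quadratic form
  \<open>det (s A + t B)\<close>.\<close>
definition hyperdet :: "(3 \<Rightarrow> 3 \<Rightarrow> 2 \<Rightarrow> 'a::field) \<Rightarrow> 'a" where
  "hyperdet y = (y 2 2 1 * y 3 3 2 + y 2 2 2 * y 3 3 1 - y 2 3 1 * y 3 2 2 - y 2 3 2 * y 3 2 1) ^ 2 -
     4 * ((y 2 2 1 * y 3 3 1 - y 2 3 1 * y 3 2 1) * (y 2 2 2 * y 3 3 2 - y 2 3 2 * y 3 2 2))"

lemma hyperdet_act_1:
  assumes "g $ 2 $ 1 = 0" "g $ 3 $ 1 = 0"
  shows "hyperdet (act_1 g y) = minor_23 g ^ 2 * hyperdet y"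
  by (simp add: hyperdet_def act_1_def minor_23_def assms algebra_simps power2_eq_square)

lemma hyperdet_act_2:
  assumes "g $ 2 $ 1 = 0" "g $ 3 $ 1 = 0"
  shows "hyperdet (act_2 g y) = minor_23 g ^ 2 * hyperdet y"
  by (simp add: hyperdet_def act_2_def minor_23_def assms algebra_simps power2_eq_square)

lemma hyperdet_act_3: "hyperdet (act_3 g y) = det g ^ 2 * hyperdet y"
  by (simp add: hyperdet_def act_3_def det_2 algebra_simps power2_eq_square)

section \<open>Characters of block diagonal matrices\<close>

lemma block_prod_one_3:
  fixes g :: "'a::field^3^3"
  assumes "block_diag b g"
  shows "block_prod b (\<lambda>_. 1) g = det g"
  using assms
  by (cases "b $ 1 = b $ 2"; cases "b $ 1 = b $ 3"; cases "b $ 2 = b $ 3")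
    (auto simp: block_prod_def block_diag_def range_vec_3 block_det_def forall_3 det_3 insert_commute algebra_simps)

lemma block_prod_one_2:
  fixes g :: "'a::field^2^2"
  assumes "block_diag b g"
  shows "block_prod b (\<lambda>_. 1) g = det g"
  using assms
  by (cases "b $ 1 = b $ 2") (auto simp: block_prod_def block_diag_def range_vec_2 block_det_def forall_2 det_2)

lemma block_prod_nonzero:
  assumes "block_prod b (\<lambda>_. 1) g = 1" "t \<in> range (($) b)"
  shows "block_det b t g \<noteq> 0"
  using assms prod_zero[of "range (($) b)" "\<lambda>t. block_det b t g"] by (auto simp: block_prod_def)

text \<open>Exponents may be negative or cancel, so they add up only if the block determinants are
  non-zero; determinant 1 ensures this.\<close>

lemma block_prod_add:
  assumes "block_prod b (\<lambda>_. 1) g = 1"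
  shows "block_prod b (\<lambda>s. e s + e' s) g = block_prod b e g * block_prod b e' g"
  using block_prod_nonzero[OF assms] by (simp add: block_prod_def power_int_add flip: prod.distrib)

lemma prod_powi: "(\<Prod>x\<in>A. (f x :: 'a::field)) powi n = (\<Prod>x\<in>A. f x powi n)"
  by (induction A rule: infinite_finite_induct) (simp_all add: power_int_mult_distrib)

lemma block_prod_mult: "block_prod b (\<lambda>s. n * e s) g = block_prod b e g powi n"
  by (simp add: block_prod_def prod_powi power_int_mult[of _ "e _" n] mult.commute[of n])

text \<open>The condition on \<open>block_prod\<close> restricts \<open>g\<close> to determinant 1,
  so the exponents matter only up to a common constant.\<close>

definition scales :: "('a::field^'n^'n \<Rightarrow> 'y \<Rightarrow> 'y) \<Rightarrow> real^'n \<Rightarrow> (real \<Rightarrow> int) \<Rightarrow> ('y \<Rightarrow> 'a) \<Rightarrow> bool" where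
  "scales A b e f \<longleftrightarrow> (\<forall>g y. block_diag b g \<longrightarrow> block_prod b (\<lambda>_. 1) g = 1 \<longrightarrow> f (A g y) = block_prod b e g * f y)"

lemma scales_mult: "scales A b e f \<Longrightarrow> scales A b e' f' \<Longrightarrow> scales A b (\<lambda>s. e s + e' s) (\<lambda>y. f y * f' y)"
  by (simp add: scales_def block_prod_add)

lemma scales_power: "scales A b e f \<Longrightarrow> scales A b (\<lambda>s. int n * e s) (\<lambda>y. f y ^ n)"
  by (simp add: scales_def block_prod_mult power_mult_distrib)

definition exp2 :: "real \<Rightarrow> int \<Rightarrow> int \<Rightarrow> real \<Rightarrow> int" where
  "exp2 x p q s = (if s = x then p else q)"

definition exp3 :: "real \<Rightarrow> real \<Rightarrow> int \<Rightarrow> int \<Rightarrow> int \<Rightarrow> real \<Rightarrow> int" where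
  "exp3 x y p q r s = (if s = x then p else if s = y then q else r)"

lemma scales_122:
  fixes A :: "'a::field^3^3 \<Rightarrow> 'y \<Rightarrow> 'y"
  assumes "x \<noteq> y" and "\<And>g u. g $ 1 $ 2 = 0 \<Longrightarrow> g $ 1 $ 3 = 0 \<Longrightarrow> g $ 2 $ 1 = 0 \<Longrightarrow> g $ 3 $ 1 = 0 \<Longrightarrow>
    f (A g u) = g $ 1 $ 1 powi p * minor_23 g powi q * f u"
  shows "scales A (vector [x, y, y]) (exp2 x p q) f"
  using assms by (auto simp: scales_def exp2_def block_122)

lemma scales_112:
  fixes A :: "'a::field^3^3 \<Rightarrow> 'y \<Rightarrow> 'y"
  assumes "x \<noteq> y" and "\<And>g u. g $ 1 $ 3 = 0 \<Longrightarrow> g $ 2 $ 3 = 0 \<Longrightarrow> g $ 3 $ 1 = 0 \<Longrightarrow> g $ 3 $ 2 = 0 \<Longrightarrow>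
    f (A g u) = minor_12 g powi p * g $ 3 $ 3 powi q * f u"
  shows "scales A (vector [x, x, y]) (exp2 x p q) f"
  using assms by (auto simp: scales_def exp2_def block_112)

lemma scales_123:
  fixes A :: "'a::field^3^3 \<Rightarrow> 'y \<Rightarrow> 'y"
  assumes "x \<noteq> y" "y \<noteq> z" "x \<noteq> z" and "\<And>g u. g $ 1 $ 2 = 0 \<Longrightarrow> g $ 1 $ 3 = 0 \<Longrightarrow> g $ 2 $ 1 = 0 \<Longrightarrow>
    g $ 3 $ 1 = 0 \<Longrightarrow> g $ 2 $ 3 = 0 \<Longrightarrow> g $ 3 $ 2 = 0 \<Longrightarrow>
    f (A g u) = g $ 1 $ 1 powi p * g $ 2 $ 2 powi q * g $ 3 $ 3 powi r * f u"
  shows "scales A (vector [x, y, z]) (exp3 x y p q r) f"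
  using assms by (auto simp: scales_def exp3_def block_123)

lemma scales_111:
  fixes A :: "'a::field^3^3 \<Rightarrow> 'y \<Rightarrow> 'y"
  assumes "\<And>g u. f (A g u) = det g powi p * f u"
  shows "scales A (vector [x, x, x]) (\<lambda>_. p) f"
  using assms by (simp add: scales_def block_111)

lemma scales_12:
  fixes A :: "'a::field^2^2 \<Rightarrow> 'y \<Rightarrow> 'y"
  assumes "x \<noteq> y" and "\<And>g u. g $ 1 $ 2 = 0 \<Longrightarrow> g $ 2 $ 1 = 0 \<Longrightarrow>
    f (A g u) = g $ 1 $ 1 powi p * g $ 2 $ 2 powi q * f u"
  shows "scales A (vector [x, y]) (exp2 x p q) f"
  using assms by (auto simp: scales_def exp2_def block_12)

lemma scales_11:
  fixes A :: "'a::field^2^2 \<Rightarrow> 'y \<Rightarrow> 'y"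
  assumes "\<And>g u. f (A g u) = det g powi p * f u"
  shows "scales A (vector [x, x]) (\<lambda>_. p) f"
  using assms by (simp add: scales_def block_11)

text \<open>The exponents of the character of \<open>f\<close> are indexed by the entries of \<open>\<beta>\<close>, that is, by the blocks.\<close>
definition semi_inv :: "wt \<Rightarrow> nat \<Rightarrow> (real \<Rightarrow> int) \<Rightarrow> (real \<Rightarrow> int) \<Rightarrow> (real \<Rightarrow> int) \<Rightarrow>
    ((3 \<Rightarrow> 3 \<Rightarrow> 2 \<Rightarrow> 'a::field) \<Rightarrow> 'a) \<Rightarrow> bool" where
  "semi_inv \<beta> d e1 e2 e3 f \<longleftrightarrow> homogeneous_polynomial_fun tensor_coords d (\<lambda>x. f (\<lambda>i j l. x $ (i, j, l))) \<and>
     scales act_1 (fst \<beta>) e1 f \<and> scales act_2 (fst (snd \<beta>)) e2 f \<and> scales act_3 (snd (snd \<beta>)) e3 f"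

lemma semi_invI:
  assumes "homogeneous_polynomial_fun tensor_coords d (\<lambda>x. f (\<lambda>i j l. x $ (i, j, l)))"
    "scales act_1 (vector [a1, a2, a3]) e1 f" "scales act_2 (vector [b1, b2, b3]) e2 f" "scales act_3 (vector [c1, c2]) e3 f"
  shows "semi_inv (mk_wt a1 a2 a3 b1 b2 b3 c1 c2) d e1 e2 e3 f"
  using assms by (simp add: semi_inv_def mk_wt_def)

lemma semi_inv_mult:
  "semi_inv \<beta> d e1 e2 e3 f \<Longrightarrow> semi_inv \<beta> d' e1' e2' e3' f' \<Longrightarrow>
     semi_inv \<beta> (d + d') (\<lambda>s. e1 s + e1' s) (\<lambda>s. e2 s + e2' s) (\<lambda>s. e3 s + e3' s) (\<lambda>y. f y * f' y)"
  by (simp add: semi_inv_def scales_mult homogeneous_polynomial_fun.mult)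

lemma semi_inv_power:
  "semi_inv \<beta> d e1 e2 e3 f \<Longrightarrow>
     semi_inv \<beta> (n * d) (\<lambda>s. int n * e1 s) (\<lambda>s. int n * e2 s) (\<lambda>s. int n * e3 s) (\<lambda>y. f y ^ n)"
  by (simp add: semi_inv_def scales_power hom_power)

text \<open>The constant \<open>A\<close> contributes a power of the determinant, which is
  1.\<close>

lemma block_prod_character_power:
  assumes "block_prod b (\<lambda>_. 1) g = 1" "\<forall>s\<in>range (($) b). k * e s = A + M * w s"
  shows "block_prod b e g powi k = block_prod b w g powi M"
proof -
  have "block_prod b e g powi k = block_prod b (\<lambda>s. A * 1 + M * w s) g"
    unfolding block_prod_mult[symmetric] using assms(2) by (auto simp: block_prod_def intro!: prod.cong)
  then show ?thesis by (simp only: block_prod_add[OF assms(1)] block_prod_mult assms(1) power_int_1_left mult_1)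
qed

text \<open>The numerical condition says that the \<open>k\<close>-th power of the character of \<open>f\<close> is a product of powers of the
  three determinants and of \<open>chi \<beta>\<close>, hence trivial on \<open>G_st_beta \<beta>\<close>.\<close>
lemma Z_ssI:
  fixes z :: "'a::alg_closed_field tensor"
  assumes f: "semi_inv \<beta> d e1 e2 e3 f" and \<beta>: "\<beta> \<noteq> 0" "rat_wt \<beta>"
    and c: "c > 0" "\<forall>t\<in>entries \<beta>. c * t \<in> \<int>" "Gcd ((\<lambda>t. \<lfloor>c * t\<rfloor>) ` entries \<beta>) = 1"
    and z: "z \<in> Z_beta \<beta>" "f (\<lambda>i j l. z $ (i, j, l)) \<noteq> 0" and d: "d > 0" and k: "k > 0"
    and e: "\<forall>s\<in>range (($) (fst \<beta>)). int k * e1 s = A1 + M * \<lfloor>c * s\<rfloor>"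
      "\<forall>s\<in>range (($) (fst (snd \<beta>))). int k * e2 s = A2 + M * \<lfloor>c * s\<rfloor>"
      "\<forall>s\<in>range (($) (snd (snd \<beta>))). int k * e3 s = A3 + M * \<lfloor>c * s\<rfloor>"
  shows "z \<in> Z_ss \<beta>"
proof -
  define h where "h = (\<lambda>x :: 'a tensor. f (\<lambda>i j l. x $ (i, j, l)))"
  have cs: "chi_scale \<beta> = c" by (rule chi_scale_eqI[OF c \<beta>])
  have "h (act g x) ^ k = h x ^ k" if "g \<in> G_st_beta \<beta>" for g x
  proof -
    obtain g1 g2 g3 where g: "g = (g1, g2, g3)" by (cases g)
    let ?w = "\<lambda>s. \<lfloor>c * s\<rfloor>"
    let ?K = "block_prod (fst \<beta>) e1 g1 * block_prod (fst (snd \<beta>)) e2 g2 * block_prod (snd (snd \<beta>)) e3 g3"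
    have "g \<in> {g \<in> M_beta \<beta> \<inter> SL332. chi \<beta> g = 1}"
      using that connected_component_of_subset_topspace unfolding G_st_beta_def by fastforce
    then have bd: "block_diag (fst \<beta>) g1" "block_diag (fst (snd \<beta>)) g2" "block_diag (snd (snd \<beta>)) g3"
      and det: "block_prod (fst \<beta>) (\<lambda>_. 1) g1 = 1" "block_prod (fst (snd \<beta>)) (\<lambda>_. 1) g2 = 1"
        "block_prod (snd (snd \<beta>)) (\<lambda>_. 1) g3 = 1"
      and chi: "block_prod (fst \<beta>) ?w g1 * block_prod (fst (snd \<beta>)) ?w g2 * block_prod (snd (snd \<beta>)) ?w g3 = 1"
      unfolding g by (auto simp: M_beta_iff SL332_def block_prod_one_3 block_prod_one_2 chi_eq cs block_prod_def[where k = "\<lambda>s. \<lfloor>c * s\<rfloor>"])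
    have "h (act g x) = ?K * h x"
      using f bd det unfolding g h_def semi_inv_def scales_def act_factor by (simp add: mult_ac)
    moreover have "?K powi int k = (block_prod (fst \<beta>) ?w g1 * block_prod (fst (snd \<beta>)) ?w g2 * block_prod (snd (snd \<beta>)) ?w g3) powi M"
      unfolding power_int_mult_distrib using det e by (simp only: block_prod_character_power)
    ultimately show ?thesis unfolding chi by (simp add: power_mult_distrib)
  qed
  moreover have "homogeneous_polynomial_fun tensor_coords d h" using f by (simp add: semi_inv_def h_def)
  ultimately show ?thesis unfolding Z_ss_def using z d k
    by (intro CollectI conjI exI[of _ "k * d"] exI[of _ "\<lambda>x. h x ^ k"] hom_power ballI) (auto simp: h_def)
qed

lemma tens_Z_ssI:
  assumes \<beta>: "\<beta> = mk_wt a1 a2 a3 b1 b2 b3 c1 c2" and f: "semi_inv \<beta> d e1 e2 e3 f"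
    and "f (\<lambda>i j l. if (i, j, l) \<in> S then 1 else (0 :: 'a::alg_closed_field)) \<noteq> 0"
    and "\<beta> \<noteq> 0" "rat_wt \<beta>" "c > 0" "\<forall>t\<in>entries \<beta>. c * t \<in> \<int>" "Gcd ((\<lambda>t. \<lfloor>c * t\<rfloor>) ` entries \<beta>) = 1" "d > 0" "k > 0"
    and "\<beta> \<in> t_star" "\<forall>p\<in>S. pairing \<beta> p = inner \<beta> \<beta>"
    and "\<forall>s\<in>{a1, a2, a3}. int k * e1 s = A1 + M * \<lfloor>c * s\<rfloor>" "\<forall>s\<in>{b1, b2, b3}. int k * e2 s = A2 + M * \<lfloor>c * s\<rfloor>"
      "\<forall>s\<in>{c1, c2}. int k * e3 s = A3 + M * \<lfloor>c * s\<rfloor>"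
  shows "(tens S :: 'a tensor) \<in> Z_ss \<beta>"
proof (rule Z_ssI[OF f])
  show "tens S \<in> Z_beta \<beta>" using assms(11,12) by (intro tens_Z_beta) auto
qed (use assms in \<open>simp_all add: \<beta> mk_wt_def range_vec_3 range_vec_2 tens_def\<close>)

lemma pairing_mk_wt:
  "pairing (mk_wt a1 a2 a3 b1 b2 b3 c1 c2) (i, j, l) = vector [a1, a2, a3] $ i + vector [b1, b2, b3] $ j + vector [c1, c2] $ l"
  by (simp add: pairing_def mk_wt_def)

lemma floor_neg_one: "\<lfloor>- 1 :: real\<rfloor> = - 1"
  by (simp add: floor_eq_iff)

section \<open>Semistable points\<close>

lemmas Z_ss_simps = mk_wt_eq_0 mk_wt_rat mk_wt_entries mk_wt_t_star mk_wt_inner pairing_mk_wt exp2_def exp3_def floor_neg_one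

text \<open>The multiplicities 3 and 1 of the two factors make the weights in each monomial of the
  invariant average to \<open>\<beta>\<close>. The other constants are then forced: \<open>c\<close>
  is the indivisible scale, and for an invariant of degree \<open>d\<close> one has
  \<open>M * c = k * d\<close>, \<open>A1 = A2 = k * d / 3\<close> and
  \<open>A3 = k * d / 2\<close>, since \<open>\<beta>\<close> has sum 0 in each factor. The same
  rules give the constants below; the numbering is that of \<open>tens_pencil\<close>.\<close>

lemma Z_ss_1:
  "(tens {(1,2,2), (2,1,2), (2,2,1), (3,3,1)} :: 'a::alg_closed_field tensor)
     \<in> Z_ss (mk_wt (-2/33) (1/33) (1/33) (-2/33) (1/33) (1/33) (-1/22) (1/22))" (is "_ \<in> Z_ss ?\<beta>")
proof -
  \<comment> \<open>The first row of the second slice, times the adjugate of the lower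
    \<open>2 \<times> 2\<close> block of the first slice, times the first column of the second
    slice. The factor \<open>f2\<close> is the determinant of that block.\<close>
  have f1: "semi_inv ?\<beta> (1 + 1 + 1) (exp2 (-2/33) 1 1) (exp2 (-2/33) 1 1) (exp2 (-1/22) 1 2)
      (\<lambda>y :: 3 \<Rightarrow> 3 \<Rightarrow> 2 \<Rightarrow> 'a. y 1 2 2 * y 3 3 1 * y 2 1 2 - y 1 2 2 * y 2 3 1 * y 3 1 2 - y 1 3 2 * y 3 2 1 * y 2 1 2 + y 1 3 2 * y 2 2 1 * y 3 1 2)"
    by (intro semi_invI hom_intros scales_122 scales_12)
      (simp_all add: act_1_def act_2_def act_3_def minor_23_def power2_eq_square power3_eq_cube algebra_simps)
  have f2: "semi_inv ?\<beta> (1 + 1) (exp2 (-2/33) 0 1) (exp2 (-2/33) 0 1) (exp2 (-1/22) 2 0)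
      (\<lambda>y :: 3 \<Rightarrow> 3 \<Rightarrow> 2 \<Rightarrow> 'a. y 2 2 1 * y 3 3 1 - y 2 3 1 * y 3 2 1)"
    by (intro semi_invI hom_intros scales_122 scales_12)
      (simp_all add: act_1_def act_2_def act_3_def minor_23_def power2_eq_square power3_eq_cube algebra_simps)
  show ?thesis
    by (rule tens_Z_ssI[OF refl semi_inv_mult[OF semi_inv_power[OF f1, of 3] f2], where c = 66 and k = 6 and M = 1
          and ?A1.0 = 22 and ?A2.0 = 22 and ?A3.0 = 33])
      (simp_all add: Z_ss_simps)
qed

text \<open>The Levi subgroup is a torus, so every coordinate is a semi-invariant. The exponents 2,
  1, 2, 2, 2, divided by 9, are the coefficients of \<open>\<beta>\<close> as a convex combination
  of the five weights.\<close>

lemma Z_ss_2: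
  "(tens {(1,3,2), (2,2,2), (2,3,1), (3,1,2), (3,2,1)} :: 'a::alg_closed_field tensor)
     \<in> Z_ss (mk_wt (-1/9) 0 (1/9) (-1/9) 0 (1/9) (-1/18) (1/18))" (is "_ \<in> Z_ss ?\<beta>")
proof -
  have f1: "semi_inv ?\<beta> (1) (exp3 (-1/9) 0 1 0 0) (exp3 (-1/9) 0 0 0 1) (exp2 (-1/18) 0 1)
      (\<lambda>y :: 3 \<Rightarrow> 3 \<Rightarrow> 2 \<Rightarrow> 'a. y 1 3 2)"
    by (intro semi_invI hom_intros scales_123 scales_12)
      (simp_all add: act_1_def act_2_def act_3_def power2_eq_square power3_eq_cube algebra_simps)
  have f2: "semi_inv ?\<beta> (1) (exp3 (-1/9) 0 0 1 0) (exp3 (-1/9) 0 0 1 0) (exp2 (-1/18) 0 1)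
      (\<lambda>y :: 3 \<Rightarrow> 3 \<Rightarrow> 2 \<Rightarrow> 'a. y 2 2 2)"
    by (intro semi_invI hom_intros scales_123 scales_12)
      (simp_all add: act_1_def act_2_def act_3_def power2_eq_square power3_eq_cube algebra_simps)
  have f3: "semi_inv ?\<beta> (1) (exp3 (-1/9) 0 0 1 0) (exp3 (-1/9) 0 0 0 1) (exp2 (-1/18) 1 0)
      (\<lambda>y :: 3 \<Rightarrow> 3 \<Rightarrow> 2 \<Rightarrow> 'a. y 2 3 1)"
    by (intro semi_invI hom_intros scales_123 scales_12)
      (simp_all add: act_1_def act_2_def act_3_def power2_eq_square power3_eq_cube algebra_simps)
  have f4: "semi_inv ?\<beta> (1) (exp3 (-1/9) 0 0 0 1) (exp3 (-1/9) 0 1 0 0) (exp2 (-1/18) 0 1)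
      (\<lambda>y :: 3 \<Rightarrow> 3 \<Rightarrow> 2 \<Rightarrow> 'a. y 3 1 2)"
    by (intro semi_invI hom_intros scales_123 scales_12)
      (simp_all add: act_1_def act_2_def act_3_def power2_eq_square power3_eq_cube algebra_simps)
  have f5: "semi_inv ?\<beta> (1) (exp3 (-1/9) 0 0 0 1) (exp3 (-1/9) 0 0 1 0) (exp2 (-1/18) 1 0)
      (\<lambda>y :: 3 \<Rightarrow> 3 \<Rightarrow> 2 \<Rightarrow> 'a. y 3 2 1)"
    by (intro semi_invI hom_intros scales_123 scales_12)
      (simp_all add: act_1_def act_2_def act_3_def power2_eq_square power3_eq_cube algebra_simps)
  show ?thesis
    by (rule tens_Z_ssI[OF refl semi_inv_mult[OF semi_inv_mult[OF semi_inv_mult[OF semi_inv_mult[OF semi_inv_power[OF f1, of 2] f2] semi_inv_power[OF f3, of 2]] semi_inv_power[OF f4, of 2]] semi_inv_power[OF f5, of 2]], where c = 18 and k = 2 and M = 1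
          and ?A1.0 = 6 and ?A2.0 = 6 and ?A3.0 = 9])
      (simp_all add: Z_ss_simps)
qed

lemma Z_ss_3:
  "(tens {(1,1,2), (2,2,2), (3,3,1)} :: 'a::alg_closed_field tensor)
     \<in> Z_ss (mk_wt (-1/30) (-1/30) (1/15) (-1/30) (-1/30) (1/15) (-1/10) (1/10))" (is "_ \<in> Z_ss ?\<beta>")
proof -
  have f1: "semi_inv ?\<beta> (1 + 1) (exp2 (-1/30) 1 0) (exp2 (-1/30) 1 0) (exp2 (-1/10) 0 2)
      (\<lambda>y :: 3 \<Rightarrow> 3 \<Rightarrow> 2 \<Rightarrow> 'a. y 1 1 2 * y 2 2 2-y 1 2 2 * y 2 1 2)"
    by (intro semi_invI hom_intros scales_112 scales_12)
      (simp_all add: act_1_def act_2_def act_3_def minor_12_def power2_eq_square power3_eq_cube algebra_simps)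
  have f2: "semi_inv ?\<beta> (1) (exp2 (-1/30) 0 1) (exp2 (-1/30) 0 1) (exp2 (-1/10) 1 0)
      (\<lambda>y :: 3 \<Rightarrow> 3 \<Rightarrow> 2 \<Rightarrow> 'a. y 3 3 1)"
    by (intro semi_invI hom_intros scales_112 scales_12)
      (simp_all add: act_1_def act_2_def act_3_def minor_12_def power2_eq_square power3_eq_cube algebra_simps)
  show ?thesis
    by (rule tens_Z_ssI[OF refl semi_inv_mult[OF semi_inv_power[OF f1, of 3] semi_inv_power[OF f2, of 4]], where c = 30 and k = 3 and M = 1
          and ?A1.0 = 10 and ?A2.0 = 10 and ?A3.0 = 15])
      (simp_all add: Z_ss_simps)
qed

lemma Z_ss_5:
  "(tens {(1,3,1), (2,3,2), (3,1,1), (3,2,2)} :: 'a::alg_closed_field tensor)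
     \<in> Z_ss (mk_wt (-1/12) (-1/12) (1/6) (-1/12) (-1/12) (1/6) 0 0)" (is "_ \<in> Z_ss ?\<beta>")
proof -
  \<comment> \<open>The upper parts of the last columns of the two slices form a
    \<open>2 \<times> 2\<close> matrix, and so do the left parts of the last rows in
    \<open>f2\<close>. The third group acts on both matrices.\<close>
  have f1: "semi_inv ?\<beta> (1 + 1) (exp2 (-1/12) 1 0) (exp2 (-1/12) 0 2) (\<lambda>_. 1)
      (\<lambda>y :: 3 \<Rightarrow> 3 \<Rightarrow> 2 \<Rightarrow> 'a. y 1 3 1 * y 2 3 2-y 1 3 2 * y 2 3 1)"
    by (intro semi_invI hom_intros scales_112 scales_11)
      (simp_all add: act_1_def act_2_def act_3_def minor_12_def det_2 power2_eq_square power3_eq_cube algebra_simps)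
  have f2: "semi_inv ?\<beta> (1 + 1) (exp2 (-1/12) 0 2) (exp2 (-1/12) 1 0) (\<lambda>_. 1)
      (\<lambda>y :: 3 \<Rightarrow> 3 \<Rightarrow> 2 \<Rightarrow> 'a. y 3 1 1 * y 3 2 2-y 3 1 2 * y 3 2 1)"
    by (intro semi_invI hom_intros scales_112 scales_11)
      (simp_all add: act_1_def act_2_def act_3_def minor_12_def det_2 power2_eq_square power3_eq_cube algebra_simps)
  show ?thesis
    by (rule tens_Z_ssI[OF refl semi_inv_mult[OF f1 f2], where c = 12 and k = 3 and M = 1
          and ?A1.0 = 4 and ?A2.0 = 4 and ?A3.0 = 6])
      (simp_all add: Z_ss_simps)
qed

lemma Z_ss_6:
  "(tens {(1,3,2), (2,2,2), (3,1,2), (3,3,1)} :: 'a::alg_closed_field tensor)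
     \<in> Z_ss (mk_wt (-1/6) 0 (1/6) (-1/6) 0 (1/6) (-1/6) (1/6))" (is "_ \<in> Z_ss ?\<beta>")
proof -
  have f1: "semi_inv ?\<beta> (1) (exp3 (-1/6) 0 1 0 0) (exp3 (-1/6) 0 0 0 1) (exp2 (-1/6) 0 1)
      (\<lambda>y :: 3 \<Rightarrow> 3 \<Rightarrow> 2 \<Rightarrow> 'a. y 1 3 2)"
    by (intro semi_invI hom_intros scales_123 scales_12)
      (simp_all add: act_1_def act_2_def act_3_def power2_eq_square power3_eq_cube algebra_simps)
  have f2: "semi_inv ?\<beta> (1) (exp3 (-1/6) 0 0 1 0) (exp3 (-1/6) 0 0 1 0) (exp2 (-1/6) 0 1)
      (\<lambda>y :: 3 \<Rightarrow> 3 \<Rightarrow> 2 \<Rightarrow> 'a. y 2 2 2)"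
    by (intro semi_invI hom_intros scales_123 scales_12)
      (simp_all add: act_1_def act_2_def act_3_def power2_eq_square power3_eq_cube algebra_simps)
  have f3: "semi_inv ?\<beta> (1) (exp3 (-1/6) 0 0 0 1) (exp3 (-1/6) 0 1 0 0) (exp2 (-1/6) 0 1)
      (\<lambda>y :: 3 \<Rightarrow> 3 \<Rightarrow> 2 \<Rightarrow> 'a. y 3 1 2)"
    by (intro semi_invI hom_intros scales_123 scales_12)
      (simp_all add: act_1_def act_2_def act_3_def power2_eq_square power3_eq_cube algebra_simps)
  have f4: "semi_inv ?\<beta> (1) (exp3 (-1/6) 0 0 0 1) (exp3 (-1/6) 0 0 0 1) (exp2 (-1/6) 1 0)
      (\<lambda>y :: 3 \<Rightarrow> 3 \<Rightarrow> 2 \<Rightarrow> 'a. y 3 3 1)"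
    by (intro semi_invI hom_intros scales_123 scales_12)
      (simp_all add: act_1_def act_2_def act_3_def power2_eq_square power3_eq_cube algebra_simps)
  show ?thesis
    by (rule tens_Z_ssI[OF refl semi_inv_mult[OF semi_inv_mult[OF semi_inv_mult[OF f1 semi_inv_power[OF f2, of 2]] f3] semi_inv_power[OF f4, of 2]], where c = 6 and k = 1 and M = 1
          and ?A1.0 = 2 and ?A2.0 = 2 and ?A3.0 = 3])
      (simp_all add: Z_ss_simps)
qed

lemma Z_ss_8:
  "(tens {(1,3,2), (2,2,2), (3,3,1)} :: 'a::alg_closed_field tensor)
     \<in> Z_ss (mk_wt (-2/15) (1/15) (1/15) (-1/3) (1/15) (4/15) (-1/10) (1/10))" (is "_ \<in> Z_ss ?\<beta>")
proof -
  have f1: "semi_inv ?\<beta> (1) (exp2 (-2/15) 1 0) (exp3 (-1/3) (1/15) 0 0 1) (exp2 (-1/10) 0 1)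
      (\<lambda>y :: 3 \<Rightarrow> 3 \<Rightarrow> 2 \<Rightarrow> 'a. y 1 3 2)"
    by (intro semi_invI hom_intros scales_122 scales_123 scales_12)
      (simp_all add: act_1_def act_2_def act_3_def minor_23_def power2_eq_square power3_eq_cube algebra_simps)
  have f2: "semi_inv ?\<beta> (1 + 1) (exp2 (-2/15) 0 1) (exp3 (-1/3) (1/15) 0 1 1) (exp2 (-1/10) 1 1)
      (\<lambda>y :: 3 \<Rightarrow> 3 \<Rightarrow> 2 \<Rightarrow> 'a. y 2 2 2 * y 3 3 1-y 3 2 2 * y 2 3 1)"
    by (intro semi_invI hom_intros scales_122 scales_123 scales_12)
      (simp_all add: act_1_def act_2_def act_3_def minor_23_def power2_eq_square power3_eq_cube algebra_simps)
  show ?thesis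
    by (rule tens_Z_ssI[OF refl semi_inv_mult[OF f1 semi_inv_power[OF f2, of 2]], where c = 30 and k = 6 and M = 1
          and ?A1.0 = 10 and ?A2.0 = 10 and ?A3.0 = 15])
      (simp_all add: Z_ss_simps)
qed

lemma Z_ss_9:
  "(tens {(3,1,2), (2,2,2), (3,3,1)} :: 'a::alg_closed_field tensor)
     \<in> Z_ss (mk_wt (-1/3) (1/15) (4/15) (-2/15) (1/15) (1/15) (-1/10) (1/10))" (is "_ \<in> Z_ss ?\<beta>")
proof -
  have f1: "semi_inv ?\<beta> (1) (exp3 (-1/3) (1/15) 0 0 1) (exp2 (-2/15) 1 0) (exp2 (-1/10) 0 1)
      (\<lambda>y :: 3 \<Rightarrow> 3 \<Rightarrow> 2 \<Rightarrow> 'a. y 3 1 2)"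
    by (intro semi_invI hom_intros scales_123 scales_122 scales_12)
      (simp_all add: act_1_def act_2_def act_3_def minor_23_def power2_eq_square power3_eq_cube algebra_simps)
  have f2: "semi_inv ?\<beta> (1 + 1) (exp3 (-1/3) (1/15) 0 1 1) (exp2 (-2/15) 0 1) (exp2 (-1/10) 1 1)
      (\<lambda>y :: 3 \<Rightarrow> 3 \<Rightarrow> 2 \<Rightarrow> 'a. y 2 2 2 * y 3 3 1-y 2 3 2 * y 3 2 1)"
    by (intro semi_invI hom_intros scales_123 scales_122 scales_12)
      (simp_all add: act_1_def act_2_def act_3_def minor_23_def power2_eq_square power3_eq_cube algebra_simps)
  show ?thesis
    by (rule tens_Z_ssI[OF refl semi_inv_mult[OF f1 semi_inv_power[OF f2, of 2]], where c = 30 and k = 6 and M = 1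
          and ?A1.0 = 10 and ?A2.0 = 10 and ?A3.0 = 15])
      (simp_all add: Z_ss_simps)
qed

lemma Z_ss_11:
  "(tens {(2,3,2), (3,2,2), (3,3,1)} :: 'a::alg_closed_field tensor)
     \<in> Z_ss (mk_wt (-1/3) 0 (1/3) (-1/3) 0 (1/3) (-1/6) (1/6))" (is "_ \<in> Z_ss ?\<beta>")
proof -
  have f1: "semi_inv ?\<beta> (1) (exp3 (-1/3) 0 0 1 0) (exp3 (-1/3) 0 0 0 1) (exp2 (-1/6) 0 1)
      (\<lambda>y :: 3 \<Rightarrow> 3 \<Rightarrow> 2 \<Rightarrow> 'a. y 2 3 2)"
    by (intro semi_invI hom_intros scales_123 scales_12)
      (simp_all add: act_1_def act_2_def act_3_def power2_eq_square power3_eq_cube algebra_simps)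
  have f2: "semi_inv ?\<beta> (1) (exp3 (-1/3) 0 0 0 1) (exp3 (-1/3) 0 0 1 0) (exp2 (-1/6) 0 1)
      (\<lambda>y :: 3 \<Rightarrow> 3 \<Rightarrow> 2 \<Rightarrow> 'a. y 3 2 2)"
    by (intro semi_invI hom_intros scales_123 scales_12)
      (simp_all add: act_1_def act_2_def act_3_def power2_eq_square power3_eq_cube algebra_simps)
  have f3: "semi_inv ?\<beta> (1) (exp3 (-1/3) 0 0 0 1) (exp3 (-1/3) 0 0 0 1) (exp2 (-1/6) 1 0)
      (\<lambda>y :: 3 \<Rightarrow> 3 \<Rightarrow> 2 \<Rightarrow> 'a. y 3 3 1)"
    by (intro semi_invI hom_intros scales_123 scales_12)
      (simp_all add: act_1_def act_2_def act_3_def power2_eq_square power3_eq_cube algebra_simps)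
  show ?thesis
    by (rule tens_Z_ssI[OF refl semi_inv_mult[OF semi_inv_mult[OF f1 f2] f3], where c = 6 and k = 2 and M = 1
          and ?A1.0 = 2 and ?A2.0 = 2 and ?A3.0 = 3])
      (simp_all add: Z_ss_simps)
qed

lemma Z_ss_12:
  "(tens {(1,1,2), (2,2,2), (3,3,2)} :: 'a::alg_closed_field tensor)
     \<in> Z_ss (mk_wt 0 0 0 0 0 0 (-1/2) (1/2))" (is "_ \<in> Z_ss ?\<beta>")
proof -
  have f1: "semi_inv ?\<beta> (1 + 1 + 1) (\<lambda>_. 1) (\<lambda>_. 1) (exp2 (-1/2) 0 3)
      (\<lambda>y :: 3 \<Rightarrow> 3 \<Rightarrow> 2 \<Rightarrow> 'a. y 1 1 2 * y 2 2 2 * y 3 3 2+y 1 2 2 * y 2 3 2 * y 3 1 2+y 1 3 2 * y 2 1 2 * y 3 2 2-y 1 3 2 * y 2 2 2 * y 3 1 2-y 1 2 2 * y 2 1 2 * y 3 3 2-y 1 1 2 * y 2 3 2 * y 3 2 2)"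
    by (intro semi_invI hom_intros scales_111 scales_12)
      (simp_all add: act_1_def act_2_def act_3_def det_3 power2_eq_square power3_eq_cube algebra_simps)
  show ?thesis
    by (rule tens_Z_ssI[OF refl f1, where c = 2 and k = 2 and M = 3
          and ?A1.0 = 2 and ?A2.0 = 2 and ?A3.0 = 3])
      (simp_all add: Z_ss_simps)
qed

lemma Z_ss_13:
  "(tens {(2,2,2), (3,3,2)} :: 'a::alg_closed_field tensor)
     \<in> Z_ss (mk_wt (-1/3) (1/6) (1/6) (-1/3) (1/6) (1/6) (-1/2) (1/2))" (is "_ \<in> Z_ss ?\<beta>")
proof -
  have f1: "semi_inv ?\<beta> (1 + 1) (exp2 (-1/3) 0 1) (exp2 (-1/3) 0 1) (exp2 (-1/2) 0 2)
      (\<lambda>y :: 3 \<Rightarrow> 3 \<Rightarrow> 2 \<Rightarrow> 'a. y 2 2 2 * y 3 3 2-y 2 3 2 * y 3 2 2)"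
    by (intro semi_invI hom_intros scales_122 scales_12)
      (simp_all add: act_1_def act_2_def act_3_def minor_23_def power2_eq_square power3_eq_cube algebra_simps)
  show ?thesis
    by (rule tens_Z_ssI[OF refl f1, where c = 6 and k = 3 and M = 1
          and ?A1.0 = 2 and ?A2.0 = 2 and ?A3.0 = 3])
      (simp_all add: Z_ss_simps)
qed

lemma Z_ss_14:
  "(tens {(2,3,1), (3,3,2)} :: 'a::alg_closed_field tensor)
     \<in> Z_ss (mk_wt (-1/3) (1/6) (1/6) (-1/3) (-1/3) (2/3) 0 0)" (is "_ \<in> Z_ss ?\<beta>")
proof -
  have f1: "semi_inv ?\<beta> (1 + 1) (exp2 (-1/3) 0 1) (exp2 (-1/3) 0 2) (\<lambda>_. 1)
      (\<lambda>y :: 3 \<Rightarrow> 3 \<Rightarrow> 2 \<Rightarrow> 'a. y 2 3 1 * y 3 3 2-y 2 3 2 * y 3 3 1)"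
    by (intro semi_invI hom_intros scales_122 scales_112 scales_11)
      (simp_all add: act_1_def act_2_def act_3_def minor_23_def minor_12_def det_2 power2_eq_square power3_eq_cube algebra_simps)
  show ?thesis
    by (rule tens_Z_ssI[OF refl f1, where c = 6 and k = 3 and M = 1
          and ?A1.0 = 2 and ?A2.0 = 2 and ?A3.0 = 3])
      (simp_all add: Z_ss_simps)
qed

lemma Z_ss_15:
  "(tens {(3,2,1), (3,3,2)} :: 'a::alg_closed_field tensor)
     \<in> Z_ss (mk_wt (-1/3) (-1/3) (2/3) (-1/3) (1/6) (1/6) 0 0)" (is "_ \<in> Z_ss ?\<beta>")
proof -
  have f1: "semi_inv ?\<beta> (1 + 1) (exp2 (-1/3) 0 2) (exp2 (-1/3) 0 1) (\<lambda>_. 1)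
      (\<lambda>y :: 3 \<Rightarrow> 3 \<Rightarrow> 2 \<Rightarrow> 'a. y 3 2 1 * y 3 3 2-y 3 2 2 * y 3 3 1)"
    by (intro semi_invI hom_intros scales_112 scales_122 scales_11)
      (simp_all add: act_1_def act_2_def act_3_def minor_12_def minor_23_def det_2 power2_eq_square power3_eq_cube algebra_simps)
  show ?thesis
    by (rule tens_Z_ssI[OF refl f1, where c = 6 and k = 3 and M = 1
          and ?A1.0 = 2 and ?A2.0 = 2 and ?A3.0 = 3])
      (simp_all add: Z_ss_simps)
qed

lemma Z_ss_16:
  "(tens {(3,3,2)} :: 'a::alg_closed_field tensor)
     \<in> Z_ss (mk_wt (-1/3) (-1/3) (2/3) (-1/3) (-1/3) (2/3) (-1/2) (1/2))" (is "_ \<in> Z_ss ?\<beta>")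
proof -
  have f1: "semi_inv ?\<beta> (1) (exp2 (-1/3) 0 1) (exp2 (-1/3) 0 1) (exp2 (-1/2) 0 1)
      (\<lambda>y :: 3 \<Rightarrow> 3 \<Rightarrow> 2 \<Rightarrow> 'a. y 3 3 2)"
    by (intro semi_invI hom_intros scales_112 scales_12)
      (simp_all add: act_1_def act_2_def act_3_def minor_12_def power2_eq_square power3_eq_cube algebra_simps)
  show ?thesis
    by (rule tens_Z_ssI[OF refl f1, where c = 6 and k = 6 and M = 1
          and ?A1.0 = 2 and ?A2.0 = 2 and ?A3.0 = 3])
      (simp_all add: Z_ss_simps)
qed

text \<open>\<open>Z_beta\<close> consists here of four columns of length 3, indexed by two copies
  of a set of size two, which is where \<open>castling_inv\<close> lives.\<close>

lemma Z_ss_4: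
  "(tens {(1,2,1), (2,2,2), (2,3,1), (3,3,2)} :: 'a::alg_closed_field tensor)
     \<in> Z_ss (mk_wt 0 0 0 (-1/3) (1/6) (1/6) 0 0)" (is "_ \<in> Z_ss ?\<beta>")
proof -
  have f1: "semi_inv ?\<beta> (1 + (1 + 1) + (1 + (1 + 1))) (\<lambda>_. 2) (exp2 (-1/3) 0 3) (\<lambda>_. 3)
      (\<lambda>y :: 3 \<Rightarrow> 3 \<Rightarrow> 2 \<Rightarrow> 'a. castling_inv y)"
  proof (rule semi_invI)
    show "homogeneous_polynomial_fun tensor_coords (1 + (1 + 1) + (1 + (1 + 1))) (\<lambda>x :: 'a tensor. castling_inv (\<lambda>i j l. x $ (i, j, l)))"
      unfolding castling_inv_def vdet_def by (intro hom_intros)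
  qed (rule scales_111 scales_122 scales_11, simp_all add: castling_inv_act_1 castling_inv_act_2 castling_inv_act_3)+
  show ?thesis
    by (rule tens_Z_ssI[OF refl f1, where c = 6 and k = 1 and M = 1
          and ?A1.0 = 2 and ?A2.0 = 2 and ?A3.0 = 3])
      (simp_all add: Z_ss_simps castling_inv_def vdet_def)
qed

lemma Z_ss_7:
  "(tens {(2,1,1), (2,2,2), (3,2,1), (3,3,2)} :: 'a::alg_closed_field tensor)
     \<in> Z_ss (mk_wt (-1/3) (1/6) (1/6) 0 0 0 0 0)" (is "_ \<in> Z_ss ?\<beta>")
proof -
  have f1: "semi_inv ?\<beta> (1 + (1 + 1) + (1 + (1 + 1))) (exp2 (-1/3) 0 3) (\<lambda>_. 2) (\<lambda>_. 3)
      (\<lambda>y :: 3 \<Rightarrow> 3 \<Rightarrow> 2 \<Rightarrow> 'a. castling_inv (\<lambda>j i. y i j))"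
  proof (rule semi_invI)
    show "homogeneous_polynomial_fun tensor_coords (1 + (1 + 1) + (1 + (1 + 1))) (\<lambda>x :: 'a tensor. castling_inv (\<lambda>j i l. x $ (i, j, l)))"
      unfolding castling_inv_def vdet_def by (intro hom_intros)
  qed (rule scales_122 scales_111 scales_11, simp_all add: castling_inv_act_1_swap castling_inv_act_2_swap castling_inv_act_3_swap)+
  show ?thesis
    by (rule tens_Z_ssI[OF refl f1, where c = 6 and k = 1 and M = 1
          and ?A1.0 = 2 and ?A2.0 = 2 and ?A3.0 = 3])
      (simp_all add: Z_ss_simps castling_inv_def vdet_def)
qed

text \<open>\<open>Z_beta\<close> is the full space of \<open>2 \<times> 2 \<times> 2\<close>
  tensors here, so Cayley's invariant applies.\<close>

lemma Z_ss_10: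
  "(tens {(2,2,1), (3,3,2)} :: 'a::alg_closed_field tensor)
     \<in> Z_ss (mk_wt (-1/3) (1/6) (1/6) (-1/3) (1/6) (1/6) 0 0)" (is "_ \<in> Z_ss ?\<beta>")
proof -
  have f1: "semi_inv ?\<beta> (1 + 1 + (1 + 1)) (exp2 (-1/3) 0 2) (exp2 (-1/3) 0 2) (\<lambda>_. 2)
      (\<lambda>y :: 3 \<Rightarrow> 3 \<Rightarrow> 2 \<Rightarrow> 'a. hyperdet y)"
  proof (rule semi_invI)
    show "homogeneous_polynomial_fun tensor_coords (1 + 1 + (1 + 1)) (\<lambda>x :: 'a tensor. hyperdet (\<lambda>i j l. x $ (i, j, l)))"
      unfolding hyperdet_def power2_eq_square by (intro hom_intros)
  qed (rule scales_122 scales_11, simp_all add: hyperdet_act_1 hyperdet_act_2 hyperdet_act_3)+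
  show ?thesis
    by (rule tens_Z_ssI[OF refl f1, where c = 6 and k = 3 and M = 2
          and ?A1.0 = 4 and ?A2.0 = 4 and ?A3.0 = 6])
      (simp_all add: Z_ss_simps hyperdet_def)
qed

section \<open>Pencils of matrices and their discriminant\<close>

lemma ex2I: "P a b \<Longrightarrow> \<exists>a b. P a b"
  by blast

lemma ex4I: "P a b c d \<Longrightarrow> \<exists>a b c d. P a b c d"
  by blast

lemma ex9I: "P a b c d e f g h i \<Longrightarrow> \<exists>a b c d e f g h i. P a b c d e f g h i"
  by blast

lemma ex10I: "P a b c d e f g h i j \<Longrightarrow> \<exists>a b c d e f g h i j. P a b c d e f g h i j"
  by blast

definition pencil :: "'a::field^3^3 \<Rightarrow> 'a^3^3 \<Rightarrow> 'a tensor" where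
  "pencil A B = (\<chi> p. case p of (i, j, l) \<Rightarrow> if l = 1 then A $ i $ j else B $ i $ j)"

definition slice :: "2 \<Rightarrow> 'a::field tensor \<Rightarrow> 'a^3^3" where
  "slice l x = (\<chi> i j. x $ (i, j, l))"

definition lcomb :: "'a::field \<Rightarrow> 'a^3^3 \<Rightarrow> 'a \<Rightarrow> 'a^3^3 \<Rightarrow> 'a^3^3" where
  "lcomb a A b B = (\<chi> i j. a * A $ i $ j + b * B $ i $ j)"

lemma pencil_slices: "pencil (slice 1 x) (slice 2 x) = x"
proof -
  have "pencil (slice 1 x) (slice 2 x) $ (i, j, l) = x $ (i, j, l)" for i j l
    using exhaust_2[of l] by (auto simp: pencil_def slice_def)
  then show ?thesis by (simp add: vec_eq_iff split_paired_All)
qed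

lemma slice_pencil [simp]: "slice 1 (pencil A B) = A" "slice 2 (pencil A B) = B"
  by (simp_all add: slice_def pencil_def vec_eq_iff)

lemma slice_act: "slice l (act (g1, g2, g3) x) =
    g1 ** lcomb (g3$l$1) (slice 1 x) (g3$l$2) (slice 2 x) ** transpose g2"
  unfolding vec_eq_iff
proof (intro allI)
  fix i j
  have "slice l (act (g1, g2, g3) x) $ i $ j = act (g1, g2, g3) x $ (i, j, l)" by (simp add: slice_def)
  also have "\<dots> = (g1 ** lcomb (g3$l$1) (slice 1 x) (g3$l$2) (slice 2 x) ** transpose g2) $ i $ j"
    unfolding act_factor act_1_def act_2_def act_3_def
    by (simp add: matrix_matrix_mult_def lcomb_def slice_def transpose_def sum_3) (simp add: algebra_simps)
  finally show "slice l (act (g1, g2, g3) x) $ i $ j = (g1 ** lcomb (g3$l$1) (slice 1 x) (g3$l$2) (slice 2 x) ** transpose g2) $ i $ j" .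
qed

text \<open>The coefficient of \<open>s\<^sup>3\<^sup>-\<^sup>k t\<^sup>k\<close> in \<open>det (s A + t B)\<close>.\<close>
definition cubic_coeff :: "nat \<Rightarrow> 'a::field^3^3 \<Rightarrow> 'a^3^3 \<Rightarrow> 'a" where
  "cubic_coeff k A B =
    (if k = 0 then det A else if k = 3 then det B else
     (let P = (if k = 1 then A else B); Q = (if k = 1 then B else A) in
       det (\<chi> i. if i = 1 then Q $ 1 else P $ i) + det (\<chi> i. if i = 2 then Q $ 2 else P $ i) +
       det (\<chi> i. if i = 3 then Q $ 3 else P $ i)))"

lemma det_lcomb:
  "det (lcomb s A t B) = s^3 * cubic_coeff 0 A B + s^2 * t * cubic_coeff 1 A B + s * t^2 * cubic_coeff 2 A B +
     t^3 * cubic_coeff 3 A B"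
  by (simp add: cubic_coeff_def Let_def det_3 lcomb_def power2_eq_square power3_eq_cube algebra_simps)

text \<open>The integral discriminant of the binary cubic
  \<open>a s^3 + b s^2 t + c s t^2 + d t^3\<close>, meaningful in every characteristic.\<close>

definition disc :: "'a::field \<Rightarrow> 'a \<Rightarrow> 'a \<Rightarrow> 'a \<Rightarrow> 'a" where
  "disc a b c d = b^2 * c^2 - 4 * a * c^3 - 4 * b^3 * d + 18 * a * b * c * d - 27 * a^2 * d^2"

text \<open>Being a polynomial in the entries, it commutes with extension of scalars. This carries
  the double root from the closure down to \<open>k\<close>.\<close>

definition tdisc :: "'a::field tensor \<Rightarrow> 'a" where
  "tdisc x = (let A = slice 1 x; B = slice 2 x in
     disc (cubic_coeff 0 A B) (cubic_coeff 1 A B) (cubic_coeff 2 A B) (cubic_coeff 3 A B))"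

lemma cubic_unique:
  fixes a b c d :: "'a::alg_closed_field"
  assumes "\<And>s t. a * s^3 + b * s^2 * t + c * s * t^2 + d * t^3 = a' * s^3 + b' * s^2 * t + c' * s * t^2 + d' * t^3"
  shows "a = a' \<and> b = b' \<and> c = c' \<and> d = d'"
proof -
  have "poly [:d - d', c - c', b - b', a - a':] s = 0" for s
    using assms[of s 1] by (simp add: algebra_simps power2_eq_square power3_eq_cube)
  then have "[:d - d', c - c', b - b', a - a':] = 0" by (intro poly_eq_0_off_zero)
  then show ?thesis by simp
qed

definition square_times_linear :: "'a::field tensor \<Rightarrow> bool" where
  "square_times_linear x \<longleftrightarrow> (\<exists>a b c d. \<forall>s t. det (lcomb s (slice 1 x) t (slice 2 x)) = (a * s + b * t)^2 * (c * s + d * t))"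

lemma disc_square_times_linear:
  "disc (a^2 * c) (2 * a * b * c + a^2 * d) (b^2 * c + 2 * a * b * d) (b^2 * d) = (0 :: 'a::Fields.field)"
  by (simp add: disc_def power2_eq_square power3_eq_cube algebra_simps)

lemma square_times_linear_imp_tdisc:
  fixes x :: "'a::alg_closed_field tensor"
  assumes "square_times_linear x"
  shows "tdisc x = 0"
proof -
  obtain a b c d where e: "\<And>s t. det (lcomb s (slice 1 x) t (slice 2 x)) = (a * s + b * t)^2 * (c * s + d * t)"
    using assms unfolding square_times_linear_def by blast
  let ?k = "\<lambda>k. cubic_coeff k (slice 1 x) (slice 2 x)"
  have "?k 0 = a^2 * c \<and> ?k 1 = 2 * a * b * c + a^2 * d \<and> ?k 2 = b^2 * c + 2 * a * b * d \<and> ?k 3 = b^2 * d"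
  proof (rule cubic_unique)
    fix s t
    show "?k 0 * s^3 + ?k 1 * s^2 * t + ?k 2 * s * t^2 + ?k 3 * t^3 =
       a^2 * c * s^3 + (2 * a * b * c + a^2 * d) * s^2 * t + (b^2 * c + 2 * a * b * d) * s * t^2 + b^2 * d * t^3"
      using e[of s t] unfolding det_lcomb by (simp add: algebra_simps power2_eq_square power3_eq_cube)
  qed
  then show ?thesis unfolding tdisc_def Let_def by (simp add: disc_square_times_linear)
qed

text \<open>For \<open>a = 0\<close> the form is \<open>t\<close> times a binary quadratic form, and
  \<open>disc\<close> is \<open>b^2\<close> times the discriminant of the latter. Otherwise the
  cubic splits with roots \<open>s\<close>, \<open>t\<close>, \<open>u\<close>, and
  \<open>disc\<close> is \<open>a^4\<close> times the square of the product of their differences.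
  Neither case divides by 2 or 3.\<close>

lemma cubic_zero_disc_double_root:
  fixes a b c d :: "'a::alg_closed_field"
  assumes "disc a b c d = 0"
  shows "\<exists>p q r u. a = p^2 * r \<and> b = 2 * p * q * r + p^2 * u \<and> c = q^2 * r + 2 * p * q * u \<and> d = q^2 * u"
proof (cases "a = 0")
  case True
  then have bc: "b^2 * (c^2 - 4 * b * d) = 0" using assms by (simp add: disc_def algebra_simps power2_eq_square power3_eq_cube)
  show ?thesis
  proof (cases "b = 0")
    case True
    then show ?thesis using \<open>a = 0\<close> by - (rule ex4I[of _ 0 1 c d], simp)
  next
    case False
    then have cd: "c^2 = 4 * b * d" using bc by simp
    have "Polynomial.degree [:d, c, b:] > 0" using False by simp
    then obtain s where s: "poly [:d, c, b:] s = 0" using alg_closed_imp_poly_has_root by blast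
    then have d: "d = - s * (c + s * b)" by (simp add: algebra_simps eq_neg_iff_add_eq_0)
    have "(c + 2 * s * b)^2 = c^2 - 4 * b * (- s * (c + s * b))"
      by (simp add: power2_eq_square algebra_simps)
    also have "\<dots> = 0" using cd unfolding d[symmetric] by simp
    finally have "c = - 2 * s * b" by (simp add: eq_neg_iff_add_eq_0)
    then show ?thesis using \<open>a = 0\<close> d
      by - (rule ex4I[of _ 1 "- s" 0 b], (simp add: power2_eq_square algebra_simps))
  qed
next
  case False
  have "Polynomial.degree [:d, c, b, a:] > 0" using False by simp
  then obtain s where s: "poly [:d, c, b, a:] s = 0" using alg_closed_imp_poly_has_root by blast
  \<comment> \<open>Synthetic division: removing the root \<open>s\<close> leaves
    \<open>a X^2 + e X + f\<close>.\<close>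
  define e f where "e = b + s * a" and "f = c + s * e"
  have d: "d = - s * f" using s by (simp add: e_def f_def algebra_simps eq_neg_iff_add_eq_0)
  have "Polynomial.degree [:f, e, a:] > 0" using False by simp
  then obtain t where t: "poly [:f, e, a:] t = 0" using alg_closed_imp_poly_has_root by blast
  define u where "u = - (e + t * a) / a"
  have e: "e = - a * (t + u)" using False by (simp add: u_def field_simps)
  have f: "f = - t * (e + t * a)" using t by (simp add: algebra_simps eq_neg_iff_add_eq_0)
  have b: "b = - a * (s + t + u)" using e by (simp add: e_def algebra_simps eq_neg_iff_add_eq_0)
  have f': "f = a * t * u" using f e by (simp add: algebra_simps)
  have c: "c = a * (s * t + s * u + t * u)" using f' e by (simp add: f_def algebra_simps)
  have d': "d = - a * s * t * u" using d f' by (simp add: algebra_simps)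
  have "disc a b c d = a^4 * ((s - t) * (s - u) * (t - u))^2"
    unfolding b c d' disc_def by (simp add: power2_eq_square power3_eq_cube power4_eq_xxxx algebra_simps)
  then have "s = t \<or> s = u \<or> t = u" using assms False by auto
  \<comment> \<open>\<open>x\<close> is the double root and \<open>y\<close> the remaining
    one.\<close>
  then obtain x y where xy: "b = - a * (2 * x + y)" "c = a * (x^2 + 2 * x * y)" "d = - a * x^2 * y"
    unfolding b c d' by (elim disjE; simp only: ; (rule that[of s u] that[of s t] that[of t s])?; simp add: power2_eq_square algebra_simps)
  then show ?thesis
    by - (rule ex4I[of _ 1 "- x" a "- a * y"], (simp add: power2_eq_square algebra_simps))
qed

lemma square_times_linear_act:
  assumes "square_times_linear x"
  shows "square_times_linear (act (g1, g2, g3) x)"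
proof -
  obtain a b c d where e: "\<And>s t. det (lcomb s (slice 1 x) t (slice 2 x)) = (a * s + b * t)^2 * (c * s + d * t)"
    using assms unfolding square_times_linear_def by blast
  have l: "lcomb s (slice 1 (act (g1, g2, g3) x)) t (slice 2 (act (g1, g2, g3) x)) =
     g1 ** lcomb (s * g3$1$1 + t * g3$2$1) (slice 1 x) (s * g3$1$2 + t * g3$2$2) (slice 2 x) ** transpose g2" for s t
    unfolding slice_act by (simp add: vec_eq_iff matrix_matrix_mult_def sum_3 lcomb_def transpose_def) (simp add: algebra_simps)
  have r: "p * (s * g3$1$1 + t * g3$2$1) + q * (s * g3$1$2 + t * g3$2$2) =
      (p * g3$1$1 + q * g3$1$2) * s + (p * g3$2$1 + q * g3$2$2) * t" for p q s t
    by (simp add: algebra_simps)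
  have r2: "u * (v^2 * (p * s + q * t)) * w = v^2 * (u * w * p * s + u * w * q * t)" for u v w p q s t :: 'a
    by (simp add: algebra_simps)
  have "det (lcomb s (slice 1 (act (g1, g2, g3) x)) t (slice 2 (act (g1, g2, g3) x))) =
      ((a * g3$1$1 + b * g3$1$2) * s + (a * g3$2$1 + b * g3$2$2) * t)^2 *
      (det g1 * det g2 * (c * g3$1$1 + d * g3$1$2) * s + det g1 * det g2 * (c * g3$2$1 + d * g3$2$2) * t)" for s t
    unfolding l det_mul det_transpose e r r2 ..
  then show ?thesis unfolding square_times_linear_def by blast
qed

text \<open>A monomial of the coefficient of \<open>s\<^sup>3\<close> or \<open>s\<^sup>2 t\<close> has pairing at most \<open>0\<close> with \<open>\<beta>\<close>, but all weights
  on \<open>Y\<^sub>\<beta>\<close> pair positively with \<open>\<beta>\<close>.\<close>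
lemma Y_ss_square_times_linear:
  fixes y :: "'a::alg_closed_field tensor"
  assumes \<beta>: "\<beta> \<in> \<BB>" and y: "y \<in> Y_ss \<beta>"
  shows "square_times_linear y"
proof -
  obtain b1 b2 b3 where b: "\<beta> = (b1, b2, b3)" by (cases \<beta>)
  have bp: "\<beta> \<in> t_star_plus" "\<beta> \<noteq> 0" using BB_D[OF \<beta>] by auto
  have s: "b1 $ 1 + b1 $ 2 + b1 $ 3 = 0" "b2 $ 1 + b2 $ 2 + b2 $ 3 = 0" "b3 $ 1 + b3 $ 2 = 0" "b3 $ 1 \<le> b3 $ 2"
    using bp(1) by (auto simp: b t_star_plus_def t_star_def sum_3 sum_2)
  have pos: "y $ (i, j, l) = 0 \<or> b1 $ i + b2 $ j + b3 $ l > 0" for i j l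
  proof (cases "y $ (i, j, l) = 0")
    case False
    then have "(i, j, l) \<in> supp (act grp_one y)" by (simp add: supp_def act_one)
    then have "pairing \<beta> (i, j, l) \<ge> inner \<beta> \<beta>"
      using lower_act_Y_ss(1)[OF \<beta> y lower_grp_one] by blast
    moreover have "inner \<beta> \<beta> > 0" using bp(2) by simp
    ultimately show ?thesis by (simp add: pairing_def b)
  qed simp
  \<comment> \<open>A monomial of a determinant uses every row and every column once, so the
    pairings of its factors add up to their \<open>b3\<close> parts alone. With at most one factor
    from the second slice this sum is not positive.\<close>
  have z: "y $ (1, j, l) * y $ (2, j', l') * y $ (3, j'', l'') = 0"
    if "b2 $ j + b2 $ j' + b2 $ j'' = 0" "b3 $ l + b3 $ l' + b3 $ l'' \<le> 0" for j j' j'' l l' l''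
  proof (rule ccontr)
    assume "\<not> ?thesis"
    then have "b1 $ 1 + b2 $ j + b3 $ l > 0" "b1 $ 2 + b2 $ j' + b3 $ l' > 0" "b1 $ 3 + b2 $ j'' + b3 $ l'' > 0"
      using pos[of 1 j l] pos[of 2 j' l'] pos[of 3 j'' l''] by auto
    then show False using that s(1) by linarith
  qed
  have p: "b2 $ 1 + b2 $ 3 + b2 $ 2 = 0" "b2 $ 2 + b2 $ 1 + b2 $ 3 = 0" "b2 $ 2 + b2 $ 3 + b2 $ 1 = 0"
    "b2 $ 3 + b2 $ 1 + b2 $ 2 = 0" "b2 $ 3 + b2 $ 2 + b2 $ 1 = 0" using s(2) by auto
  have q: "b3 $ 1 + b3 $ 1 + b3 $ 1 \<le> 0" "b3 $ 2 + b3 $ 1 + b3 $ 1 \<le> 0" "b3 $ 1 + b3 $ 2 + b3 $ 1 \<le> 0"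
    "b3 $ 1 + b3 $ 1 + b3 $ 2 \<le> 0" using s(3,4) by linarith+
  note z' = z[OF s(2)] z[OF p(1)] z[OF p(2)] z[OF p(3)] z[OF p(4)] z[OF p(5)]
  have c0: "cubic_coeff 0 (slice 1 y) (slice 2 y) = 0"
    by (simp add: cubic_coeff_def det_3 slice_def z'[OF q(1)])
  have c1: "cubic_coeff 1 (slice 1 y) (slice 2 y) = 0"
    by (simp add: cubic_coeff_def det_3 slice_def z'[OF q(2)] z'[OF q(3)] z'[OF q(4)])
  show ?thesis unfolding square_times_linear_def det_lcomb c0 c1
    by - (rule ex4I[of _ 0 1 "cubic_coeff 2 (slice 1 y) (slice 2 y)" "cubic_coeff 3 (slice 1 y) (slice 2 y)"], (simp add: algebra_simps power2_eq_square power3_eq_cube))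
qed

lemma stratum_tdisc:
  fixes x :: "'a::alg_closed_field tensor"
  assumes "\<beta> \<in> \<BB>" "x \<in> stratum \<beta>"
  shows "tdisc x = 0"
proof -
  obtain g1 g2 g3 y where "x = act (g1, g2, g3) y" "y \<in> Y_ss \<beta>" using assms(2) unfolding stratum_def by auto
  then show ?thesis
    using square_times_linear_imp_tdisc square_times_linear_act Y_ss_square_times_linear[OF assms(1)] by blast
qed

section \<open>Classification of pencils\<close>

definition eqv :: "'a::field tensor \<Rightarrow> 'a tensor \<Rightarrow> bool" where
  "eqv x y \<longleftrightarrow> (\<exists>g\<in>GL332. act g x = y)"

lemma eqv_refl: "eqv x x"
  unfolding eqv_def using GL332_one act_one by blast

lemma eqv_sym: "eqv x y \<Longrightarrow> eqv y x"
  unfolding eqv_def by (metis GL332_iff_inv act_inv grp_inv_sym)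

lemma eqv_trans [trans]: "eqv x y \<Longrightarrow> eqv y z \<Longrightarrow> eqv x z"
  unfolding eqv_def by (metis GL332_mult act_act)

definition M3 :: "'a \<Rightarrow> 'a \<Rightarrow> 'a \<Rightarrow> 'a \<Rightarrow> 'a \<Rightarrow> 'a \<Rightarrow> 'a \<Rightarrow> 'a \<Rightarrow> 'a \<Rightarrow> 'a::field^3^3" where
  "M3 a b c d e f g h i = vector [vector [a, b, c], vector [d, e, f], vector [g, h, i]]"

lemma M3_nth [simp]:
  "M3 a b c d e f g h i $ 1 $ 1 = a" "M3 a b c d e f g h i $ 1 $ 2 = b" "M3 a b c d e f g h i $ 1 $ 3 = c"
  "M3 a b c d e f g h i $ 2 $ 1 = d" "M3 a b c d e f g h i $ 2 $ 2 = e" "M3 a b c d e f g h i $ 2 $ 3 = f"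
  "M3 a b c d e f g h i $ 3 $ 1 = g" "M3 a b c d e f g h i $ 3 $ 2 = h" "M3 a b c d e f g h i $ 3 $ 3 = i"
  by (simp_all add: M3_def)

lemma M3_eta: "A = M3 (A$1$1) (A$1$2) (A$1$3) (A$2$1) (A$2$2) (A$2$3) (A$3$1) (A$3$2) (A$3$3)"
  by (simp add: vec_eq_iff forall_3)

lemma M3_cases: obtains a b c d e f g h i where "A = M3 a b c d e f g h i"
  using M3_eta by blast

lemma M3_eq [simp]: "M3 a b c d e f g h i = M3 a' b' c' d' e' f' g' h' i' \<longleftrightarrow>
    a = a' \<and> b = b' \<and> c = c' \<and> d = d' \<and> e = e' \<and> f = f' \<and> g = g' \<and> h = h' \<and> i = i'"
  by (auto simp: vec_eq_iff forall_3)

lemma M3_mult [simp]: "M3 a b c d e f g h i ** M3 a' b' c' d' e' f' g' h' i' =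
  M3 (a*a' + b*d' + c*g') (a*b' + b*e' + c*h') (a*c' + b*f' + c*i')
     (d*a' + e*d' + f*g') (d*b' + e*e' + f*h') (d*c' + e*f' + f*i')
     (g*a' + h*d' + i*g') (g*b' + h*e' + i*h') (g*c' + h*f' + i*i')"
  by (simp add: vec_eq_iff forall_3 matrix_matrix_mult_def sum_3)

lemma M3_lcomb [simp]: "lcomb p (M3 a b c d e f g h i) q (M3 a' b' c' d' e' f' g' h' i') =
  M3 (p*a + q*a') (p*b + q*b') (p*c + q*c') (p*d + q*d') (p*e + q*e') (p*f + q*f') (p*g + q*g') (p*h + q*h') (p*i + q*i')"
  by (simp add: vec_eq_iff forall_3 lcomb_def)

lemma M3_det [simp]: "det (M3 a b c d e f g h i) = a*e*i + b*f*g + c*d*h - a*f*h - b*d*i - c*e*g"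
  by (simp add: det_3)

lemma M3_transpose [simp]: "transpose (M3 a b c d e f g h i) = M3 a d g b e h c f i"
  by (simp add: vec_eq_iff forall_3 transpose_def)

lemma eqvI:
  fixes A B P Q :: "'a::field^3^3"
  assumes "det P \<noteq> 0" "det Q \<noteq> 0" "p * s - q * r \<noteq> 0"
    "P ** lcomb p A q B ** Q = A'" "P ** lcomb r A s B ** Q = B'"
  shows "eqv (pencil A B) (pencil A' B')"
proof -
  define g3 :: "'a^2^2" where "g3 = vector [vector [p, q], vector [r, s]]"
  have "det g3 \<noteq> 0" using assms(3) by (simp add: g3_def det_2)
  then have "(P, transpose Q, g3) \<in> GL332" using assms(1,2) by (simp add: GL332_def invertible_det_nz)
  moreover have "act (P, transpose Q, g3) (pencil A B) = pencil A' B'"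
    by (subst pencil_slices[symmetric]) (simp add: slice_act g3_def assms(4,5))
  ultimately show ?thesis unfolding eqv_def by blast
qed

text \<open>Exchanges the two factors of size three, that is, transposes both matrices of a pencil.
  This saves half of the singular cases.\<close>

definition flip :: "'a::field tensor \<Rightarrow> 'a tensor" where
  "flip x = (\<chi> p. case p of (i, j, l) \<Rightarrow> x $ (j, i, l))"

lemma flip_nth: "flip x $ (i, j, l) = x $ (j, i, l)"
  by (simp add: flip_def)

lemma flip_act: "flip (act (g1, g2, g3) x) = act (g2, g1, g3) (flip x)"
proof -
  have "flip (act (g1, g2, g3) x) $ (i, j, l) = act (g2, g1, g3) (flip x) $ (i, j, l)" for i j l
    unfolding flip_nth act_expand by (simp add: sum_3 sum_2 flip_nth mult_ac add_ac)
  then show ?thesis by (simp add: vec_eq_iff split_paired_All)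
qed

lemma eqv_flip: "eqv x y \<Longrightarrow> eqv (flip x) (flip y)"
proof -
  assume "eqv x y"
  then obtain g1 g2 g3 where "(g1, g2, g3) \<in> GL332" "act (g1, g2, g3) x = y" by (auto simp: eqv_def)
  then have "(g2, g1, g3) \<in> GL332" "act (g2, g1, g3) (flip x) = flip y"
    by (auto simp: GL332_def simp flip: flip_act)
  then show "eqv (flip x) (flip y)" unfolding eqv_def by blast
qed

lemma flip_pencil: "flip (pencil A B) = pencil (transpose A) (transpose B)"
  by (auto simp: vec_eq_iff split_paired_All flip_nth pencil_def transpose_def)

lemma flip_flip: "flip (flip x) = x"
  by (simp add: vec_eq_iff split_paired_All flip_nth)

lemma tens_pencil:
  "tens {(1,2,2), (2,1,2), (2,2,1), (3,3,1)} = pencil (M3 0 0 0 0 1 0 0 0 1) (M3 0 1 0 1 0 0 0 0 0)"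
  "tens {(1,3,2), (2,2,2), (2,3,1), (3,1,2), (3,2,1)} = pencil (M3 0 0 0 0 0 1 0 1 0) (M3 0 0 1 0 1 0 1 0 0)"
  "tens {(1,1,2), (2,2,2), (3,3,1)} = pencil (M3 0 0 0 0 0 0 0 0 1) (M3 1 0 0 0 1 0 0 0 0)"
  "tens {(1,2,1), (2,2,2), (2,3,1), (3,3,2)} = pencil (M3 0 1 0 0 0 1 0 0 0) (M3 0 0 0 0 1 0 0 0 1)"
  "tens {(1,3,1), (2,3,2), (3,1,1), (3,2,2)} = pencil (M3 0 0 1 0 0 0 1 0 0) (M3 0 0 0 0 0 1 0 1 0)"
  "tens {(1,3,2), (2,2,2), (3,1,2), (3,3,1)} = pencil (M3 0 0 0 0 0 0 0 0 1) (M3 0 0 1 0 1 0 1 0 0)"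
  "tens {(2,1,1), (2,2,2), (3,2,1), (3,3,2)} = pencil (M3 0 0 0 1 0 0 0 1 0) (M3 0 0 0 0 1 0 0 0 1)"
  "tens {(1,3,2), (2,2,2), (3,3,1)} = pencil (M3 0 0 0 0 0 0 0 0 1) (M3 0 0 1 0 1 0 0 0 0)"
  "tens {(3,1,2), (2,2,2), (3,3,1)} = pencil (M3 0 0 0 0 0 0 0 0 1) (M3 0 0 0 0 1 0 1 0 0)"
  "tens {(2,2,1), (3,3,2)} = pencil (M3 0 0 0 0 1 0 0 0 0) (M3 0 0 0 0 0 0 0 0 1)"
  "tens {(2,3,2), (3,2,2), (3,3,1)} = pencil (M3 0 0 0 0 0 0 0 0 1) (M3 0 0 0 0 0 1 0 1 0)"
  "tens {(1,1,2), (2,2,2), (3,3,2)} = pencil (M3 0 0 0 0 0 0 0 0 0) (M3 1 0 0 0 1 0 0 0 1)"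
  "tens {(2,2,2), (3,3,2)} = pencil (M3 0 0 0 0 0 0 0 0 0) (M3 0 0 0 0 1 0 0 0 1)"
  "tens {(2,3,1), (3,3,2)} = pencil (M3 0 0 0 0 0 1 0 0 0) (M3 0 0 0 0 0 0 0 0 1)"
  "tens {(3,2,1), (3,3,2)} = pencil (M3 0 0 0 0 0 0 0 1 0) (M3 0 0 0 0 0 0 0 0 1)"
  "tens {(3,3,2)} = pencil (M3 0 0 0 0 0 0 0 0 0) (M3 0 0 0 0 0 0 0 0 1)"
  by (simp_all add: vec_eq_iff split_paired_All forall_3 forall_2 tens_def pencil_def)

text \<open>The second lower block is the companion matrix of \<open>x^2 - t x + n\<close>, the
  first one the identity.\<close>

definition quad_tensor :: "'a::field \<Rightarrow> 'a \<Rightarrow> 'a tensor" where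
  "quad_tensor t n = pencil (M3 0 0 0 0 1 0 0 0 1) (M3 0 0 0 0 0 (- n) 0 1 t)"

text \<open>The supports of representatives of all strata but the one containing the family \<open>quad_tensor\<close>.\<close>
definition rep_supports :: "(3 \<times> 3 \<times> 2) set set" where
  "rep_supports = {{(1,2,2), (2,1,2), (2,2,1), (3,3,1)}, {(1,3,2), (2,2,2), (2,3,1), (3,1,2), (3,2,1)},
    {(1,1,2), (2,2,2), (3,3,1)}, {(1,2,1), (2,2,2), (2,3,1), (3,3,2)}, {(1,3,1), (2,3,2), (3,1,1), (3,2,2)},
    {(1,3,2), (2,2,2), (3,1,2), (3,3,1)}, {(2,1,1), (2,2,2), (3,2,1), (3,3,2)}, {(1,3,2), (2,2,2), (3,3,1)},
    {(3,1,2), (2,2,2), (3,3,1)}, {(2,3,2), (3,2,2), (3,3,1)}, {(1,1,2), (2,2,2), (3,3,2)}, {(2,2,2), (3,3,2)},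
    {(2,3,1), (3,3,2)}, {(3,2,1), (3,3,2)}, {(3,3,2)}}"

text \<open>The condition on \<open>t^2 - 4 * n\<close> says that \<open>x^2 - t x + n\<close> has
  distinct roots; in characteristic 2 it reads \<open>t \<noteq> 0\<close>.\<close>

definition classified :: "'a::field tensor \<Rightarrow> bool" where
  "classified x \<longleftrightarrow> x = 0 \<or> (\<exists>S\<in>rep_supports. eqv x (tens S)) \<or> (\<exists>t n. t^2 - 4 * n \<noteq> 0 \<and> eqv x (quad_tensor t n))"

lemma classified_eqv: "eqv x y \<Longrightarrow> classified y \<Longrightarrow> classified x"
proof -
  assume e: "eqv x y" and c: "classified y"
  have "x = 0" if "y = 0"
    using eqv_sym[OF e] that by (auto simp: eqv_def act_zero)
  then show ?thesis using c eqv_trans[OF e] unfolding classified_def by blast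
qed

lemma classified_tens: "S \<in> rep_supports \<Longrightarrow> eqv x (tens S) \<Longrightarrow> classified x"
  unfolding classified_def by blast

lemma classified_quad: "t^2 - 4 * n \<noteq> 0 \<Longrightarrow> classified (quad_tensor t n)"
  unfolding classified_def using eqv_refl by blast

section \<open>Reduction by the rank of the first matrix\<close>

lemma classify_2_case_4:
  fixes m :: "'a::field"
  assumes "m \<noteq> 0"
  shows "eqv (pencil (M3 0 0 0 0 1 0 0 0 1) (M3 0 0 0 1 0 0 0 m n)) (pencil (M3 0 0 0 1 0 0 0 1 0) (M3 0 0 0 0 1 0 0 0 1))"
  by (rule eqvI[where P = "M3 1 0 0 0 m 0 0 0 1" and Q = "M3 (1/m) (n/m) 0 0 (1/m) 0 0 0 1" and p = "- n" and q = 1 and r = 1 and s = 0])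
     (use assms in \<open>simp_all add: field_simps\<close>)

lemma classify_2_case_5:
  fixes n :: "'a::field"
  shows "eqv (pencil (M3 0 0 0 0 1 0 0 0 1) (M3 0 0 0 1 0 0 0 0 n)) (pencil (M3 0 0 0 0 0 0 0 0 1) (M3 0 0 0 0 1 0 1 0 0))"
  by (rule eqvI[where P = "M3 1 0 0 0 0 1 0 1 0" and Q = "M3 n 0 1 1 0 0 0 1 0" and p = "- n" and q = 1 and r = 1 and s = 0])
     simp_all

text \<open>The cubic of this pencil is \<open>- t^2 (p s + (p n - q m) t)\<close>. For
  \<open>p \<noteq> 0\<close> its third root differs from the double one, for \<open>p = 0\<close>
  and \<open>q m \<noteq> 0\<close> the root is triple, and in the remaining cases the cubic
  vanishes.\<close>

lemma classify_2_generic: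
  fixes p :: "'a::field"
  shows "classified (pencil (M3 0 0 0 0 1 0 0 0 1) (M3 0 p q 1 0 0 0 m n))"
proof -
  let ?x = "pencil (M3 0 0 0 0 1 0 0 0 1) (M3 0 p q 1 0 0 0 m n)"
  consider "p \<noteq> 0" | "p = 0" "q \<noteq> 0" "m \<noteq> 0" | "p = 0" "q \<noteq> 0" "m = 0" | "p = 0" "q = 0" "m \<noteq> 0" | "p = 0" "q = 0" "m = 0"
    by blast
  then show ?thesis
  proof cases
    case 1
    define k where "k = q / p"
    \<comment> \<open>The cubic is now \<open>- p t^2 (s + d t)\<close>, so subtracting
      \<open>d\<close> times the first matrix from the second moves the simple root to the second
      matrix.\<close>
    define d where "d = n - m * k"
    have q: "q = k * p" using 1 by (simp add: k_def)
    have n: "n = d + m * k" by (simp add: d_def)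
    have "eqv ?x (tens {(1,2,2), (2,1,2), (2,2,1), (3,3,1)})"
      unfolding tens_pencil q n
      by (rule eqvI[where P = "M3 (1/p) 0 0 (- k * m / p) 1 k (- m / p) 0 1" and Q = "M3 1 d (- k * d) 0 1 (- k) 0 0 1" and p = 1 and q = 0 and r = "- d" and s = 1])
         (use 1 in \<open>simp_all add: field_simps\<close>)
    then show ?thesis by (rule classified_tens[rotated]) (simp add: rep_supports_def)
  next
    case 2
    have "eqv ?x (tens {(1,3,2), (2,2,2), (2,3,1), (3,1,2), (3,2,1)})"
      unfolding tens_pencil
      by (rule eqvI[where P = "M3 (1/q) 0 0 (- n / q) 0 1 0 m 0" and Q = "M3 (1/m) 0 0 0 (1/m) 0 0 0 1" and p = 1 and q = 0 and r = 0 and s = 1])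
         (use 2 in \<open>simp_all add: field_simps\<close>)
    then show ?thesis by (rule classified_tens[rotated]) (simp add: rep_supports_def)
  next
    case 3
    have "eqv ?x (tens {(1,3,1), (2,3,2), (3,1,1), (3,2,2)})"
      unfolding tens_pencil
      by (rule eqvI[where P = "M3 (1/q) 0 0 (- n / q) 0 1 0 1 0" and Q = "M3 1 0 0 0 1 0 0 0 1" and p = 0 and q = 1 and r = 1 and s = 0])
         (use 3 in \<open>simp_all add: field_simps\<close>)
    then show ?thesis by (rule classified_tens[rotated]) (simp add: rep_supports_def)
  next
    case 4
    have "eqv ?x (tens {(2,1,1), (2,2,2), (3,2,1), (3,3,2)})"
      unfolding tens_pencil using 4 classify_2_case_4 by simp
    then show ?thesis by (rule classified_tens[rotated]) (simp add: rep_supports_def)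
  next
    case 5
    have "eqv ?x (tens {(3,1,2), (2,2,2), (3,3,1)})"
      unfolding tens_pencil using 5 classify_2_case_5 by simp
    then show ?thesis by (rule classified_tens[rotated]) (simp add: rep_supports_def)
  qed
qed

text \<open>The lower part of the first column of \<open>B\<close> is moved to a unit vector by
  conjugating the lower blocks, which fixes the identity block of \<open>A\<close>. Multiples of the
  first column then clear the second row of \<open>B\<close>; they do not affect \<open>A\<close>,
  whose first column is zero. A vanishing first row of \<open>B\<close> survives, which the
  transposed case uses.\<close>

lemma classify_2_column:
  fixes a :: "'a::field"
  assumes "c \<noteq> 0 \<or> d \<noteq> 0"
  shows "\<exists>p q m n. eqv (pencil (M3 0 0 0 0 1 0 0 0 1) (M3 0 a b c e f d g h)) (pencil (M3 0 0 0 0 1 0 0 0 1) (M3 0 p q 1 0 0 0 m n)) \<and>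
    (a = 0 \<and> b = 0 \<longrightarrow> p = 0 \<and> q = 0)"
proof (cases "c = 0")
  case False
  let ?e = "e + f * d / c" and ?f = "f / c" and ?g = "c * g + c * h * d / c - d * e - d * f * d / c" and ?h = "h - d * f / c"
  show ?thesis
    by - (rule ex4I[of _ "a * c + b * d" b ?g ?h], intro conjI eqvI[where P = "M3 1 0 0 0 (1/c) 0 0 (-d/c) 1" and Q = "M3 1 (- ?e) (- ?f) 0 c 0 0 d 1" and p = 1 and q = 0 and r = 0 and s = 1], (use False in \<open>simp_all add: field_simps\<close>))
next
  case True
  then have d: "d \<noteq> 0" using assms by simp
  show ?thesis
    by - (rule ex4I[of _ "b * d" a "f * d" e], intro conjI eqvI[where P = "M3 1 0 0 0 0 (1/d) 0 1 0" and Q = "M3 1 (- h) (- g / d) 0 0 1 0 d 0" and p = 1 and q = 0 and r = 0 and s = 1], (use True d in \<open>simp_all add: field_simps\<close>))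
qed

text \<open>A \<open>2 \<times> 2\<close> matrix that is not scalar has a cyclic vector and is
  similar to the companion matrix of its characteristic polynomial. The lower columns of
  \<open>Q\<close> are a cyclic vector and its image; the vector is the first or second unit vector
  or, for diagonal matrices, their sum.\<close>

lemma quad_tensor_similar:
  fixes a :: "'a::field"
  assumes "b \<noteq> 0 \<or> c \<noteq> 0 \<or> a \<noteq> d"
  shows "eqv (pencil (M3 0 0 0 0 1 0 0 0 1) (M3 0 0 0 0 a b 0 c d)) (quad_tensor (a + d) (a * d - b * c))"
proof (cases "c = 0")
  case False
  show ?thesis unfolding quad_tensor_def
    by (rule eqvI[where P = "M3 1 0 0 0 1 (- a / c) 0 0 (1 / c)" and Q = "M3 1 0 0 0 1 a 0 0 c" and p = 1 and q = 0 and r = 0 and s = 1])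
       (use False in \<open>simp_all add: field_simps\<close>)
next
  case c: True
  show ?thesis
  proof (cases "b = 0")
    case False
    show ?thesis unfolding quad_tensor_def
      by (rule eqvI[where P = "M3 1 0 0 0 (- d / b) 1 0 (1 / b) 0" and Q = "M3 1 0 0 0 0 b 0 1 d" and p = 1 and q = 0 and r = 0 and s = 1])
         (use False c in \<open>simp_all add: field_simps\<close>)
  next
    case True
    obtain k where k: "d = a + k" "k \<noteq> 0" using True c assms by (metis add.commute diff_add_cancel eq_iff_diff_eq_0)
    show ?thesis unfolding quad_tensor_def
      by (rule eqvI[where P = "M3 1 0 0 0 (d / k) (- a / k) 0 (- 1 / k) (1 / k)" and Q = "M3 1 0 0 0 1 a 0 1 d" and p = 1 and q = 0 and r = 0 and s = 1])
         (use True c k(2) in \<open>simp_all add: k(1) field_simps\<close>)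
  qed
qed

text \<open>The block is a Jordan block with eigenvalue \<open>u\<close>. Subtracting
  \<open>u\<close> times the identity leaves a nilpotent matrix of rank one, which becomes the new
  first matrix.\<close>

lemma classify_quad_degenerate:
  fixes u :: "'a::field"
  shows "classified (quad_tensor (2 * u) (u^2))"
proof -
  have "eqv (quad_tensor (2 * u) (u^2)) (tens {(2,3,2), (3,2,2), (3,3,1)})"
    unfolding tens_pencil quad_tensor_def
    by (rule eqvI[where P = "M3 1 0 0 0 1 0 0 0 1 ** M3 1 0 0 0 1 u 0 0 1" and Q = "M3 1 0 0 0 (- u) 1 0 1 0" and p = "- u" and q = 1 and r = 1 and s = 0])
       (simp_all add: power2_eq_square algebra_simps)
  then show ?thesis by (rule classified_tens[rotated]) (simp add: rep_supports_def)
qed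

text \<open>\<open>dbl\<close> says that a quadratic polynomial with discriminant 0 is the square of
  a rational linear one, which is where characteristic 2 needs a perfect field.\<close>

lemma classify_2_square:
  fixes a :: "'a::field"
  assumes dbl: "\<And>t n :: 'a. t^2 = 4 * n \<Longrightarrow> \<exists>u. t = 2 * u \<and> n = u^2"
  shows "classified (pencil (M3 0 0 0 0 1 0 0 0 1) (M3 0 0 0 0 a b 0 c d))"
proof (cases "b \<noteq> 0 \<or> c \<noteq> 0 \<or> a \<noteq> d")
  case True
  then show ?thesis
    using classified_eqv[OF quad_tensor_similar] dbl[of "a + d" "a * d - b * c"] classify_quad_degenerate
      classified_quad[of "a + d" "a * d - b * c"] by (metis eq_iff_diff_eq_0)
next
  case False
  have "eqv (pencil (M3 0 0 0 0 1 0 0 0 1) (M3 0 0 0 0 a b 0 c d)) (tens {(2,2,2), (3,3,2)})"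
    unfolding tens_pencil
    by (rule eqvI[where P = "M3 1 0 0 0 1 0 0 0 1" and Q = "M3 1 0 0 0 1 0 0 0 1" and p = "- a" and q = 1 and r = 1 and s = 0])
       (use False in simp_all)
  then show ?thesis by (rule classified_tens[rotated]) (simp add: rep_supports_def)
qed

lemma classify_rank_2:
  fixes a :: "'a::field"
  assumes dbl: "\<And>t n :: 'a. t^2 = 4 * n \<Longrightarrow> \<exists>u. t = 2 * u \<and> n = u^2"
  shows "classified (pencil (M3 0 0 0 0 1 0 0 0 1) (M3 0 a b c e f d g h))"
proof (cases "c \<noteq> 0 \<or> d \<noteq> 0")
  case True
  then show ?thesis using classify_2_column[OF True] classify_2_generic classified_eqv by blast
next
  case cd: False
  let ?x = "pencil (M3 0 0 0 0 1 0 0 0 1) (M3 0 a b c e f d g h)"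
  show ?thesis
  proof (cases "a = 0 \<and> b = 0")
    case True
    then show ?thesis using cd classify_2_square[OF dbl] by simp
  next
    case False
    \<comment> \<open>The first column of \<open>B\<close> is zero but its first row is not, so the
      transposed pencil has the column needed.\<close>
    have fl: "flip ?x = pencil (M3 0 0 0 0 1 0 0 0 1) (M3 0 0 0 a e g b f h)"
      using cd by (simp add: flip_pencil)
    obtain m n where e: "eqv (flip ?x) (pencil (M3 0 0 0 0 1 0 0 0 1) (M3 0 0 0 1 0 0 0 m n))"
      unfolding fl using classify_2_column[of a b 0 0 e g f h] False by blast
    show ?thesis
    proof (cases "m = 0")
      case True
      have "eqv (pencil (M3 0 0 0 0 1 0 0 0 1) (M3 0 0 0 1 0 0 0 m n)) (pencil (M3 0 0 0 0 0 0 0 0 1) (M3 0 0 0 0 1 0 1 0 0))"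
        using classify_2_case_5 True by simp
      from eqv_flip[OF eqv_trans[OF e this]] have "eqv ?x (tens {(1,3,2), (2,2,2), (3,3,1)})"
        unfolding tens_pencil by (simp add: flip_flip) (simp add: flip_pencil)
      then show ?thesis by (rule classified_tens[rotated]) (simp add: rep_supports_def)
    next
      case False
      have "eqv (pencil (M3 0 0 0 0 1 0 0 0 1) (M3 0 0 0 1 0 0 0 m n)) (pencil (M3 0 0 0 1 0 0 0 1 0) (M3 0 0 0 0 1 0 0 0 1))"
        by (rule classify_2_case_4[OF False])
      from eqv_flip[OF eqv_trans[OF e this]] have "eqv ?x (tens {(1,2,1), (2,2,2), (2,3,1), (3,3,2)})"
        unfolding tens_pencil by (simp add: flip_flip) (simp add: flip_pencil)
      then show ?thesis by (rule classified_tens[rotated]) (simp add: rep_supports_def)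
    qed
  qed
qed

text \<open>The lower block of \<open>B\<close> is already in rank normal form. Where it has a
  pivot, it clears the first row and column; the corner of \<open>B\<close> is removed by
  subtracting a multiple of \<open>A\<close>.\<close>

lemma classify_rank_1:
  fixes a :: "'a::field"
  assumes ef: "(e = 0 \<and> f = 0) \<or> (e = 1 \<and> f = 0) \<or> (e = 1 \<and> f = 1)"
  shows "classified (pencil (M3 1 0 0 0 0 0 0 0 0) (M3 a r1 r2 c1 e 0 c2 0 f))"
  using ef
proof (elim disjE)
  assume 1: "e = 1 \<and> f = 1"
  \<comment> \<open>The multiple of \<open>A\<close> to be subtracted is the Schur complement of the
    identity block in \<open>B\<close>.\<close>
  have "eqv (pencil (M3 1 0 0 0 0 0 0 0 0) (M3 a r1 r2 c1 e 0 c2 0 f)) (tens {(1,1,2), (2,2,2), (3,3,1)})"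
    unfolding tens_pencil
    by (rule eqvI[where P = "M3 0 1 0 0 0 1 1 (- r1) (- r2)" and Q = "M3 0 0 1 1 0 (- c1) 0 1 (- c2)" and p = 1 and q = 0 and r = "- (a - r1 * c1 - r2 * c2)" and s = 1])
       (use 1 in \<open>simp_all add: algebra_simps\<close>)
  then show ?thesis by (rule classified_tens[rotated]) (simp add: rep_supports_def)
next
  assume 1: "e = 1 \<and> f = 0"
  define k where "k = a - r1 * c1"
  have a: "a = k + r1 * c1" by (simp add: k_def)
  have x: "eqv (pencil (M3 1 0 0 0 0 0 0 0 0) (M3 a r1 r2 c1 e 0 c2 0 f)) (pencil (M3 1 0 0 0 0 0 0 0 0) (M3 0 0 r2 0 1 0 c2 0 0))"
    by (rule eqvI[where P = "M3 1 (- r1) 0 0 1 0 0 0 1" and Q = "M3 1 0 0 (- c1) 1 0 0 0 1" and p = 1 and q = 0 and r = "- k" and s = 1])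
       (use 1 a in \<open>simp_all add: algebra_simps\<close>)
  consider "r2 \<noteq> 0" "c2 \<noteq> 0" | "r2 \<noteq> 0" "c2 = 0" | "r2 = 0" "c2 \<noteq> 0" | "r2 = 0" "c2 = 0" by blast
  then have "classified (pencil (M3 1 0 0 0 0 0 0 0 0) (M3 0 0 r2 0 1 0 c2 0 0))" (is "classified ?y")
  proof cases
    case 1
    have "eqv ?y (tens {(1,3,2), (2,2,2), (3,1,2), (3,3,1)})"
      unfolding tens_pencil
      by (rule eqvI[where P = "M3 0 0 (1/c2) 0 1 0 1 0 0" and Q = "M3 0 0 1 0 1 0 (1/r2) 0 0" and p = 1 and q = 0 and r = 0 and s = 1])
         (use 1 in \<open>simp_all add: field_simps\<close>)
    then show ?thesis by (rule classified_tens[rotated]) (simp add: rep_supports_def)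
  next
    case 2
    have "eqv ?y (tens {(3,1,2), (2,2,2), (3,3,1)})"
      unfolding tens_pencil
      by (rule eqvI[where P = "M3 0 0 1 0 1 0 1 0 0" and Q = "M3 0 0 1 0 1 0 (1/r2) 0 0" and p = 1 and q = 0 and r = 0 and s = 1])
         (use 2 in \<open>simp_all add: field_simps\<close>)
    then show ?thesis by (rule classified_tens[rotated]) (simp add: rep_supports_def)
  next
    case 3
    have "eqv ?y (tens {(1,3,2), (2,2,2), (3,3,1)})"
      unfolding tens_pencil
      by (rule eqvI[where P = "M3 0 0 (1/c2) 0 1 0 1 0 0" and Q = "M3 0 0 1 0 1 0 1 0 0" and p = 1 and q = 0 and r = 0 and s = 1])
         (use 3 in \<open>simp_all add: field_simps\<close>)
    then show ?thesis by (rule classified_tens[rotated]) (simp add: rep_supports_def)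
  next
    case 4
    \<comment> \<open>Two complementary matrices of rank one: the split member of the family, with
      polynomial \<open>x^2 - x\<close>.\<close>
    have "eqv ?y (quad_tensor 1 0)" unfolding quad_tensor_def
      by (rule eqvI[where P = "M3 0 0 1 1 0 0 (- 1) 1 0" and Q = "M3 0 1 0 0 1 1 1 0 0" and p = 1 and q = 1 and r = 0 and s = 1])
         (use 4 in simp_all)
    then show ?thesis using classified_eqv classified_quad[of 1 0] by fastforce
  qed
  then show ?thesis using classified_eqv x by blast
next
  assume 0: "e = 0 \<and> f = 0"
  have x: "eqv (pencil (M3 1 0 0 0 0 0 0 0 0) (M3 a r1 r2 c1 e 0 c2 0 f)) (pencil (M3 1 0 0 0 0 0 0 0 0) (M3 0 r1 r2 c1 0 0 c2 0 0))"
    by (rule eqvI[where P = "M3 1 0 0 0 1 0 0 0 1" and Q = "M3 1 0 0 0 1 0 0 0 1" and p = 1 and q = 0 and r = "- a" and s = 1])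
       (use 0 in simp_all)
  \<comment> \<open>An invertible \<open>2 \<times> 2\<close> matrix taking \<open>(u, v)\<close> to
    \<open>(1, 0)\<close>, unless \<open>(u, v)\<close> is zero.\<close>
  have vec: "\<exists>p q r s. p * s - q * r \<noteq> 0 \<and> p * u + q * v = (if u = 0 \<and> v = 0 then 0 else 1) \<and> r * u + s * v = 0" for u v :: 'a
  proof (cases "u = 0")
    case True
    show ?thesis
    proof (cases "v = 0")
      case v: True
      show ?thesis using True v
        by - (rule ex4I[of _ 1 0 0 1], simp)
    next
      case False
      then show ?thesis using True
        by - (rule ex4I[of _ 0 "1/v" 1 0], simp)
    qed
  next
    case False
    then show ?thesis by - (rule ex4I[of _ "1/u" 0 "- v" u], (simp add: algebra_simps))
  qed
  obtain p q r s where R: "p * s - q * r \<noteq> 0" "p * r1 + q * r2 = (if r1 = 0 \<and> r2 = 0 then 0 else 1)" "r * r1 + s * r2 = 0"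
    using vec by blast
  obtain p' q' r' s' where C: "p' * s' - q' * r' \<noteq> 0" "p' * c1 + q' * c2 = (if c1 = 0 \<and> c2 = 0 then 0 else 1)" "r' * c1 + s' * c2 = 0"
    using vec by blast
  define \<rho> \<kappa> :: 'a where "\<rho> = (if r1 = 0 \<and> r2 = 0 then 0 else 1)" and "\<kappa> = (if c1 = 0 \<and> c2 = 0 then 0 else 1)"
  have y: "eqv (pencil (M3 1 0 0 0 0 0 0 0 0) (M3 0 r1 r2 c1 0 0 c2 0 0)) (pencil (M3 1 0 0 0 0 0 0 0 0) (M3 0 \<rho> 0 \<kappa> 0 0 0 0 0))"
    by (rule eqvI[where P = "M3 1 0 0 0 p' q' 0 r' s'" and Q = "M3 1 0 0 0 p r 0 q s" and p = 1 and q = 0 and r = 0 and s = 1])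
       (use R C in \<open>simp_all add: \<rho>_def \<kappa>_def mult.commute\<close>)
  consider "\<rho> = 1" "\<kappa> = 1" | "\<rho> = 1" "\<kappa> = 0" | "\<rho> = 0" "\<kappa> = 1" | "\<rho> = 0" "\<kappa> = 0"
    unfolding \<rho>_def \<kappa>_def by metis
  then have "classified (pencil (M3 1 0 0 0 0 0 0 0 0) (M3 0 \<rho> 0 \<kappa> 0 0 0 0 0))" (is "classified ?y")
  proof cases
    case 1
    have "eqv ?y (tens {(2,3,2), (3,2,2), (3,3,1)})"
      unfolding tens_pencil
      by (rule eqvI[where P = "M3 0 0 1 0 1 0 1 0 0" and Q = "M3 0 0 1 0 1 0 1 0 0" and p = 1 and q = 0 and r = 0 and s = 1])
         (use 1 in simp_all)
    then show ?thesis by (rule classified_tens[rotated]) (simp add: rep_supports_def)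
  next
    case 2
    have "eqv ?y (tens {(3,2,1), (3,3,2)})"
      unfolding tens_pencil
      by (rule eqvI[where P = "M3 0 0 1 0 1 0 1 0 0" and Q = "M3 0 1 0 0 0 1 1 0 0" and p = 1 and q = 0 and r = 0 and s = 1])
         (use 2 in simp_all)
    then show ?thesis by (rule classified_tens[rotated]) (simp add: rep_supports_def)
  next
    case 3
    have "eqv ?y (tens {(2,3,1), (3,3,2)})"
      unfolding tens_pencil
      by (rule eqvI[where P = "M3 0 0 1 1 0 0 0 1 0" and Q = "M3 0 0 1 0 1 0 1 0 0" and p = 1 and q = 0 and r = 0 and s = 1])
         (use 3 in simp_all)
    then show ?thesis by (rule classified_tens[rotated]) (simp add: rep_supports_def)
  next
    case 4
    have "eqv ?y (tens {(3,3,2)})"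
      unfolding tens_pencil
      by (rule eqvI[where P = "M3 0 0 1 0 1 0 1 0 0" and Q = "M3 0 0 1 0 1 0 1 0 0" and p = 0 and q = 1 and r = 1 and s = 0])
         (use 4 in simp_all)
    then show ?thesis by (rule classified_tens[rotated]) (simp add: rep_supports_def)
  qed
  then show ?thesis using classified_eqv x y by blast
qed

section \<open>Rank normal form of a single matrix\<close>

lemma pencil_equiv_PQ: "det P \<noteq> 0 \<Longrightarrow> det Q \<noteq> 0 \<Longrightarrow> eqv (pencil A B) (pencil (P ** A ** Q) (P ** B ** Q))"
  for P :: "'a::field^3^3"
proof -
  have l: "lcomb 1 M 0 N = M" "lcomb 0 M 1 N = N" for M N :: "'a^3^3"
    by (simp_all add: lcomb_def vec_eq_iff)
  show "det P \<noteq> 0 \<Longrightarrow> det Q \<noteq> 0 \<Longrightarrow> eqv (pencil A B) (pencil (P ** A ** Q) (P ** B ** Q))"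
    by (rule eqvI[where p = 1 and q = 0 and r = 0 and s = 1]) (simp_all add: l)
qed

text \<open>Elimination with pivot \<open>a\<close>, written in scalars so that the transformations
  can be inserted as lower blocks of \<open>M3\<close>. The quantity \<open>e\<close> is the Schur
  complement.\<close>

lemma rank_normal_form_2_pivot:
  fixes a :: "'a::field"
  assumes "a \<noteq> 0"
  shows "\<exists>p q r s p' q' r' s' f. p * s - q * r \<noteq> 0 \<and> p' * s' - q' * r' \<noteq> 0 \<and> (f = 0 \<or> f = 1) \<and>
    p * (a * p' + b * r') + q * (c * p' + d * r') = 1 \<and> p * (a * q' + b * s') + q * (c * q' + d * s') = 0 \<and>
    r * (a * p' + b * r') + s * (c * p' + d * r') = 0 \<and> r * (a * q' + b * s') + s * (c * q' + d * s') = f"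
proof -
  obtain k where k: "b = k * a" using assms by (metis nonzero_divide_eq_eq)
  obtain m where m: "c = m * a" using assms by (metis nonzero_divide_eq_eq)
  define e where "e = d - m * k * a"
  have d: "d = e + m * k * a" by (simp add: e_def)
  show ?thesis
  proof (cases "e = 0")
    case True
    show ?thesis
      by - (rule ex9I[of _ "1/a" 0 "- m" 1 1 "- k" 0 1 0], (use assms True in \<open>simp add: k m d algebra_simps\<close>))
  next
    case False
    show ?thesis
      by - (rule ex9I[of _ "1/a" 0 "- m / e" "1 / e" 1 "- k" 0 1 1], (use assms False in \<open>simp add: k m d field_simps\<close>))
  qed
qed

lemma rank_normal_form_2:
  fixes a b c d :: "'a::field"
  shows "\<exists>p q r s p' q' r' s' e f. p * s - q * r \<noteq> 0 \<and> p' * s' - q' * r' \<noteq> 0 \<and>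
    ((e = 0 \<and> f = 0) \<or> (e = 1 \<and> f = 0) \<or> (e = 1 \<and> f = 1)) \<and>
    p * (a * p' + b * r') + q * (c * p' + d * r') = e \<and> p * (a * q' + b * s') + q * (c * q' + d * s') = 0 \<and>
    r * (a * p' + b * r') + s * (c * p' + d * r') = 0 \<and> r * (a * q' + b * s') + s * (c * q' + d * s') = f"
proof -
  consider "a \<noteq> 0" | "b \<noteq> 0" | "c \<noteq> 0" | "d \<noteq> 0" | "a = 0" "b = 0" "c = 0" "d = 0" by blast
  then show ?thesis
  proof cases
    case 1
    then show ?thesis using rank_normal_form_2_pivot[OF 1, of b c d] by blast
  next
    case 2
    obtain p q r s p' q' r' s' f where h: "p * s - q * r \<noteq> 0" "p' * s' - q' * r' \<noteq> 0" "f = 0 \<or> f = 1"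
      "p * (b * p' + a * r') + q * (d * p' + c * r') = 1" "p * (b * q' + a * s') + q * (d * q' + c * s') = 0"
      "r * (b * p' + a * r') + s * (d * p' + c * r') = 0" "r * (b * q' + a * s') + s * (d * q' + c * s') = f"
      using rank_normal_form_2_pivot[OF 2, of a d c] by blast
    have "r' * q' - s' * p' \<noteq> 0" using h(2) by (simp add: mult.commute)
    then show ?thesis using h
      by - (rule ex10I[of _ p q r s r' s' p' q' 1 f], (simp add: add.commute))
  next
    case 3
    obtain p q r s p' q' r' s' f where h: "p * s - q * r \<noteq> 0" "p' * s' - q' * r' \<noteq> 0" "f = 0 \<or> f = 1"
      "p * (c * p' + d * r') + q * (a * p' + b * r') = 1" "p * (c * q' + d * s') + q * (a * q' + b * s') = 0"
      "r * (c * p' + d * r') + s * (a * p' + b * r') = 0" "r * (c * q' + d * s') + s * (a * q' + b * s') = f"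
      using rank_normal_form_2_pivot[OF 3, of d a b] by blast
    have "q * r - p * s \<noteq> 0" using h(1) by (simp add: mult.commute)
    then show ?thesis using h
      by - (rule ex10I[of _ q p s r p' q' r' s' 1 f], (simp add: add.commute))
  next
    case 4
    obtain p q r s p' q' r' s' f where h: "p * s - q * r \<noteq> 0" "p' * s' - q' * r' \<noteq> 0" "f = 0 \<or> f = 1"
      "p * (d * p' + c * r') + q * (b * p' + a * r') = 1" "p * (d * q' + c * s') + q * (b * q' + a * s') = 0"
      "r * (d * p' + c * r') + s * (b * p' + a * r') = 0" "r * (d * q' + c * s') + s * (b * q' + a * s') = f"
      using rank_normal_form_2_pivot[OF 4, of c b a] by blast
    have "q * r - p * s \<noteq> 0" "r' * q' - s' * p' \<noteq> 0" using h(1,2) by (simp_all add: mult.commute)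
    then show ?thesis using h
      by - (rule ex10I[of _ q p s r r' s' p' q' 1 f], (simp add: add.commute))
  next
    case 5
    then show ?thesis
      by - (rule ex10I[of _ 1 0 0 1 1 0 0 1 0 0], simp)
  qed
qed

definition mat_equiv :: "'a::field^3^3 \<Rightarrow> 'a^3^3 \<Rightarrow> bool" where
  "mat_equiv A B \<longleftrightarrow> (\<exists>P Q. det P \<noteq> 0 \<and> det Q \<noteq> 0 \<and> P ** A ** Q = B)"

lemma mat_equivI: "det P \<noteq> 0 \<Longrightarrow> det Q \<noteq> 0 \<Longrightarrow> P ** A ** Q = B \<Longrightarrow> mat_equiv A B"
  unfolding mat_equiv_def by blast

lemma mat_equiv_trans: "mat_equiv A B \<Longrightarrow> mat_equiv B C \<Longrightarrow> mat_equiv A C"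
proof -
  assume "mat_equiv A B" "mat_equiv B C"
  then obtain P Q P' Q' where "det P \<noteq> 0" "det Q \<noteq> 0" "P ** A ** Q = B" "det P' \<noteq> 0" "det Q' \<noteq> 0" "P' ** B ** Q' = C"
    unfolding mat_equiv_def by blast
  then show ?thesis
    by (intro mat_equivI[of "P' ** P" "Q ** Q'"]) (auto simp: det_mul matrix_mul_assoc)
qed

lemma rank_normal_form:
  fixes A :: "'a::field^3^3"
  shows "mat_equiv A (M3 0 0 0 0 0 0 0 0 0) \<or> mat_equiv A (M3 1 0 0 0 0 0 0 0 0) \<or>
    mat_equiv A (M3 0 0 0 0 1 0 0 0 1) \<or> mat_equiv A (M3 1 0 0 0 1 0 0 0 1)"
proof (cases "A = M3 0 0 0 0 0 0 0 0 0")
  case True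
  have "mat_equiv A (M3 0 0 0 0 0 0 0 0 0)"
    by (rule mat_equivI[of "M3 1 0 0 0 1 0 0 0 1" "M3 1 0 0 0 1 0 0 0 1"]) (simp_all add: True)
  then show ?thesis ..
next
  case False
  obtain a b c d e f g h i where A: "A = M3 a b c d e f g h i" by (rule M3_cases)
  let ?I = "M3 1 0 0 0 1 0 0 0 1 :: 'a^3^3" and ?S = "M3 0 1 0 1 0 0 0 0 1 :: 'a^3^3" and ?T = "M3 0 0 1 0 1 0 1 0 0 :: 'a^3^3"
  have "\<exists>a' b c d e f g h i. a' \<noteq> 0 \<and> mat_equiv A (M3 a' b c d e f g h i)"
  proof -
    have ex: "\<exists>a' b c d e f g h i. a' \<noteq> 0 \<and> mat_equiv A (M3 a' b c d e f g h i)"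
      if "det P \<noteq> 0" "det Q \<noteq> 0" "(P ** A ** Q) $ 1 $ 1 \<noteq> 0" for P Q
    proof -
      obtain a b c d e f g h i where M: "P ** A ** Q = M3 a b c d e f g h i" by (rule M3_cases)
      have "a \<noteq> 0" using that(3) unfolding M by simp
      then show ?thesis using mat_equivI[OF that(1,2) M] by blast
    qed
    consider "a \<noteq> 0" | "b \<noteq> 0" | "c \<noteq> 0" | "d \<noteq> 0" | "e \<noteq> 0" | "f \<noteq> 0" | "g \<noteq> 0" | "h \<noteq> 0" | "i \<noteq> 0"
      using False A by auto
    then show ?thesis
    proof cases
      case 1 then show ?thesis by (intro ex[of ?I ?I]) (auto simp: A)
    next
      case 2 then show ?thesis by (intro ex[of ?I ?S]) (auto simp: A)
    next
      case 3 then show ?thesis by (intro ex[of ?I ?T]) (auto simp: A)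
    next
      case 4 then show ?thesis by (intro ex[of ?S ?I]) (auto simp: A)
    next
      case 5 then show ?thesis by (intro ex[of ?S ?S]) (auto simp: A)
    next
      case 6 then show ?thesis by (intro ex[of ?S ?T]) (auto simp: A)
    next
      case 7 then show ?thesis by (intro ex[of ?T ?I]) (auto simp: A)
    next
      case 8 then show ?thesis by (intro ex[of ?T ?S]) (auto simp: A)
    next
      case 9 then show ?thesis by (intro ex[of ?T ?T]) (auto simp: A)
    qed
  qed
  then obtain a b c d e f g h i where a: "a \<noteq> 0" and e1: "mat_equiv A (M3 a b c d e f g h i)" by blast
  have e2: "mat_equiv (M3 a b c d e f g h i) (M3 1 0 0 0 (e - d * b / a) (f - d * c / a) 0 (h - g * b / a) (i - g * c / a))"
    by (rule mat_equivI[of "M3 (1/a) 0 0 (- d / a) 1 0 (- g / a) 0 1" "M3 1 (- b / a) (- c / a) 0 1 0 0 0 1"])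
       (use a in \<open>simp_all add: field_simps\<close>)
  obtain p q r s p' q' r' s' u v where R: "p * s - q * r \<noteq> 0" "p' * s' - q' * r' \<noteq> 0"
    "(u = 0 \<and> v = 0) \<or> (u = 1 \<and> v = 0) \<or> (u = 1 \<and> v = 1)" and
    E: "p * ((e - d * b / a) * p' + (f - d * c / a) * r') + q * ((h - g * b / a) * p' + (i - g * c / a) * r') = u"
    "p * ((e - d * b / a) * q' + (f - d * c / a) * s') + q * ((h - g * b / a) * q' + (i - g * c / a) * s') = 0"
    "r * ((e - d * b / a) * p' + (f - d * c / a) * r') + s * ((h - g * b / a) * p' + (i - g * c / a) * r') = 0"
    "r * ((e - d * b / a) * q' + (f - d * c / a) * s') + s * ((h - g * b / a) * q' + (i - g * c / a) * s') = v"
    using rank_normal_form_2[of "e - d * b / a" "f - d * c / a" "h - g * b / a" "i - g * c / a"] by blast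
  have "mat_equiv (M3 1 0 0 0 (e - d * b / a) (f - d * c / a) 0 (h - g * b / a) (i - g * c / a)) (M3 1 0 0 0 u 0 0 0 v)"
  proof (rule mat_equivI[of "M3 1 0 0 0 p q 0 r s" "M3 1 0 0 0 p' q' 0 r' s'"])
    have m: "(p * x + q * y) * z + (p * x' + q * y') * z' = p * (x * z + x' * z') + q * (y * z + y' * z')" for p q x y z x' y' z' :: 'a
      by (simp add: algebra_simps)
    show "M3 1 0 0 0 p q 0 r s ** M3 1 0 0 0 (e - d * b / a) (f - d * c / a) 0 (h - g * b / a) (i - g * c / a) ** M3 1 0 0 0 p' q' 0 r' s' = M3 1 0 0 0 u 0 0 0 v"
      by (simp add: m E)
  qed (use R in simp_all)
  then have e3: "mat_equiv A (M3 1 0 0 0 u 0 0 0 v)" using e1 e2 mat_equiv_trans by blast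
  \<comment> \<open>Rank two is moved to the lower corner, where the identity block of
    \<open>quad_tensor\<close> lies.\<close>
  have "mat_equiv (M3 1 0 0 0 1 0 0 0 0) (M3 0 0 0 0 1 0 0 0 1 :: 'a^3^3)"
    by (rule mat_equivI[of ?T ?T]) simp_all
  then show ?thesis using e3 R(3) mat_equiv_trans by blast
qed

section \<open>Rationality of the double root\<close>

definition lift_mat :: "'k::field^3^3 \<Rightarrow> 'k alg_closure^3^3" where
  "lift_mat A = (\<chi> i j. to_ac (A $ i $ j))"

lemma lift_mat_mult: "lift_mat (A ** B) = lift_mat A ** lift_mat B"
  by (simp add: lift_mat_def matrix_matrix_mult_def vec_eq_iff to_ac_sum)

lemma lift_mat_lcomb: "lift_mat (lcomb a A b B) = lcomb (to_ac a) (lift_mat A) (to_ac b) (lift_mat B)"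
  by (simp add: lift_mat_def lcomb_def vec_eq_iff)

lemma lift_mat_cubic_coeff: "cubic_coeff k (lift_mat A) (lift_mat B) = to_ac (cubic_coeff k A B)"
  by (simp add: cubic_coeff_def Let_def det_3 lift_mat_def)

lemma lcomb_PQ: "lcomb s (P ** A ** Q) t (P ** B ** Q) = P ** lcomb s A t B ** Q"
  by (simp add: vec_eq_iff matrix_matrix_mult_def sum_3 lcomb_def) (simp add: algebra_simps)

lemma lcomb_lcomb: "lcomb s (lcomb p A q B) t (lcomb p' A q' B) = lcomb (s * p + t * p') A (s * q + t * q') B"
  by (simp add: vec_eq_iff lcomb_def) (simp add: algebra_simps)

text \<open>\<open>det (s A + t B)\<close> is divisible by \<open>t\<^sup>2\<close>, stated over the algebraic closure since a polynomial
  over a finite field is not determined by its values.\<close>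
definition double_root_at_A :: "'k::field^3^3 \<Rightarrow> 'k^3^3 \<Rightarrow> bool" where
  "double_root_at_A A B \<longleftrightarrow> (\<exists>c d. \<forall>s t. det (lcomb s (lift_mat A) t (lift_mat B)) = t^2 * (c * s + d * t))"

lemma double_root_at_A_PQ:
  assumes "double_root_at_A A B"
  shows "double_root_at_A (P ** A ** Q) (P ** B ** Q)"
proof -
  obtain c d where e: "\<And>s t. det (lcomb s (lift_mat A) t (lift_mat B)) = t^2 * (c * s + d * t)"
    using assms unfolding double_root_at_A_def by blast
  have r: "u * (v^2 * (c * s + d * t)) * w = v^2 * (u * w * c * s + u * w * d * t)" for u v w s t
    by (simp add: algebra_simps)
  show ?thesis unfolding double_root_at_A_def lift_mat_mult lcomb_PQ det_mul e r by blast
qed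

lemma double_root_at_A_coeffs:
  assumes "double_root_at_A A B"
  shows "det A = 0" "cubic_coeff 1 A B = 0"
proof -
  obtain c d where e: "\<And>s t. det (lcomb s (lift_mat A) t (lift_mat B)) = t^2 * (c * s + d * t)"
    using assms unfolding double_root_at_A_def by blast
  let ?k = "\<lambda>k. cubic_coeff k (lift_mat A) (lift_mat B)"
  have "?k 0 = 0 \<and> ?k 1 = 0 \<and> ?k 2 = c \<and> ?k 3 = d"
  proof (rule cubic_unique)
    fix s t
    show "?k 0 * s^3 + ?k 1 * s^2 * t + ?k 2 * s * t^2 + ?k 3 * t^3 = 0 * s^3 + 0 * s^2 * t + c * s * t^2 + d * t^3"
      using e[of s t] unfolding det_lcomb by (simp add: algebra_simps power2_eq_square power3_eq_cube)
  qed
  then have "cubic_coeff 0 A B = 0" "cubic_coeff 1 A B = 0"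
    unfolding lift_mat_cubic_coeff to_ac_eq_0_iff by blast+
  then show "det A = 0" "cubic_coeff 1 A B = 0" by (simp_all add: cubic_coeff_def)
qed

lemma perfect_field_CHAR:
  assumes "perfect_field TYPE('k::field)" "Factorial_Ring.prime p" "of_nat p = (0 :: 'k)"
  shows "\<exists>y::'k. y ^ p = c"
proof -
  have "CHAR('k) dvd p" using assms(3) by (simp add: of_nat_eq_0_iff_char_dvd)
  moreover have "CHAR('k) \<noteq> 1" by simp
  ultimately have "CHAR('k) = p" using assms(2) by (metis prime_nat_iff)
  moreover have "p \<noteq> 0" using assms(2) by auto
  ultimately show ?thesis using assms(1) unfolding perfect_field_def by (metis surjD)
qed

text \<open>Squaring is additive when \<open>2 = 0\<close>, hence injective on the closure, so
  \<open>x\<close> equals the square root that exists in \<open>k\<close>.\<close>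

lemma perfect_root_2:
  fixes x :: "'k::field alg_closure"
  assumes "perfect_field TYPE('k)" "(2 :: 'k) = 0" "x^2 = to_ac c"
  shows "x \<in> range to_ac"
proof -
  obtain y :: 'k where y: "y^2 = c" using perfect_field_CHAR[OF assms(1), of 2 c] assms(2) by auto
  have 2: "(2 :: 'k alg_closure) = 0" using assms(2) by (metis to_ac_0 to_ac_numeral)
  have "(x - to_ac y)^2 = x^2 + (to_ac y)^2 - 2 * (x * to_ac y)" by (simp add: power2_eq_square algebra_simps)
  also have "\<dots> = 2 * to_ac c" using assms(3) y 2 by (simp flip: to_ac_power)
  finally show ?thesis using 2 by simp
qed

lemma perfect_root_3:
  fixes x :: "'k::field alg_closure"
  assumes "perfect_field TYPE('k)" "(3 :: 'k) = 0" "x^3 = to_ac c"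
  shows "x \<in> range to_ac"
proof -
  obtain y :: 'k where y: "y^3 = c" using perfect_field_CHAR[OF assms(1), of 3 c] assms(2) by auto
  have 3: "(3 :: 'k alg_closure) = 0" using assms(2) by (metis to_ac_0 to_ac_numeral)
  have cube: "(x - z)^3 = x^3 - z^3 + 3 * (x * z^2 - x^2 * z)" for z
    by (simp add: power2_eq_square power3_eq_cube algebra_simps)
  have "(to_ac y)^3 = to_ac c" using y by (simp flip: to_ac_power)
  then have "(x - to_ac y)^3 = 0" unfolding cube assms(3) 3 by simp
  then show ?thesis by simp
qed

lemma range_to_ac_closed:
  "x \<in> range to_ac \<Longrightarrow> y \<in> range to_ac \<Longrightarrow> x + y \<in> range to_ac"
  "x \<in> range to_ac \<Longrightarrow> y \<in> range to_ac \<Longrightarrow> x - y \<in> range to_ac"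
  "x \<in> range to_ac \<Longrightarrow> y \<in> range to_ac \<Longrightarrow> x * y \<in> range to_ac"
  "x \<in> range to_ac \<Longrightarrow> y \<in> range to_ac \<Longrightarrow> x / y \<in> range to_ac"
  "x \<in> range to_ac \<Longrightarrow> x ^ n \<in> range to_ac"
  "- x \<in> range to_ac \<longleftrightarrow> x \<in> range to_ac"
  "numeral m \<in> range to_ac" "0 \<in> range to_ac" "1 \<in> range to_ac"
proof -
  have m: "- x \<in> range to_ac" if "x \<in> range to_ac" for x :: "'a alg_closure"
    using that by (auto simp flip: to_ac_minus)
  show "- x \<in> range to_ac \<longleftrightarrow> x \<in> range to_ac" using m[of x] m[of "- x"] by auto
  show "numeral m \<in> range to_ac" "0 \<in> range to_ac" "1 \<in> range to_ac"
    by (metis rangeI to_ac_numeral, metis rangeI to_ac_0, metis rangeI to_ac_1)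
qed (auto simp flip: to_ac_add to_ac_diff to_ac_mult to_ac_divide to_ac_power)

text \<open>The double root of the monic cubic \<open>(x + \<alpha>)\<^sup>2 (x + \<mu>)\<close> over a perfect field is rational: it is a rational
  function of the coefficients unless the characteristic is 2 or 3, where it can be a square or cube root.\<close>
lemma double_root_rational:
  fixes \<alpha> \<mu> :: "'k::field alg_closure"
  assumes perf: "perfect_field TYPE('k)"
    and e: "2 * \<alpha> + \<mu> \<in> range to_ac" "\<alpha>^2 + 2 * \<alpha> * \<mu> \<in> range to_ac" "\<alpha>^2 * \<mu> \<in> range to_ac"
  shows "\<alpha> \<in> range to_ac"
proof -
  let ?e1 = "2 * \<alpha> + \<mu>" and ?e2 = "\<alpha>^2 + 2 * \<alpha> * \<mu>" and ?e3 = "\<alpha>^2 * \<mu>"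
  have two: "(2 :: 'k alg_closure) = 0 \<longleftrightarrow> (2 :: 'k) = 0" and three: "(3 :: 'k alg_closure) = 0 \<longleftrightarrow> (3 :: 'k) = 0"
    using to_ac_eq_0_iff[of "2 :: 'k"] to_ac_eq_0_iff[of "3 :: 'k"] by simp_all
  show ?thesis
  proof (cases "\<alpha> = \<mu>")
    case True
    have e1: "?e1 = 3 * \<alpha>" and e3: "?e3 = \<alpha>^3" using True by (simp_all add: power2_eq_square power3_eq_cube)
    show ?thesis
    proof (cases "(3 :: 'k) = 0")
      case True
      then show ?thesis using perfect_root_3[OF perf] e(3) unfolding e3 by auto
    next
      case False
      then have a: "\<alpha> = ?e1 / 3" unfolding e1 using three by simp
      have "?e1 / 3 \<in> range to_ac" by (intro range_to_ac_closed e)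
      then show ?thesis unfolding a[symmetric] .
    qed
  next
    case False
    show ?thesis
    proof (cases "(2 :: 'k) = 0")
      case True
      then have "(2 :: 'k alg_closure) = 0" using two by simp
      then have "?e2 = \<alpha>^2" by simp
      then show ?thesis using perfect_root_2[OF perf True] e(2) by auto
    next
      case 2: False
      then have "(2 :: 'k alg_closure) \<noteq> 0" using two by simp
      \<comment> \<open>The root of the remainder of the cubic modulo its derivative, with the
        denominators of the division cleared.\<close>
      moreover have "?e1^2 - 3 * ?e2 = (\<alpha> - \<mu>)^2" "?e1 * ?e2 - 9 * ?e3 = 2 * \<alpha> * (\<alpha> - \<mu>)^2"
        by (simp_all add: power2_eq_square algebra_simps)
      ultimately have a: "\<alpha> = (?e1 * ?e2 - 9 * ?e3) / (2 * (?e1^2 - 3 * ?e2))" using False by simp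
      have "(?e1 * ?e2 - 9 * ?e3) / (2 * (?e1^2 - 3 * ?e2)) \<in> range to_ac"
        by (intro range_to_ac_closed e)
      then show ?thesis using a by simp
    qed
  qed
qed

text \<open>If \<open>p = 0\<close>, the double root is at \<open>A\<close> already. Otherwise it is
  given by \<open>\<alpha> = q / p\<close>, which is shown to be rational. The case
  \<open>r' = 0\<close> is separate because the cubic then has no leading coefficient to divide
  by.\<close>

lemma rational_double_root:
  fixes A B :: "'k::field^3^3"
  assumes perf: "perfect_field TYPE('k)"
    and D: "disc (cubic_coeff 0 A B) (cubic_coeff 1 A B) (cubic_coeff 2 A B) (cubic_coeff 3 A B) = 0"
  shows "\<exists>p q r s. p * s - q * r \<noteq> 0 \<and> double_root_at_A (lcomb p A q B) (lcomb r A s B)"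
proof -
  let ?c = "\<lambda>k. to_ac (cubic_coeff k A B)"
  have "disc (?c 0) (?c 1) (?c 2) (?c 3) = to_ac 0" unfolding D[symmetric] by (simp add: disc_def)
  then obtain p q r u where c: "?c 0 = p^2 * r" "?c 1 = 2 * p * q * r + p^2 * u" "?c 2 = q^2 * r + 2 * p * q * u" "?c 3 = q^2 * u"
    using cubic_zero_disc_double_root[of "?c 0" "?c 1" "?c 2" "?c 3"] by auto
  have det: "det (lcomb s (lift_mat A) t (lift_mat B)) = (p * s + q * t)^2 * (r * s + u * t)" for s t
    unfolding det_lcomb lift_mat_cubic_coeff c by (simp add: power2_eq_square power3_eq_cube algebra_simps)
  show ?thesis
  proof (cases "p = 0")
    case True
    have "double_root_at_A (lcomb 1 A 0 B) (lcomb 0 A 1 B)"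
      unfolding double_root_at_A_def lift_mat_lcomb lcomb_lcomb det
      by - (rule ex2I[of _ "q^2 * r" "q^2 * u"], (simp add: True algebra_simps power2_eq_square))
    then show ?thesis by - (rule ex4I[of _ 1 0 0 1], simp)
  next
    case False
    define \<alpha> r' u' where "\<alpha> = q / p" and "r' = p^2 * r" and "u' = p^2 * u"
    have q: "q = \<alpha> * p" using False by (simp add: \<alpha>_def)
    have det': "det (lcomb s (lift_mat A) t (lift_mat B)) = (s + \<alpha> * t)^2 * (r' * s + u' * t)" for s t
      unfolding det q r'_def u'_def by (simp add: power2_eq_square algebra_simps)
    have c': "?c 0 = r'" "?c 1 = 2 * \<alpha> * r' + u'" "?c 2 = \<alpha>^2 * r' + 2 * \<alpha> * u'" "?c 3 = \<alpha>^2 * u'"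
      unfolding c q r'_def u'_def by (simp_all add: power2_eq_square algebra_simps)
    \<comment> \<open>For the zero form every point is a double root and \<open>\<alpha>\<close> may
      be irrational, hence the alternative.\<close>
    have "\<exists>a. \<alpha> = to_ac a \<or> (r' = 0 \<and> u' = 0)"
    proof (cases "r' = 0")
      case r: True
      show ?thesis
      proof (cases "u' = 0")
        case False
        have cc: "?c 1 = u'" "?c 2 = 2 * \<alpha> * u'" "?c 3 = \<alpha>^2 * u'" using c' r by simp_all
        have "\<alpha> \<in> range to_ac"
        proof (cases "(2 :: 'k) = 0")
          case True
          have "\<alpha>^2 = ?c 3 / ?c 1" unfolding cc using False by simp
          then have "\<alpha>^2 = to_ac (cubic_coeff 3 A B / cubic_coeff 1 A B)" by simp
          then show ?thesis by (rule perfect_root_2[OF perf True])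
        next
          case 2: False
          then have "(2 :: 'k alg_closure) \<noteq> 0" using to_ac_eq_0_iff[of "2 :: 'k"] by simp
          then have "\<alpha> = ?c 2 / (2 * ?c 1)" unfolding cc using False by simp
          moreover have "?c 2 / (2 * ?c 1) \<in> range to_ac" by (intro range_to_ac_closed rangeI)
          ultimately show ?thesis by simp
        qed
        then show ?thesis by auto
      qed (use r in simp)
    next
      case False
      define \<mu> where "\<mu> = u' / r'"
      have u': "u' = \<mu> * r'" using False by (simp add: \<mu>_def)
      have "2 * \<alpha> + \<mu> = ?c 1 / ?c 0" "\<alpha>^2 + 2 * \<alpha> * \<mu> = ?c 2 / ?c 0" "\<alpha>^2 * \<mu> = ?c 3 / ?c 0"
        unfolding c' u' using False by (simp_all add: field_simps)
      then have "\<alpha> \<in> range to_ac"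
        by (intro double_root_rational[OF perf, of \<alpha> \<mu>]) (simp_all only:, (intro range_to_ac_closed rangeI)+)
      then show ?thesis by auto
    qed
    then obtain a where a: "\<alpha> = to_ac a \<or> (r' = 0 \<and> u' = 0)" ..
    \<comment> \<open>Replacing \<open>(A, B)\<close> by \<open>(B - a A, A)\<close> substitutes
      \<open>t - a s\<close> for \<open>s\<close> and \<open>s\<close> for \<open>t\<close>, so the
      factor \<open>s + \<alpha> t\<close> becomes \<open>t\<close>.\<close>
    have "double_root_at_A (lcomb (- a) A 1 B) (lcomb 1 A 0 B)"
      unfolding double_root_at_A_def lift_mat_lcomb lcomb_lcomb det'
      by - (rule ex2I[of _ "u' - r' * to_ac a" r'], (use a in \<open>auto simp: algebra_simps\<close>))
    then show ?thesis by - (rule ex4I[of _ "- a" 1 1 0], simp)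
  qed
qed

lemma perfect_double_root_quadratic:
  fixes t n :: "'k::field"
  assumes perf: "perfect_field TYPE('k)" and "t^2 = 4 * n"
  shows "\<exists>u. t = 2 * u \<and> n = u^2"
proof (cases "(2 :: 'k) = 0")
  case True
  obtain y :: 'k where y: "y^2 = n" using perfect_field_CHAR[OF perf, of 2 n] True by auto
  have "(4 :: 'k) = 2 * 2" by simp
  then have "t = 0" using assms(2) True by simp
  then show ?thesis using y True by auto
next
  case False
  then have "(4 :: 'k) \<noteq> 0" by (metis mult_2 mult_eq_0_iff numeral_Bit0 numeral_times_numeral semiring_norm(12) semiring_norm(13))
  then show ?thesis using False assms(2) by (intro exI[of _ "t / 2"]) (simp add: power_divide)
qed

text \<open>After the double root is moved to the first matrix, the rank of that matrix decides.
  Rank three contradicts its determinant being 0, and rank two uses the vanishing of the next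
  coefficient as well.\<close>

lemma tdisc_zero_classified:
  fixes x :: "'k::field tensor"
  assumes perf: "perfect_field TYPE('k)" and D: "tdisc x = 0"
  shows "classified x"
proof -
  obtain p q r s where ps: "p * s - q * r \<noteq> 0" and dr: "double_root_at_A (lcomb p (slice 1 x) q (slice 2 x)) (lcomb r (slice 1 x) s (slice 2 x))"
    using rational_double_root[OF perf] D unfolding tdisc_def Let_def by blast
  define A0 B0 where AB: "A0 = lcomb p (slice 1 x) q (slice 2 x)" "B0 = lcomb r (slice 1 x) s (slice 2 x)"
  have e0: "eqv x (pencil A0 B0)"
    using eqvI[of "mat 1" "mat 1" p s q r "slice 1 x" "slice 2 x" A0 B0] ps by (simp add: AB pencil_slices)
  have red: "\<exists>B. eqv x (pencil A B) \<and> double_root_at_A A B" if "mat_equiv A0 A" for A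
  proof -
    obtain P Q where "det P \<noteq> 0" "det Q \<noteq> 0" "P ** A0 ** Q = A" using \<open>mat_equiv A0 A\<close> unfolding mat_equiv_def by blast
    then show ?thesis
      using eqv_trans[OF e0 pencil_equiv_PQ[of P Q A0 B0]] double_root_at_A_PQ[of A0 B0 P Q] dr AB by blast
  qed
  consider "mat_equiv A0 (M3 0 0 0 0 0 0 0 0 0)" | "mat_equiv A0 (M3 1 0 0 0 0 0 0 0 0)" |
    "mat_equiv A0 (M3 0 0 0 0 1 0 0 0 1)" | "mat_equiv A0 (M3 1 0 0 0 1 0 0 0 1)" using rank_normal_form by blast
  then show ?thesis
  proof cases
    case 1
    obtain B where B: "eqv x (pencil (M3 0 0 0 0 0 0 0 0 0) B)" using red[OF 1] by blast
    have z: "P ** M3 0 0 0 0 0 0 0 0 0 ** Q = M3 0 0 0 0 0 0 0 0 0" for P Q :: "'k^3^3"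
      by (simp add: vec_eq_iff matrix_matrix_mult_def forall_3 sum_3)
    have e: "eqv x (pencil (M3 0 0 0 0 0 0 0 0 0) B')" if "mat_equiv B B'" for B'
    proof -
      obtain P Q where "det P \<noteq> 0" "det Q \<noteq> 0" "P ** B ** Q = B'" using \<open>mat_equiv B B'\<close> unfolding mat_equiv_def by blast
      then show ?thesis using eqv_trans[OF B pencil_equiv_PQ[of P Q _ B]] z by metis
    qed
    have "pencil (M3 0 0 0 0 0 0 0 0 0) (M3 0 0 0 0 0 0 0 0 0) = (0 :: 'k tensor)"
      by (simp add: vec_eq_iff split_paired_All forall_3 pencil_def)
    then have "classified (pencil (M3 0 0 0 0 0 0 0 0 0) (M3 0 0 0 0 0 0 0 0 0) :: 'k tensor)"
      by (simp add: classified_def)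
    moreover have "classified (pencil (M3 0 0 0 0 0 0 0 0 0) (M3 1 0 0 0 0 0 0 0 0) :: 'k tensor)"
    proof -
      have "eqv (pencil (M3 0 0 0 0 0 0 0 0 0) (M3 1 0 0 0 0 0 0 0 0)) (tens {(3,3,2)} :: 'k tensor)"
        unfolding tens_pencil
        by (rule eqvI[where P = "M3 0 0 1 0 1 0 1 0 0" and Q = "M3 0 0 1 0 1 0 1 0 0" and p = 1 and q = 0 and r = 0 and s = 1]) simp_all
      then show ?thesis by (rule classified_tens[rotated]) (simp add: rep_supports_def)
    qed
    moreover have "classified (pencil (M3 0 0 0 0 0 0 0 0 0) (M3 0 0 0 0 1 0 0 0 1) :: 'k tensor)"
      by (rule classified_tens[of "{(2,2,2), (3,3,2)}"]) (simp add: rep_supports_def, simp add: tens_pencil eqv_refl)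
    moreover have "classified (pencil (M3 0 0 0 0 0 0 0 0 0) (M3 1 0 0 0 1 0 0 0 1) :: 'k tensor)"
      by (rule classified_tens[of "{(1,1,2), (2,2,2), (3,3,2)}"]) (simp add: rep_supports_def, simp add: tens_pencil eqv_refl)
    ultimately show ?thesis using rank_normal_form[of B] e classified_eqv by blast
  next
    case 2
    obtain B where B: "eqv x (pencil (M3 1 0 0 0 0 0 0 0 0) B)" using red[OF 2] by blast
    obtain a b c d e f g h i where M: "B = M3 a b c d e f g h i" by (rule M3_cases)
    obtain p q r s p' q' r' s' u v where R: "p * s - q * r \<noteq> 0" "p' * s' - q' * r' \<noteq> 0"
      "(u = 0 \<and> v = 0) \<or> (u = 1 \<and> v = 0) \<or> (u = 1 \<and> v = 1)" and
      E: "p * (e * p' + f * r') + q * (h * p' + i * r') = u" "p * (e * q' + f * s') + q * (h * q' + i * s') = 0"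
      "r * (e * p' + f * r') + s * (h * p' + i * r') = 0" "r * (e * q' + f * s') + s * (h * q' + i * s') = v"
      using rank_normal_form_2[of e f h i] by blast
    have m: "(p * x + q * y) * z + (p * x' + q * y') * z' = p * (x * z + x' * z') + q * (y * z + y' * z')" for p q x y z x' y' z' :: 'k
      by (simp add: algebra_simps)
    have "eqv (pencil (M3 1 0 0 0 0 0 0 0 0) B) (pencil (M3 1 0 0 0 0 0 0 0 0)
        (M3 a (b * p' + c * r') (b * q' + c * s') (p * d + q * g) u 0 (r * d + s * g) 0 v))"
      unfolding M
      by (rule eqvI[where P = "M3 1 0 0 0 p q 0 r s" and Q = "M3 1 0 0 0 p' q' 0 r' s'" and p = 1 and q = 0 and r = 0 and s = 1])
         (use R(1,2) in \<open>simp_all add: m E\<close>)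
    then show ?thesis using classify_rank_1[OF R(3)] B classified_eqv eqv_trans by blast
  next
    case 3
    obtain B where B: "eqv x (pencil (M3 0 0 0 0 1 0 0 0 1) B)" "double_root_at_A (M3 0 0 0 0 1 0 0 0 1) B" using red[OF 3] by blast
    obtain a b c d e f g h i where M: "B = M3 a b c d e f g h i" by (rule M3_cases)
    \<comment> \<open>The coefficient of \<open>s^2 t\<close> is the corner entry of
      \<open>B\<close>, which therefore vanishes.\<close>
    have "cubic_coeff 1 (M3 0 0 0 0 1 0 0 0 1) B = a" by (simp add: cubic_coeff_def det_3 M)
    then have "a = 0" using double_root_at_A_coeffs(2)[OF B(2)] by simp
    then show ?thesis using classified_eqv[OF B(1)] classify_rank_2[OF perfect_double_root_quadratic[OF perf]] M by blast
  next
    case 4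
    obtain B :: "'k^3^3" where "double_root_at_A (M3 1 0 0 0 1 0 0 0 1) B" using red[OF 4] by blast
    then show ?thesis using double_root_at_A_coeffs(1) by fastforce
  qed
qed

text \<open>Allows the same classification to be used over the closure when the non-empty strata are
  counted.\<close>

lemma alg_closed_perfect: "perfect_field TYPE('a::alg_closed_field)"
proof (cases "CHAR('a) = 0")
  case False
  then have "\<exists>x. x ^ CHAR('a) = y" for y :: 'a using nth_root_exists[of "CHAR('a)" y] by auto
  then show ?thesis unfolding perfect_field_def surj_def by metis
qed (simp add: perfect_field_def)

section \<open>Extensions of degree at most two\<close>

definition simple_ext :: "'k::field alg_closure \<Rightarrow> 'k alg_closure set" where
  "simple_ext \<alpha> = {to_ac a + to_ac b * \<alpha> | a b. True}"

text \<open>The polynomial may be reducible; a rational root yields the trivial extension.\<close>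

definition quad_root :: "'k::field \<Rightarrow> 'k \<Rightarrow> 'k alg_closure \<Rightarrow> bool" where
  "quad_root t n \<alpha> \<longleftrightarrow> \<alpha>^2 = to_ac t * \<alpha> - to_ac n"

lemma simple_extI: "to_ac a + to_ac b * \<alpha> \<in> simple_ext \<alpha>"
  unfolding simple_ext_def by blast

lemma simple_ext_rational: "\<alpha> \<in> range to_ac \<Longrightarrow> simple_ext \<alpha> = range to_ac"
proof -
  assume "\<alpha> \<in> range to_ac"
  then obtain c where c: "\<alpha> = to_ac c" by auto
  have e: "to_ac a + to_ac b * \<alpha> = to_ac (a + b * c)" for a b by (simp add: c)
  have "simple_ext \<alpha> \<subseteq> range to_ac" unfolding simple_ext_def e by blast
  moreover have "to_ac a \<in> simple_ext \<alpha>" for a using simple_extI[of a 0 \<alpha>] by simp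
  ultimately show ?thesis by blast
qed

lemma quad_root_cases:
  assumes "quad_root t n \<alpha>" "quad_root t n \<gamma>"
  shows "\<gamma> = \<alpha> \<or> \<gamma> = to_ac t - \<alpha>"
proof -
  have "(\<gamma> - \<alpha>) * (\<gamma> - (to_ac t - \<alpha>)) = (\<gamma>^2 - to_ac t * \<gamma>) - (\<alpha>^2 - to_ac t * \<alpha>)"
    by (simp add: power2_eq_square algebra_simps)
  also have "\<dots> = 0" using assms by (simp add: quad_root_def)
  finally show ?thesis by auto
qed

text \<open>\<open>2 \<alpha> - t\<close> is the difference of the two roots, so the discriminant
  detects a double root in every characteristic.\<close>

lemma quad_root_disc: "quad_root t n \<alpha> \<Longrightarrow> (2 * \<alpha> - to_ac t)^2 = to_ac (t^2 - 4 * n)"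
proof -
  assume h: "quad_root t n \<alpha>"
  have "(2 * \<alpha> - to_ac t)^2 = 4 * \<alpha>^2 - 4 * (to_ac t * \<alpha>) + to_ac t ^ 2"
    by (simp add: power2_eq_square algebra_simps)
  also have "\<dots> = to_ac (t^2 - 4 * n)" unfolding h[unfolded quad_root_def] by (simp add: algebra_simps)
  finally show ?thesis .
qed

lemma quad_root_exists: "\<exists>\<alpha>. quad_root t n \<alpha>"
proof -
  have "Polynomial.degree [:to_ac n, - to_ac t, 1:] > 0" by simp
  then obtain x where "poly [:to_ac n, - to_ac t, 1:] x = 0" using alg_closed_imp_poly_has_root by blast
  then show ?thesis by (intro exI[of _ x]) (simp add: quad_root_def power2_eq_square algebra_simps eq_neg_iff_add_eq_0)
qed

text \<open>The new coefficients are the trace and the norm of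
  \<open>a + b \<alpha>\<close>.\<close>

lemma quad_root_affine:
  assumes "quad_root t n \<alpha>"
  shows "quad_root (2 * a + b * t) (a^2 + a * b * t + b^2 * n) (to_ac a + to_ac b * \<alpha>)"
proof -
  have e: "(u + v * x)^2 = (2 * u + v * s) * (u + v * x) - (u^2 + u * v * s + v^2 * m) + v^2 * (x^2 - (s * x - m))"
    for u v x s m :: "'a alg_closure"
    by (simp add: power2_eq_square ring_distribs)
  show ?thesis using e[of "to_ac a" "to_ac b" \<alpha> "to_ac t" "to_ac n"] assms
    by (simp only: quad_root_def) simp
qed

lemma simple_ext_coords:
  assumes "\<alpha> \<notin> range to_ac" "to_ac a + to_ac b * \<alpha> = to_ac c + to_ac d * \<alpha>"
  shows "a = c \<and> b = d"
proof (cases "b = d")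
  case False
  have "to_ac (b - d) * \<alpha> = to_ac (c - a)" using assms(2) by (simp add: algebra_simps)
  then have "\<alpha> = to_ac ((c - a) / (b - d))" using False by (simp add: field_simps)
  then show ?thesis using assms(1) by blast
next
  case True
  then show ?thesis using assms(2) by simp
qed

lemma quad_root_unique:
  assumes "\<alpha> \<notin> range to_ac" "quad_root t n \<alpha>" "quad_root t' n' \<alpha>"
  shows "t = t' \<and> n = n'"
  using simple_ext_coords[OF assms(1), of "- n" t "- n'" t'] assms(2,3) by (simp add: quad_root_def)

lemma intermediate_field_simple_ext:
  assumes q: "quad_root t n \<alpha>"
  shows "intermediate_field (simple_ext \<alpha>)"
proof (cases "\<alpha> \<in> range to_ac")
  case True
  have "inverse (to_ac x) \<in> range to_ac" for x :: 'a by (simp flip: to_ac_inverse)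
  then show ?thesis unfolding simple_ext_rational[OF True] intermediate_field_def
    by (auto intro: range_to_ac_closed)
next
  case False
  have mult: "(to_ac a + to_ac b * \<alpha>) * (to_ac c + to_ac d * \<alpha>) = to_ac (a * c - b * d * n) + to_ac (a * d + b * c + b * d * t) * \<alpha>" for a b c d
  proof -
    have e: "(u + v * x) * (w + z * x) = (u * w - v * z * m) + (u * z + v * w + v * z * s) * x + v * z * (x^2 - (s * x - m))"
      for u v w x z s m :: "'a alg_closure"
      by (simp add: power2_eq_square ring_distribs)
    show ?thesis using e[of "to_ac a" "to_ac b" \<alpha> "to_ac c" "to_ac d" "to_ac n" "to_ac t"] q
      by (simp only: quad_root_def) simp
  qed
  have inv: "inverse (to_ac a + to_ac b * \<alpha>) \<in> simple_ext \<alpha>" for a b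
  proof (cases "a = 0 \<and> b = 0")
    case True
    then show ?thesis using simple_extI[of 0 0 \<alpha>] by simp
  next
    case ab: False
    \<comment> \<open>The norm of \<open>a + b \<alpha>\<close>, in the shape that
      \<open>mult\<close> produces for the product with the conjugate.\<close>
    define N where "N = a * (a + b * t) - b * (- b) * n"
    have e: "(to_ac a + to_ac b * \<alpha>) * (to_ac (a + b * t) + to_ac (- b) * \<alpha>) = to_ac N"
    proof -
      have "a * (- b) + b * (a + b * t) + b * (- b) * t = 0" by (simp add: algebra_simps)
      then show ?thesis unfolding mult N_def by simp
    qed
    have nz: "to_ac a + to_ac b * \<alpha> \<noteq> 0" "to_ac (a + b * t) + to_ac (- b) * \<alpha> \<noteq> 0"
      using simple_ext_coords[OF False, of a b 0 0] simple_ext_coords[OF False, of "a + b * t" "- b" 0 0] ab by auto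
    then have N: "to_ac N \<noteq> 0" using e by (metis mult_eq_0_iff)
    have ie: "inverse x = (u + v * w) / m \<Longrightarrow> inverse x = u / m + v / m * w" for x u v w m :: "'a alg_closure"
      by (simp add: add_divide_distrib)
    have i: "x * y = m \<Longrightarrow> m \<noteq> 0 \<Longrightarrow> inverse x = y / m" for x y m :: "'a alg_closure"
      by (auto simp: divide_inverse)
    have "inverse (to_ac a + to_ac b * \<alpha>) = to_ac (a + b * t) / to_ac N + to_ac (- b) / to_ac N * \<alpha>"
      by (rule ie[OF i[OF e N]])
    also have "\<dots> = to_ac ((a + b * t) / N) + to_ac (- b / N) * \<alpha>" by (simp only: to_ac_divide)
    finally show ?thesis using simple_extI by metis
  qed
  show ?thesis unfolding intermediate_field_def
  proof (intro conjI ballI)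
    show "range to_ac \<subseteq> simple_ext \<alpha>" using simple_extI[of _ 0 \<alpha>] by auto
    fix x assume "x \<in> simple_ext \<alpha>"
    then obtain a b where x: "x = to_ac a + to_ac b * \<alpha>" unfolding simple_ext_def by blast
    show "inverse x \<in> simple_ext \<alpha>" unfolding x by (rule inv)
    fix y assume "y \<in> simple_ext \<alpha>"
    then obtain c d where y: "y = to_ac c + to_ac d * \<alpha>" unfolding simple_ext_def by blast
    have "x + y = to_ac (a + c) + to_ac (b + d) * \<alpha>" "x - y = to_ac (a - c) + to_ac (b - d) * \<alpha>"
      by (simp_all add: x y algebra_simps)
    then show "x + y \<in> simple_ext \<alpha>" "x - y \<in> simple_ext \<alpha>" using simple_extI by metis+
    show "x * y \<in> simple_ext \<alpha>" unfolding x y mult by (rule simple_extI)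
  qed
qed

lemma simple_ext_eq_span: "simple_ext \<alpha> = ext.span {1, \<alpha>}"
proof
  show "simple_ext \<alpha> \<subseteq> ext.span {1, \<alpha>}"
  proof
    fix x assume "x \<in> simple_ext \<alpha>"
    then obtain a b where x: "x = to_ac a * 1 + to_ac b * \<alpha>" unfolding simple_ext_def by auto
    show "x \<in> ext.span {1, \<alpha>}" unfolding x by (intro ext.span_add ext.span_scale ext.span_base) auto
  qed
  show "ext.span {1, \<alpha>} \<subseteq> simple_ext \<alpha>"
  proof (rule ext.span_minimal)
    show "{1, \<alpha>} \<subseteq> simple_ext \<alpha>" using simple_extI[of 1 0 \<alpha>] simple_extI[of 0 1 \<alpha>] by simp
    show "ext.subspace (simple_ext \<alpha>)"
    proof (rule ext.subspaceI)
      show "0 \<in> simple_ext \<alpha>" using simple_extI[of 0 0 \<alpha>] by simp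
      fix x y c assume "x \<in> simple_ext \<alpha>"
      then obtain a b where x: "x = to_ac a + to_ac b * \<alpha>" unfolding simple_ext_def by blast
      have "to_ac c * x = to_ac (c * a) + to_ac (c * b) * \<alpha>" by (simp add: x algebra_simps)
      then show "to_ac c * x \<in> simple_ext \<alpha>" using simple_extI by metis
      assume "y \<in> simple_ext \<alpha>"
      then obtain a' b' where y: "y = to_ac a' + to_ac b' * \<alpha>" unfolding simple_ext_def by blast
      have "x + y = to_ac (a + a') + to_ac (b + b') * \<alpha>" by (simp add: x y algebra_simps)
      then show "x + y \<in> simple_ext \<alpha>" using simple_extI by metis
    qed
  qed
qed

lemma independent_1: "ext.independent {1 :: 'k::field alg_closure}"
  by (simp add: ext.independent_insert)

lemma span_1: "ext.span {1 :: 'k::field alg_closure} = range to_ac"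
  using simple_ext_eq_span[of "1 :: 'k alg_closure"] simple_ext_rational[of "1 :: 'k alg_closure"]
  by (simp add: range_to_ac_closed)

lemma independent_1_alpha: "\<alpha> \<notin> range to_ac \<Longrightarrow> ext.independent {1, \<alpha>}"
  using ext.independent_insert[of \<alpha> "{1}"] independent_1 span_1 by (auto simp: insert_commute)

lemma dim_simple_ext: "ext.dim (simple_ext \<alpha>) \<in> {1, 2}"
proof (cases "\<alpha> \<in> range to_ac")
  case True
  then have "ext.dim (simple_ext \<alpha>) = 1"
    unfolding simple_ext_rational[OF True] span_1[symmetric] ext.dim_span_eq_card_independent[OF independent_1] by simp
  then show ?thesis by simp
next
  case False
  then have "\<alpha> \<noteq> 1" using range_to_ac_closed(9) by metis
  then have "ext.dim (simple_ext \<alpha>) = 2"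
    unfolding simple_ext_eq_span ext.dim_span_eq_card_independent[OF independent_1_alpha[OF False]] by auto
  then show ?thesis by simp
qed

section \<open>Separability of quadratic elements\<close>

lemma order_linear: "Polynomial.order a [:- b, 1 :: 'a::Fields.field:] = (if a = b then 1 else 0)"
  using order_power_n_n[of a 1] by (auto simp: order_0I)

lemma degree_1_cases:
  fixes p :: "'a::Fields.field poly"
  assumes "Polynomial.degree p \<le> 1"
  obtains c d where "p = [:c, d:]"
proof -
  obtain c q where p: "p = pCons c q" by (cases p)
  have "Polynomial.degree q = 0" using assms by (cases "q = 0") (auto simp: p degree_pCons_eq)
  then obtain d where "q = [:d:]" by (rule degree_eq_zeroE)
  then show ?thesis using that p by simp
qed

lemma rsquarefree_two_linear:
  fixes x y :: "'a::Fields.field"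
  assumes "x \<noteq> y"
  shows "rsquarefree ([:- x, 1:] * [:- y, 1:])"
proof -
  show ?thesis unfolding rsquarefree_def
    using assms by (auto simp: order_mult order_linear simp del: mult_pCons_left mult_pCons_right)
qed

lemma map_poly_quad: "map_poly to_ac [:n, - t, 1:] = [:to_ac n, - to_ac t, 1:]"
  by (simp add: map_poly_pCons)

lemma quad_factor:
  "quad_root t n \<alpha> \<Longrightarrow> [:to_ac n, - to_ac t, 1:] = [:- \<alpha>, 1:] * [:- (to_ac t - \<alpha>), 1:]"
  by (simp add: quad_root_def power2_eq_square algebra_simps)

lemma irreducible_quad:
  fixes t n :: "'k::field"
  assumes q: "quad_root t n \<alpha>" and irr: "\<alpha> \<notin> range to_ac"
  shows "Factorial_Ring.irreducible [:n, - t, 1:]"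
proof (rule Factorial_Ring.irreducibleI)
  show "[:n, - t, 1:] \<noteq> 0" by simp
  show "\<not> [:n, - t, 1:] dvd 1" by (auto simp: is_unit_poly_iff)
next
  fix a b assume ab: "[:n, - t, 1:] = a * b"
  show "a dvd 1 \<or> b dvd 1"
  proof (rule ccontr)
    assume nu: "\<not> ?thesis"
    have nz: "a \<noteq> 0" "b \<noteq> 0" using ab by auto
    have "Polynomial.degree a + Polynomial.degree b = 2"
      using degree_mult_eq[OF nz] ab by (metis degree_pCons_eq_if one_neq_zero pCons_eq_0_iff numeral_2_eq_2 degree_0 pCons_0_0)
    moreover have "Polynomial.degree a \<noteq> 0" "Polynomial.degree b \<noteq> 0"
      using nu nz by (auto simp: is_unit_iff_degree)
    ultimately have deg: "Polynomial.degree a = 1" by simp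
    then obtain c d where a: "a = [:c, d:]" using degree_1_cases[of a] by auto
    have "d \<noteq> 0" using deg a by auto
    let ?r = "- c / d"
    have "poly a ?r = 0" using \<open>d \<noteq> 0\<close> by (simp add: a)
    then have "poly [:n, - t, 1:] ?r = 0" unfolding ab by simp
    then have "?r^2 = t * ?r - n" by (simp add: power2_eq_square algebra_simps eq_neg_iff_add_eq_0)
    then have "quad_root t n (to_ac ?r)" unfolding quad_root_def
      by (metis to_ac_diff to_ac_mult to_ac_power)
    then have "to_ac ?r = \<alpha> \<or> to_ac ?r = to_ac t - \<alpha>" using quad_root_cases[OF q] by blast
    then have "\<alpha> = to_ac ?r \<or> \<alpha> = to_ac (t - ?r)" by (metis diff_diff_eq2 add_diff_cancel_left' diff_add_cancel to_ac_diff)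
    then show False using irr by blast
  qed
qed

text \<open>An irrational element \<open>a + b \<alpha>\<close> has an irreducible quadratic
  polynomial with discriminant \<open>b^2 (t^2 - 4 n)\<close>.\<close>

lemma separable_simple_ext:
  fixes t n :: "'k::field"
  assumes q: "quad_root t n \<alpha>" and d: "t^2 - 4 * n \<noteq> 0" and x: "x \<in> simple_ext \<alpha>"
  shows "separable_element x"
proof (cases "x \<in> range to_ac")
  case True
  then obtain c where c: "x = to_ac c" by auto
  have "Factorial_Ring.irreducible [:- c, 1:]" by (rule irreducible_linear_field_poly) simp
  moreover have m: "map_poly to_ac [:- c, 1:] = [:- x, 1:]" by (simp add: map_poly_pCons c)
  moreover have "rsquarefree [:- x, 1:]"
    unfolding rsquarefree_def by (simp add: order_linear)
  ultimately show ?thesis unfolding separable_element_def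
    by (intro exI[of _ "[:- c, 1:]"]) simp
next
  case False
  obtain a b where ab: "x = to_ac a + to_ac b * \<alpha>" using x unfolding simple_ext_def by blast
  have b: "b \<noteq> 0" using False ab by auto
  let ?t = "2 * a + b * t" and ?n = "a^2 + a * b * t + b^2 * n"
  have qx: "quad_root ?t ?n x" unfolding ab by (rule quad_root_affine[OF q])
  have "?t^2 - 4 * ?n = b^2 * (t^2 - 4 * n)" by (simp add: power2_eq_square algebra_simps)
  then have "?t^2 - 4 * ?n \<noteq> 0" using d b by simp
  then have "(2 * x - to_ac ?t)^2 \<noteq> 0" unfolding quad_root_disc[OF qx] to_ac_eq_0_iff .
  then have ne: "x \<noteq> to_ac ?t - x" by (auto simp: algebra_simps mult_2)
  have "map_poly to_ac [:?n, - ?t, 1:] = [:- x, 1:] * [:- (to_ac ?t - x), 1:]"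
    unfolding map_poly_quad by (rule quad_factor[OF qx])
  then show ?thesis unfolding separable_element_def
    using irreducible_quad[OF qx False] rsquarefree_two_linear[OF ne]
    by (intro exI[of _ "[:?n, - ?t, 1:]"]) (simp del: mult_pCons_left mult_pCons_right)
qed

lemma separable_ext_simple_ext:
  assumes "quad_root t n \<alpha>" "t^2 - 4 * n \<noteq> 0"
  shows "separable_ext_le2 (simple_ext \<alpha>)"
  unfolding separable_ext_le2_def
  using intermediate_field_simple_ext[OF assms(1)] dim_simple_ext separable_simple_ext[OF assms] by blast

text \<open>Any polynomial over \<open>k\<close> with root \<open>\<alpha>\<close> is divisible by
  the quadratic one, as a remainder of degree at most 1 cannot vanish at an irrational element. A
  double root of the quadratic would thus be a multiple root of every such polynomial.\<close>

lemma separable_quad_disc: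
  fixes t n :: "'k::field"
  assumes q: "quad_root t n \<alpha>" and irr: "\<alpha> \<notin> range to_ac" and sep: "separable_element \<alpha>"
  shows "t^2 - 4 * n \<noteq> 0"
proof
  assume d: "t^2 - 4 * n = 0"
  obtain p :: "'k poly" where p: "Factorial_Ring.irreducible p" "poly (map_poly to_ac p) \<alpha> = 0" "rsquarefree (map_poly to_ac p)"
    using sep unfolding separable_element_def by blast
  let ?q = "[:n, - t, 1:]"
  have hm: "map_poly to_ac (f + g) = map_poly to_ac f + map_poly to_ac g" "map_poly to_ac (f * g) = map_poly to_ac f * map_poly to_ac g" for f g :: "'k poly"
    by (auto simp: poly_eq_iff coeff_map_poly coeff_mult to_ac_sum)
  have q0: "poly (map_poly to_ac ?q) \<alpha> = 0" unfolding map_poly_quad using quad_factor[OF q] by simp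
  have "p = p div ?q * ?q + p mod ?q" by (rule div_mult_mod_eq[symmetric])
  then have "map_poly to_ac p = map_poly to_ac (p div ?q) * map_poly to_ac ?q + map_poly to_ac (p mod ?q)" using hm by metis
  then have r0: "poly (map_poly to_ac (p mod ?q)) \<alpha> = 0" using p(2) q0 by simp
  have "p mod ?q = 0 \<or> Polynomial.degree (p mod ?q) < Polynomial.degree ?q" by (rule degree_mod_less) simp
  then have "Polynomial.degree (p mod ?q) \<le> 1" by auto
  then obtain c e where ce: "p mod ?q = [:c, e:]" by (rule degree_1_cases)
  have "to_ac c + to_ac e * \<alpha> = 0" using r0 by (simp add: ce map_poly_pCons mult.commute)
  then have "c = 0 \<and> e = 0" using simple_ext_coords[OF irr, of c e 0 0] by simp
  then have "?q dvd p" using ce by (simp add: dvd_eq_mod_eq_0)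
  then obtain k where k: "p = ?q * k" by (elim dvdE)
  have "(2 * \<alpha> - to_ac t)^2 = 0" unfolding quad_root_disc[OF q] d by simp
  then have "\<alpha> + \<alpha> = to_ac t" by simp
  then have "\<alpha> = to_ac t - \<alpha>" by (metis add_diff_cancel_right')
  then have m: "map_poly to_ac p = ([:- \<alpha>, 1:] * [:- \<alpha>, 1:]) * map_poly to_ac k"
    unfolding k hm map_poly_quad using quad_factor[OF q] by metis
  have "map_poly to_ac p \<noteq> 0" using p(3) by (simp add: rsquarefree_def)
  moreover have "[:- \<alpha>, 1:]^2 dvd map_poly to_ac p" unfolding m power2_eq_square by (rule dvd_triv_left)
  ultimately have "2 \<le> Polynomial.order \<alpha> (map_poly to_ac p)" by (simp add: order_divides)
  then show False using p(3) unfolding rsquarefree_def by (metis One_nat_def not_numeral_le_zero numeral_le_one_iff semiring_norm(69))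
qed

lemma separable_ext_le2_cases:
  fixes F :: "'k::field alg_closure set"
  assumes F: "separable_ext_le2 F"
  obtains t n \<alpha> where "quad_root t n \<alpha>" "t^2 - 4 * n \<noteq> 0" "F = simple_ext \<alpha>"
proof -
  have i: "range to_ac \<subseteq> F" and cl: "\<And>x y. x \<in> F \<Longrightarrow> y \<in> F \<Longrightarrow> x + y \<in> F" "\<And>x y. x \<in> F \<Longrightarrow> y \<in> F \<Longrightarrow> x * y \<in> F"
    and dim: "ext.dim F \<in> {1, 2}" and sep: "\<And>x. x \<in> F \<Longrightarrow> separable_element x"
    using F unfolding separable_ext_le2_def intermediate_field_def by auto
  have sub: "ext.subspace F"
  proof (rule ext.subspaceI)
    show "0 \<in> F" using i range_to_ac_closed(8) by blast
    show "to_ac c * x \<in> F" if "x \<in> F" for c x using i cl(2) that by blast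
  qed (rule cl(1))
  show ?thesis
  proof (cases "F = range to_ac")
    case True
    \<comment> \<open>The trivial extension is represented by \<open>x^2 - x\<close>, which has
      distinct roots.\<close>
    have "quad_root 1 0 (0 :: 'k alg_closure)" by (simp add: quad_root_def)
    moreover have "(1::'k)^2 - 4 * 0 \<noteq> 0" by simp
    moreover have "F = simple_ext 0" using True simple_ext_rational[of "0 :: 'k alg_closure"] by (simp add: range_to_ac_closed)
    ultimately show ?thesis by (rule that)
  next
    case False
    then obtain \<alpha> where \<alpha>: "\<alpha> \<in> F" "\<alpha> \<notin> range to_ac" using i by blast
    have a1: "\<alpha> \<noteq> 1" using \<alpha>(2) range_to_ac_closed(9) by metis
    have ind: "ext.independent {1, \<alpha>}" by (rule independent_1_alpha[OF \<alpha>(2)])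
    have sF: "{1, \<alpha>} \<subseteq> F" using \<alpha> i range_to_ac_closed(9) by blast
    have c2: "card {1, \<alpha>} = 2" using a1 by auto
    obtain B where B: "B \<subseteq> F" "ext.independent B" "F \<subseteq> ext.span B" "card B = ext.dim F" using ext.basis_exists by blast
    \<comment> \<open>An infinite set has cardinality 0, which the degree condition
      excludes.\<close>
    have finB: "finite B" using B(4) dim by (intro card_ge_0_finite) auto
    have "card {1, \<alpha>} \<le> card B" using ext.independent_span_bound[OF finB ind] sF B(3) by auto
    then have cB: "card B = 2" using B(4) dim c2 by auto
    have "F = ext.span {1, \<alpha>}"
    proof
      show "ext.span {1, \<alpha>} \<subseteq> F" by (rule ext.span_minimal[OF sF sub])
      show "F \<subseteq> ext.span {1, \<alpha>}"
      proof (rule ccontr)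
        assume "\<not> ?thesis"
        then obtain \<gamma> where \<gamma>: "\<gamma> \<in> F" "\<gamma> \<notin> ext.span {1, \<alpha>}" by blast
        then have "ext.independent (insert \<gamma> {1, \<alpha>})" using ind ext.independent_insertI by blast
        moreover have "insert \<gamma> {1, \<alpha>} \<subseteq> ext.span B" using \<gamma>(1) sF B(3) by auto
        ultimately have "card (insert \<gamma> {1, \<alpha>}) \<le> 2" using ext.independent_span_bound[OF finB] cB by metis
        moreover have "\<gamma> \<notin> {1, \<alpha>}" using \<gamma>(2) ext.span_base by blast
        ultimately show False using c2 by simp
      qed
    qed
    then have FE: "F = simple_ext \<alpha>" by (simp add: simple_ext_eq_span)
    have "\<alpha> * \<alpha> \<in> F" using cl(2) \<alpha>(1) by blast
    then obtain a b where "\<alpha> * \<alpha> = to_ac a + to_ac b * \<alpha>" unfolding FE simple_ext_def by blast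
    then have q: "quad_root b (- a) \<alpha>" by (simp add: quad_root_def power2_eq_square)
    show ?thesis by (rule that[OF q separable_quad_disc[OF q \<alpha>(2) sep[OF \<alpha>(1)]] FE])
  qed
qed

text \<open>These extensions are normal: an isomorphism sends \<open>\<alpha>\<close> to itself or
  to its conjugate, both of which generate the same subfield. So the isomorphism classes within the
  closure are singletons.\<close>

lemma ext_iso_iff_eq:
  fixes F F' :: "'k::field alg_closure set"
  assumes F: "separable_ext_le2 F" "separable_ext_le2 F'"
  shows "ext_iso F F' \<longleftrightarrow> F = F'"
proof
  assume "F = F'"
  then show "ext_iso F F'" unfolding ext_iso_def by (intro exI[of _ "\<lambda>x. x"]) (auto simp: bij_betw_def)
next
  assume "ext_iso F F'"
  then obtain \<phi> where bij: "bij_betw \<phi> F F'" and c: "\<And>c. \<phi> (to_ac c) = to_ac c"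
    and add: "\<And>x y. x \<in> F \<Longrightarrow> y \<in> F \<Longrightarrow> \<phi> (x + y) = \<phi> x + \<phi> y"
    and mult: "\<And>x y. x \<in> F \<Longrightarrow> y \<in> F \<Longrightarrow> \<phi> (x * y) = \<phi> x * \<phi> y"
    unfolding ext_iso_def by blast
  obtain t n \<alpha> where q: "quad_root t n \<alpha>" and FE: "F = simple_ext \<alpha>" using separable_ext_le2_cases[OF F(1)] by metis
  have mem: "\<alpha> \<in> F" "to_ac a \<in> F" "to_ac a * \<alpha> \<in> F" for a
    using simple_extI[of 0 1 \<alpha>] simple_extI[of a 0 \<alpha>] simple_extI[of 0 a \<alpha>] by (simp_all add: FE)
  have val: "\<phi> (to_ac a + to_ac b * \<alpha>) = to_ac a + to_ac b * \<phi> \<alpha>" for a b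
    using add[OF mem(2,3)] mult[OF mem(2,1)] c by simp
  have "\<alpha> * \<alpha> = to_ac (- n) + to_ac t * \<alpha>" using q by (simp add: quad_root_def power2_eq_square)
  then have "\<phi> \<alpha> * \<phi> \<alpha> = to_ac (- n) + to_ac t * \<phi> \<alpha>" using mult[OF mem(1,1)] val by metis
  then have "quad_root t n (\<phi> \<alpha>)" by (simp add: quad_root_def power2_eq_square)
  then have r: "\<phi> \<alpha> = \<alpha> \<or> \<phi> \<alpha> = to_ac t - \<alpha>" using quad_root_cases[OF q] by blast
  have im: "\<phi> ` F = F'" using bij by (simp add: bij_betw_def)
  have i: "intermediate_field F" "intermediate_field F'" using F by (auto simp: separable_ext_le2_def)
  have "\<phi> \<alpha> \<in> F" using r mem i(1) unfolding intermediate_field_def by metis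
  then have "to_ac a + to_ac b * \<phi> \<alpha> \<in> F" for a b using i(1) mem(2) unfolding intermediate_field_def by blast
  note lin = this
  have "\<phi> x \<in> F" if x: "x \<in> F" for x
  proof -
    obtain a b where "x = to_ac a + to_ac b * \<alpha>" using x unfolding FE simple_ext_def by blast
    then show ?thesis using val lin by simp
  qed
  then have "F' \<subseteq> F" using im by blast
  have "\<phi> \<alpha> \<in> F'" using im mem(1) by blast
  moreover have t: "to_ac a \<in> F'" for a using i(2) unfolding intermediate_field_def by blast
  ultimately have "\<alpha> \<in> F'" using r i(2) unfolding intermediate_field_def
    by (metis diff_diff_eq2 add_diff_cancel_left')
  then have "to_ac a + to_ac b * \<alpha> \<in> F'" for a b using t i(2) unfolding intermediate_field_def by blast
  then have "F \<subseteq> F'" unfolding FE simple_ext_def by blast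
  then show "F = F'" using \<open>F' \<subseteq> F\<close> by blast
qed

lemma Ex2_eq: "Ex2 = (\<lambda>F. {F}) ` {F. separable_ext_le2 F}"
proof -
  have "{(F, F'). separable_ext_le2 F \<and> separable_ext_le2 F' \<and> ext_iso F F'} `` {F} = {F}" if "separable_ext_le2 F" for F :: "'k::field alg_closure set"
    using that ext_iso_iff_eq by auto
  then show ?thesis unfolding Ex2_def quotient_def by auto
qed

section \<open>Orbits with rank one points\<close>

text \<open>This locus determines the extension attached to \<open>quad_tensor t n\<close>.\<close>
definition rank_one_locus :: "'k::field tensor \<Rightarrow> ('k alg_closure \<times> 'k alg_closure) set" where
  "rank_one_locus x = {(s, t). (s, t) \<noteq> (0, 0) \<and>
     (\<exists>u v. \<forall>i j. lcomb s (lift_mat (slice 1 x)) t (lift_mat (slice 2 x)) $ i $ j = u $ i * v $ j)}"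

lemma rank_one_mult:
  fixes M P Q :: "'a::field^3^3"
  assumes "\<forall>i j. M $ i $ j = u $ i * v $ j"
  shows "\<exists>u' v'. \<forall>i j. (P ** M ** Q) $ i $ j = u' $ i * v' $ j"
proof -
  have "(P ** M ** Q) $ i $ j = (P *v u) $ i * (v v* Q) $ j" for i j
    using assms by (simp add: matrix_matrix_mult_def matrix_vector_mult_def vector_matrix_mult_def sum_3 algebra_simps)
  then show ?thesis by (intro exI[of _ "P *v u"] exI[of _ "v v* Q"]) simp
qed

lemma rank_one_locus_act:
  fixes x :: "'k::field tensor"
  assumes g: "(g1, g2, g3) \<in> GL332" and m: "(s * to_ac (g3$1$1) + t * to_ac (g3$2$1), s * to_ac (g3$1$2) + t * to_ac (g3$2$2)) \<in> rank_one_locus x" (is "(?s, ?t) \<in> _")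
    and nz: "(s, t) \<noteq> (0, 0)"
  shows "(s, t) \<in> rank_one_locus (act (g1, g2, g3) x)"
proof -
  have "lcomb s (lift_mat (slice 1 (act (g1, g2, g3) x))) t (lift_mat (slice 2 (act (g1, g2, g3) x))) =
      lift_mat g1 ** lcomb ?s (lift_mat (slice 1 x)) ?t (lift_mat (slice 2 x)) ** lift_mat (transpose g2)"
    unfolding slice_act lift_mat_mult lcomb_PQ lift_mat_lcomb lcomb_lcomb ..
  note e = this
  obtain u v where "\<forall>i j. lcomb ?s (lift_mat (slice 1 x)) ?t (lift_mat (slice 2 x)) $ i $ j = u $ i * v $ j"
    using m unfolding rank_one_locus_def mem_Collect_eq case_prod_conv by blast
  from rank_one_mult[OF this] show ?thesis
    unfolding rank_one_locus_def mem_Collect_eq case_prod_conv e using nz by blast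
qed

lemma lift_mat_M3: "lift_mat (M3 a b c d e f g h i) = M3 (to_ac a) (to_ac b) (to_ac c) (to_ac d) (to_ac e) (to_ac f) (to_ac g) (to_ac h) (to_ac i)"
  by (simp add: vec_eq_iff forall_3 lift_mat_def)

text \<open>The member of the pencil is zero outside its lower block, so its rank is governed by the
  determinant of that block. The locus consists of the multiples of \<open>(- \<alpha>, 1)\<close>
  for the roots \<open>\<alpha>\<close> of \<open>x^2 - t x + n\<close>.\<close>

lemma rank_one_locus_quad:
  "(s, w) \<in> rank_one_locus (quad_tensor t n) \<longleftrightarrow> (s, w) \<noteq> (0, 0) \<and> s * (s + to_ac t * w) + to_ac n * w^2 = 0"
proof -
  let ?M = "M3 0 0 0 0 s (- (w * to_ac n)) 0 w (s + w * to_ac t)"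
  have M: "lcomb s (lift_mat (slice 1 (quad_tensor t n))) w (lift_mat (slice 2 (quad_tensor t n))) = ?M"
    by (simp add: quad_tensor_def lift_mat_M3)
  have e: "s * (s + to_ac t * w) + to_ac n * w^2 = s * (s + w * to_ac t) - (- (w * to_ac n)) * w"
    by (simp add: power2_eq_square algebra_simps)
  have "(\<exists>u v. \<forall>i j. ?M $ i $ j = u $ i * v $ j) \<longleftrightarrow> s * (s + to_ac t * w) + to_ac n * w^2 = 0" if nz: "(s, w) \<noteq> (0, 0)"
  proof
    assume "\<exists>u v. \<forall>i j. ?M $ i $ j = u $ i * v $ j"
    then obtain u v where "\<And>i j. ?M $ i $ j = u $ i * v $ j" by blast
    from this[of 2 2] this[of 2 3] this[of 3 2] this[of 3 3]
    have "s = u $ 2 * v $ 2" "- (w * to_ac n) = u $ 2 * v $ 3" "w = u $ 3 * v $ 2" "s + w * to_ac t = u $ 3 * v $ 3" by simp_all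
    then show "s * (s + to_ac t * w) + to_ac n * w^2 = 0" unfolding e by (metis (no_types, lifting) mult.assoc mult.commute right_minus_eq)
  next
    assume z: "s * (s + to_ac t * w) + to_ac n * w^2 = 0"
    have w: "w \<noteq> 0" using z nz by auto
    define k where "k = s / w"
    have s: "s = k * w" using w by (simp add: k_def)
    have "w * (w * (k * (k + to_ac t) + to_ac n)) = 0" using z unfolding s by (simp add: power2_eq_square algebra_simps)
    then have n: "to_ac n = - (k * (k + to_ac t))" using w by (simp add: eq_neg_iff_add_eq_0 add.commute)
    have "\<forall>i j. ?M $ i $ j = vector [0, k, 1] $ i * vector [0, w, w * (k + to_ac t)] $ j"
      unfolding forall_3 n s by (simp add: algebra_simps)
    then show "\<exists>u v. \<forall>i j. ?M $ i $ j = u $ i * v $ j" by blast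
  qed
  then show ?thesis unfolding rank_one_locus_def mem_Collect_eq case_prod_conv M by blast
qed

lemma quotient_root:
  fixes s w :: "'a::field"
  assumes "s * (s + t * w) + n * w^2 = 0" "w \<noteq> 0"
  shows "(- (s / w))^2 = t * - (s / w) - n"
proof -
  define k where "k = s / w"
  have s: "s = k * w" using assms(2) by (simp add: k_def)
  have "w * w * (k * (k + t) + n) = 0" using assms(1) unfolding s by (simp add: power2_eq_square algebra_simps)
  then have "k * (k + t) + n = 0" using assms(2) by simp
  then show ?thesis unfolding k_def[symmetric] by (simp add: power2_eq_square algebra_simps eq_neg_iff_add_eq_0)
qed

lemma simple_ext_subset:
  assumes "intermediate_field F" "\<alpha> \<in> F"
  shows "simple_ext \<alpha> \<subseteq> F"
  using assms unfolding simple_ext_def intermediate_field_def by blast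

text \<open>A rational change of basis of the pencil carries the rank one point
  \<open>(- \<alpha>, 1)\<close> to a rank one point of the other pencil. Its coordinates lie in
  \<open>simple_ext \<alpha>\<close>, and their negative ratio is a root of the other
  polynomial.\<close>

lemma eqv_quad_imp_subset:
  fixes t n :: "'k::field"
  assumes e: "eqv (quad_tensor t n) (quad_tensor t' n')" and q: "quad_root t n \<alpha>" "quad_root t' n' \<alpha>'"
  shows "simple_ext \<alpha>' \<subseteq> simple_ext \<alpha>"
proof -
  obtain g1 g2 g3 where g: "(g1, g2, g3) \<in> GL332" "act (g1, g2, g3) (quad_tensor t' n') = quad_tensor t n"
    using eqv_sym[OF e] unfolding eqv_def by auto
  have h: "quad_root t n \<alpha>" by (rule q)
  obtain h1 h2 h3 where hh: "grp_inv (g1, g2, g3) (h1, h2, h3)" using g(1) GL332_iff_inv by (metis prod_cases3)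
  have hG: "(h1, h2, h3) \<in> GL332" using hh grp_inv_sym GL332_iff_inv by blast
  have hact: "act (h1, h2, h3) (quad_tensor t n) = quad_tensor t' n'" using act_inv[OF hh] g(2) by metis
  have inv3: "h3 ** g3 = mat 1" using hh by (auto simp: grp_inv_def grp_mult_def)
  have root: "(- \<alpha>, 1) \<in> rank_one_locus (quad_tensor t n)"
    unfolding rank_one_locus_quad using h by (simp add: quad_root_def power2_eq_square algebra_simps)
  \<comment> \<open>Chosen so that \<open>h3\<close>, the inverse of \<open>g3\<close>, takes the
    point back to \<open>(- \<alpha>, 1)\<close>.\<close>
  let ?s = "- \<alpha> * to_ac (g3$1$1) + to_ac (g3$2$1)" and ?w = "- \<alpha> * to_ac (g3$1$2) + to_ac (g3$2$2)"
  have i: "g3 ** h3 = mat 1" using hh by (auto simp: grp_inv_def grp_mult_def)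
  have ent: "g3$1$1 * h3$1$1 + g3$1$2 * h3$2$1 = 1" "g3$1$1 * h3$1$2 + g3$1$2 * h3$2$2 = 0"
    "g3$2$1 * h3$1$1 + g3$2$2 * h3$2$1 = 0" "g3$2$1 * h3$1$2 + g3$2$2 * h3$2$2 = 1"
    using i by (auto simp: vec_eq_iff forall_2 matrix_matrix_mult_def sum_2 mat_def)
  have ent': "to_ac (g3$1$1) * to_ac (h3$1$1) + to_ac (g3$1$2) * to_ac (h3$2$1) = 1" "to_ac (g3$1$1) * to_ac (h3$1$2) + to_ac (g3$1$2) * to_ac (h3$2$2) = 0"
    "to_ac (g3$2$1) * to_ac (h3$1$1) + to_ac (g3$2$2) * to_ac (h3$2$1) = 0" "to_ac (g3$2$1) * to_ac (h3$1$2) + to_ac (g3$2$2) * to_ac (h3$2$2) = 1"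
    using ent by (metis to_ac_0 to_ac_1 to_ac_add to_ac_mult)+
  have c1: "?s * to_ac (h3$1$1) + ?w * to_ac (h3$2$1) = - \<alpha>"
  proof -
    have "?s * to_ac (h3$1$1) + ?w * to_ac (h3$2$1) = - \<alpha> * (to_ac (g3$1$1) * to_ac (h3$1$1) + to_ac (g3$1$2) * to_ac (h3$2$1)) +
       (to_ac (g3$2$1) * to_ac (h3$1$1) + to_ac (g3$2$2) * to_ac (h3$2$1))" by (simp add: algebra_simps)
    then show ?thesis unfolding ent' by simp
  qed
  have c2: "?s * to_ac (h3$1$2) + ?w * to_ac (h3$2$2) = 1"
  proof -
    have "?s * to_ac (h3$1$2) + ?w * to_ac (h3$2$2) = - \<alpha> * (to_ac (g3$1$1) * to_ac (h3$1$2) + to_ac (g3$1$2) * to_ac (h3$2$2)) +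
       (to_ac (g3$2$1) * to_ac (h3$1$2) + to_ac (g3$2$2) * to_ac (h3$2$2))" by (simp add: algebra_simps)
    then show ?thesis unfolding ent' by simp
  qed
  have nz: "(?s, ?w) \<noteq> (0, 0)" using c2 by auto
  have "(?s, ?w) \<in> rank_one_locus (act (h1, h2, h3) (quad_tensor t n))"
    by (rule rank_one_locus_act[OF hG _ nz]) (use root c1 c2 in simp)
  then have r: "?s * (?s + to_ac t' * ?w) + to_ac n' * ?w^2 = 0" unfolding hact rank_one_locus_quad by blast
  have w: "?w \<noteq> 0" using r nz by auto
  have F: "intermediate_field (simple_ext \<alpha>)" by (rule intermediate_field_simple_ext[OF q(1)])
  have "quad_root t' n' (- (?s / ?w))" unfolding quad_root_def by (rule quotient_root[OF r w])
  \<comment> \<open>The root obtained may be the conjugate of \<open>\<alpha>'\<close>, which lies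
    in the same field.\<close>
  then have \<alpha>': "\<alpha>' = - (?s / ?w) \<or> \<alpha>' = to_ac t' + ?s / ?w" using quad_root_cases[OF _ q(2)] by force
  have fld: "x + y \<in> simple_ext \<alpha>" "x - y \<in> simple_ext \<alpha>" "x * y \<in> simple_ext \<alpha>" "inverse x \<in> simple_ext \<alpha>"
    if "x \<in> simple_ext \<alpha>" "y \<in> simple_ext \<alpha>" for x y
    using F that unfolding intermediate_field_def by auto
  have k: "to_ac a \<in> simple_ext \<alpha>" for a using F unfolding intermediate_field_def by blast
  have "?s \<in> simple_ext \<alpha>" "?w \<in> simple_ext \<alpha>"
    using simple_extI[of "g3$2$1" "- g3$1$1" \<alpha>] simple_extI[of "g3$2$2" "- g3$1$2" \<alpha>] by (simp_all add: mult.commute add.commute)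
  then have sw: "?s / ?w \<in> simple_ext \<alpha>" unfolding divide_inverse by (intro fld(3) fld(4))
  then have "\<alpha>' \<in> simple_ext \<alpha>"
    using \<alpha>' fld(1)[OF k[of t'] sw] fld(2)[OF k[of 0] sw] by auto
  then show ?thesis by (rule simple_ext_subset[OF F])
qed

text \<open>For distinct rational eigenvalues the two rank one members \<open>v A - B\<close> and
  \<open>B - u A\<close> form a basis of the pencil.\<close>

lemma quad_tensor_split:
  fixes u v :: "'k::field"
  assumes "u \<noteq> v"
  shows "eqv (quad_tensor (u + v) (u * v)) (tens {(2,2,1), (3,3,2)})"
proof -
  obtain k where k: "v = u + k" "k \<noteq> 0" using assms by (metis add.commute diff_add_cancel eq_iff_diff_eq_0)
  have "eqv (pencil (M3 0 0 0 0 1 0 0 0 1) (M3 0 0 0 0 u 0 0 0 v)) (tens {(2,2,1), (3,3,2)})"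
    unfolding tens_pencil
    by (rule eqvI[where P = "M3 1 0 0 0 (1/k) 0 0 0 (1/k)" and Q = "M3 1 0 0 0 1 0 0 0 1" and p = v and q = "- 1" and r = "- u" and s = 1])
       (use k(2) in \<open>simp_all add: k(1) field_simps\<close>)
  moreover have "eqv (pencil (M3 0 0 0 0 1 0 0 0 1) (M3 0 0 0 0 u 0 0 0 v)) (quad_tensor (u + v) (u * v - 0 * 0))"
    by (rule quad_tensor_similar) (use assms in simp)
  ultimately show ?thesis using eqv_sym eqv_trans by fastforce
qed

text \<open>Replacing the second matrix \<open>B\<close> by \<open>a A + b B\<close> replaces the
  root \<open>\<alpha>\<close> by \<open>a + b \<alpha>\<close>.\<close>

lemma quad_tensor_affine:
  fixes t n a b :: "'k::field"
  assumes "b \<noteq> 0"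
  shows "eqv (quad_tensor t n) (quad_tensor (2 * a + b * t) (a^2 + a * b * t + b^2 * n))"
proof -
  have "eqv (quad_tensor t n) (pencil (M3 0 0 0 0 1 0 0 0 1) (M3 0 0 0 0 a (- (b * n)) 0 b (a + b * t)))"
    unfolding quad_tensor_def
    by (rule eqvI[where P = "M3 1 0 0 0 1 0 0 0 1" and Q = "M3 1 0 0 0 1 0 0 0 1" and p = 1 and q = 0 and r = a and s = b]) (use assms in simp_all)
  moreover have "eqv (pencil (M3 0 0 0 0 1 0 0 0 1) (M3 0 0 0 0 a (- (b * n)) 0 b (a + b * t)))
      (quad_tensor (a + (a + b * t)) (a * (a + b * t) - (- (b * n)) * b))"
    by (rule quad_tensor_similar) (use assms in simp)
  moreover have "a + (a + b * t) = 2 * a + b * t" "a * (a + b * t) - (- (b * n)) * b = a^2 + a * b * t + b^2 * n"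
    by (simp_all add: power2_eq_square algebra_simps)
  ultimately show ?thesis by simp (erule (1) eqv_trans)
qed

lemma eqv_quad_iff:
  fixes t n :: "'k::field"
  assumes q: "quad_root t n \<alpha>" "quad_root t' n' \<alpha>'" and d: "t^2 - 4 * n \<noteq> 0" "t'^2 - 4 * n' \<noteq> 0"
  shows "eqv (quad_tensor t n) (quad_tensor t' n') \<longleftrightarrow> simple_ext \<alpha> = simple_ext \<alpha>'"
proof
  assume "eqv (quad_tensor t n) (quad_tensor t' n')"
  then show "simple_ext \<alpha> = simple_ext \<alpha>'"
    using eqv_quad_imp_subset[OF _ q] eqv_quad_imp_subset[OF eqv_sym q(2,1)] by blast
next
  assume eq: "simple_ext \<alpha> = simple_ext \<alpha>'"
  \<comment> \<open>Rational roots do not generate each other through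
    \<open>quad_tensor_affine\<close>, so the split case goes through a common normal form.\<close>
  have split: "eqv (quad_tensor t n) (tens {(2,2,1), (3,3,2)})" if q: "quad_root t n \<alpha>" and d: "t^2 - 4 * n \<noteq> 0" and r: "\<alpha> \<in> range to_ac"
    for t n :: 'k and \<alpha>
  proof -
    obtain u where u: "\<alpha> = to_ac u" using r by auto
    have "to_ac n = to_ac (t * u - u^2)" using q by (simp add: u quad_root_def)
    then have n: "n = u * (t - u)" unfolding to_ac_eq_iff by (simp add: power2_eq_square algebra_simps)
    have "t^2 - 4 * n = (t - 2 * u)^2" unfolding n by (simp add: power2_eq_square algebra_simps)
    then have "t \<noteq> 2 * u" using d by auto
    then have "u \<noteq> t - u" by (metis add_diff_cancel_left' diff_add_cancel mult_2)
    from quad_tensor_split[OF this] show ?thesis by (simp add: n)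
  qed
  show "eqv (quad_tensor t n) (quad_tensor t' n')"
  proof (cases "\<alpha> \<in> range to_ac")
    case True
    have "\<alpha>' \<in> simple_ext \<alpha>'" using simple_extI[of 0 1 \<alpha>'] by simp
    then have "\<alpha>' \<in> range to_ac" using eq simple_ext_rational[OF True] by simp
    then show ?thesis using split[OF q(1) d(1) True] split[OF q(2) d(2)] eqv_sym eqv_trans by blast
  next
    case False
    have "\<alpha> \<in> simple_ext \<alpha>" using simple_extI[of 0 1 \<alpha>] by simp
    then have irr: "\<alpha>' \<notin> range to_ac" using eq False simple_ext_rational by blast
    have "\<alpha>' \<in> simple_ext \<alpha>" using eq simple_extI[of 0 1 \<alpha>'] by simp
    then obtain a b where ab: "\<alpha>' = to_ac a + to_ac b * \<alpha>" unfolding simple_ext_def by blast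
    have b: "b \<noteq> 0" using irr ab by auto
    have "quad_root (2 * a + b * t) (a^2 + a * b * t + b^2 * n) \<alpha>'" unfolding ab by (rule quad_root_affine[OF q(1)])
    then have "t' = 2 * a + b * t \<and> n' = a^2 + a * b * t + b^2 * n" using quad_root_unique[OF irr q(2)] by blast
    then show ?thesis using quad_tensor_affine[OF b] by blast
  qed
qed

section \<open>Extension of scalars to the closure\<close>

definition lift :: "'k::field tensor \<Rightarrow> 'k alg_closure tensor" where
  "lift x = (\<chi> p. to_ac (x $ p))"

lemma lift_nth: "lift x $ p = to_ac (x $ p)"
  by (simp add: lift_def)

lemma lift_act:
  fixes x :: "'k::field tensor"
  shows "lift (act (g1, g2, g3) x) = act (lift_mat g1, lift_mat g2, (\<chi> i j. to_ac (g3 $ i $ j))) (lift x)"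
proof -
  have "lift (act (g1, g2, g3) x) $ (i, j, l) = act (lift_mat g1, lift_mat g2, (\<chi> i j. to_ac (g3 $ i $ j))) (lift x) $ (i, j, l)" for i j l
    unfolding lift_nth act_expand by (simp add: to_ac_sum lift_mat_def lift_nth)
  then show ?thesis by (simp add: vec_eq_iff split_paired_All)
qed

lemma lift_eqv: "eqv x y \<Longrightarrow> eqv (lift x) (lift y)"
proof -
  assume "eqv x y"
  then obtain g1 g2 g3 where g: "(g1, g2, g3) \<in> GL332" "act (g1, g2, g3) x = y" unfolding eqv_def by auto
  have "(lift_mat g1, lift_mat g2, (\<chi> i j. to_ac (g3 $ i $ j))) \<in> GL332"
    using g(1) by (simp add: GL332_def invertible_det_nz det_3 det_2 lift_mat_def flip: to_ac_mult to_ac_add to_ac_diff)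
  then show ?thesis unfolding eqv_def using lift_act g(2) by metis
qed

lemma lift_tens: "lift (tens S) = tens S"
  by (simp add: vec_eq_iff lift_nth tens_def)

lemma lift_zero: "lift x = 0 \<longleftrightarrow> x = 0"
  by (simp add: vec_eq_iff lift_nth)

lemma slice_lift: "slice l (lift x) = lift_mat (slice l x)"
  by (simp add: vec_eq_iff lift_nth slice_def lift_mat_def)

lemma lift_tdisc: "tdisc (lift x) = to_ac (tdisc x)"
  unfolding tdisc_def Let_def slice_lift lift_mat_cubic_coeff by (simp add: disc_def)

lemma lift_quad_tensor: "lift (quad_tensor t n) = quad_tensor (to_ac t) (to_ac n)"
  unfolding quad_tensor_def
  by (simp add: vec_eq_iff split_paired_All forall_3 forall_2 lift_nth pencil_def)

lemma quad_tensor_alg_closed: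
  fixes t n :: "'a::alg_closed_field"
  assumes "t^2 - 4 * n \<noteq> 0"
  shows "eqv (quad_tensor t n) (tens {(2,2,1), (3,3,2)})"
proof -
  have "Polynomial.degree [:n, - t, 1:] > 0" by simp
  then obtain u where "poly [:n, - t, 1:] u = 0" using alg_closed_imp_poly_has_root by blast
  then have n: "n = u * (t - u)" by (simp add: algebra_simps eq_neg_iff_add_eq_0)
  have "t^2 - 4 * n = (t - 2 * u)^2" unfolding n by (simp add: power2_eq_square algebra_simps)
  then have "t \<noteq> 2 * u" using assms by auto
  then have "u \<noteq> t - u" by (metis add_diff_cancel_left' diff_add_cancel mult_2)
  from quad_tensor_split[OF this] show ?thesis by (simp add: n)
qed

section \<open>The strata\<close>

text \<open>Each weight is the point closest to the origin in the convex hull of the weights of the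
  support beside it.\<close>

definition strata_table :: "(wt \<times> (3 \<times> 3 \<times> 2) set) set" where
  "strata_table = set [
    (mk_wt (-1/3) (1/6) (1/6) (-1/3) (1/6) (1/6) 0 0, {(2,2,1), (3,3,2)}),
    (mk_wt (-2/33) (1/33) (1/33) (-2/33) (1/33) (1/33) (-1/22) (1/22), {(1,2,2), (2,1,2), (2,2,1), (3,3,1)}),
    (mk_wt (-1/9) 0 (1/9) (-1/9) 0 (1/9) (-1/18) (1/18), {(1,3,2), (2,2,2), (2,3,1), (3,1,2), (3,2,1)}),
    (mk_wt (-1/30) (-1/30) (1/15) (-1/30) (-1/30) (1/15) (-1/10) (1/10), {(1,1,2), (2,2,2), (3,3,1)}),
    (mk_wt 0 0 0 (-1/3) (1/6) (1/6) 0 0, {(1,2,1), (2,2,2), (2,3,1), (3,3,2)}),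
    (mk_wt (-1/12) (-1/12) (1/6) (-1/12) (-1/12) (1/6) 0 0, {(1,3,1), (2,3,2), (3,1,1), (3,2,2)}),
    (mk_wt (-1/6) 0 (1/6) (-1/6) 0 (1/6) (-1/6) (1/6), {(1,3,2), (2,2,2), (3,1,2), (3,3,1)}),
    (mk_wt (-1/3) (1/6) (1/6) 0 0 0 0 0, {(2,1,1), (2,2,2), (3,2,1), (3,3,2)}),
    (mk_wt (-2/15) (1/15) (1/15) (-1/3) (1/15) (4/15) (-1/10) (1/10), {(1,3,2), (2,2,2), (3,3,1)}),
    (mk_wt (-1/3) (1/15) (4/15) (-2/15) (1/15) (1/15) (-1/10) (1/10), {(3,1,2), (2,2,2), (3,3,1)}),
    (mk_wt (-1/3) 0 (1/3) (-1/3) 0 (1/3) (-1/6) (1/6), {(2,3,2), (3,2,2), (3,3,1)}),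
    (mk_wt 0 0 0 0 0 0 (-1/2) (1/2), {(1,1,2), (2,2,2), (3,3,2)}),
    (mk_wt (-1/3) (1/6) (1/6) (-1/3) (1/6) (1/6) (-1/2) (1/2), {(2,2,2), (3,3,2)}),
    (mk_wt (-1/3) (1/6) (1/6) (-1/3) (-1/3) (2/3) 0 0, {(2,3,1), (3,3,2)}),
    (mk_wt (-1/3) (-1/3) (2/3) (-1/3) (1/6) (1/6) 0 0, {(3,2,1), (3,3,2)}),
    (mk_wt (-1/3) (-1/3) (2/3) (-1/3) (-1/3) (2/3) (-1/2) (1/2), {(3,3,2)})]"

abbreviation \<beta>_quad :: wt where
  "\<beta>_quad \<equiv> mk_wt (-1/3) (1/6) (1/6) (-1/3) (1/6) (1/6) 0 0"

abbreviation quad_support :: "(3 \<times> 3 \<times> 2) set" where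
  "quad_support \<equiv> {(2,2,1), (3,3,2)}"

lemma card_strata_table: "card (Domain strata_table) = 16"
  unfolding strata_table_def by (simp add: mk_wt_eq)

lemma strata_table_Z_ss:
  "(\<beta>, S) \<in> strata_table \<Longrightarrow> (tens S :: 'a::alg_closed_field tensor) \<in> Z_ss \<beta>"
  unfolding strata_table_def list.set insert_iff empty_iff prod.inject
  by (elim disjE conjE FalseE; hypsubst;
      rule Z_ss_1 Z_ss_2 Z_ss_3 Z_ss_4 Z_ss_5 Z_ss_6 Z_ss_7 Z_ss_8 Z_ss_9 Z_ss_10 Z_ss_11 Z_ss_12 Z_ss_13 Z_ss_14
        Z_ss_15 Z_ss_16)

lemma strata_table_wt: "(\<beta>, S) \<in> strata_table \<Longrightarrow> rat_wt \<beta> \<and> \<beta> \<noteq> 0 \<and> \<beta> \<in> t_star_plus"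
  unfolding strata_table_def list.set insert_iff empty_iff prod.inject
  by (elim disjE conjE FalseE; hypsubst; simp add: mk_wt_rat mk_wt_eq_0 mk_wt_t_star_plus)

text \<open>\<open>\<BB>\<close> does not depend on the field, so semistability over any one
  algebraically closed field suffices.\<close>

lemma strata_table_BB: "(\<beta>, S) \<in> strata_table \<Longrightarrow> \<beta> \<in> \<BB>"
  using strata_table_wt strata_table_Z_ss[where 'a = "complex alg_closure"] Z_ss_imp_BB by blast

lemma strata_table_stratum:
  "(\<beta>, S) \<in> strata_table \<Longrightarrow> (tens S :: 'a::alg_closed_field tensor) \<in> stratum \<beta>"
  by (intro Z_ss_imp_stratum strata_table_Z_ss)

lemma quad_in_strata_table: "(\<beta>_quad, quad_support) \<in> strata_table"
  unfolding strata_table_def list.set by (rule insertI1)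

lemma strata_table_supports: "snd ` strata_table = insert quad_support rep_supports"
  unfolding strata_table_def rep_supports_def list.set image_insert image_empty snd_conv by (rule refl)

lemma strata_table_ex: "S \<in> insert quad_support rep_supports \<Longrightarrow> \<exists>\<beta>. (\<beta>, S) \<in> strata_table"
  unfolding strata_table_supports[symmetric] by auto

text \<open>By counting: the table has at most 16 rows and exactly 16 different weights.\<close>

lemma strata_table_inj:
  assumes "(\<beta>, S) \<in> strata_table" "(\<beta>, S') \<in> strata_table"
  shows "S = S'"
proof -
  have "card strata_table \<le> 16" unfolding strata_table_def by (rule order_trans[OF card_length]) simp
  moreover have "finite strata_table" unfolding strata_table_def by (rule finite_set)
  moreover have "card (fst ` strata_table) = 16" using card_strata_table by (simp only: Domain_fst)
  ultimately have "inj_on fst strata_table" by (intro eq_card_imp_inj_on) (use card_image_le[of strata_table fst] in linarith)+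
  from inj_onD[OF this _ assms] show ?thesis by simp
qed

lemma stratum_eqv: "eqv x y \<Longrightarrow> x \<in> stratum \<beta> \<longleftrightarrow> y \<in> stratum \<beta>"
  using stratum_act eqv_sym[of x y] unfolding eqv_def by metis

lemma stratum_eqv_tens:
  fixes x :: "'a::alg_closed_field tensor"
  assumes "\<beta> \<in> \<BB>" "x \<in> stratum \<beta>" "eqv x (tens S)" "(\<beta>', S) \<in> strata_table"
  shows "\<beta> = \<beta>'"
  using stratum_unique[OF assms(1) strata_table_BB[OF assms(4)], of "tens S :: 'a tensor"] assms(2)
    strata_table_stratum[OF assms(4)] stratum_eqv[OF assms(3)] by blast

lemma lift_quad_eqv:
  fixes t n :: "'k::field"
  assumes "t^2 - 4 * n \<noteq> 0"
  shows "eqv (lift (quad_tensor t n)) (tens quad_support)"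
proof -
  have "(to_ac t)^2 - 4 * to_ac n = to_ac (t^2 - 4 * n)" by simp
  then have "(to_ac t)^2 - 4 * to_ac n \<noteq> 0" using assms by (simp only: to_ac_eq_0_iff) simp
  then show ?thesis unfolding lift_quad_tensor by (rule quad_tensor_alg_closed)
qed

lemma rational_stratum_iff: "v \<in> rational_stratum \<beta> \<longleftrightarrow> lift v \<in> stratum \<beta>"
  by (simp add: rational_stratum_def lift_def)

text \<open>The normal form is found over \<open>k\<close>, whereas \<open>\<beta>\<close> is
  identified over the closure, where strata are disjoint and the lifted normal form lies in a known
  one.\<close>

lemma rational_stratum_cases:
  fixes v :: "'k::field tensor"
  assumes perfect: "perfect_field TYPE('k)" and \<beta>: "\<beta> \<in> \<BB>" and v: "v \<in> rational_stratum \<beta>"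
  obtains S where "S \<in> rep_supports" "(\<beta>, S) \<in> strata_table" "eqv v (tens S)"
  | t n where "\<beta> = \<beta>_quad" "t^2 - 4 * n \<noteq> 0" "eqv v (quad_tensor t n)"
proof -
  have lv: "lift v \<in> stratum \<beta>" using v by (simp add: rational_stratum_iff)
  have "tdisc v = 0" using stratum_tdisc[OF \<beta> lv] by (simp add: lift_tdisc)
  then have c: "classified v" by (rule tdisc_zero_classified[OF perfect])
  have "v \<noteq> 0" using zero_not_in_stratum[OF \<beta>] lv lift_zero by metis
  with c consider S where "S \<in> rep_supports" "eqv v (tens S)"
    | t n where "t^2 - 4 * n \<noteq> 0" "eqv v (quad_tensor t n)" unfolding classified_def by blast
  then show ?thesis
  proof cases
    case (1 S)
    then obtain \<beta>' where \<beta>': "(\<beta>', S) \<in> strata_table" using strata_table_ex[of S] by blast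
    moreover have "\<beta> = \<beta>'" using stratum_eqv_tens[OF \<beta> lv _ \<beta>'] lift_eqv[OF 1(2)] by (simp add: lift_tens)
    ultimately show ?thesis using that(1) 1 by blast
  next
    case (2 t n)
    have "eqv (lift v) (tens quad_support)" by (rule eqv_trans[OF lift_eqv[OF 2(2)] lift_quad_eqv[OF 2(1)]])
    then have "\<beta> = \<beta>_quad" by (rule stratum_eqv_tens[OF \<beta> lv _ quad_in_strata_table])
    then show ?thesis using that(2) 2 by blast
  qed
qed

text \<open>Over the closure all members of the family \<open>quad_tensor\<close> with non-zero
  discriminant split, so 16 normal forms of non-zero vectors remain.\<close>

lemma nonempty_strata:
  "{\<beta> \<in> \<BB>. (stratum \<beta> :: 'k::field alg_closure tensor set) \<noteq> {}} = Domain strata_table"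
proof -
  have "\<beta> \<in> Domain strata_table" if \<beta>: "\<beta> \<in> \<BB>" and x: "(x :: 'k alg_closure tensor) \<in> stratum \<beta>" for \<beta> x
  proof -
    have "classified x" by (rule tdisc_zero_classified[OF alg_closed_perfect stratum_tdisc[OF \<beta> x]])
    moreover have "x \<noteq> 0" using zero_not_in_stratum[OF \<beta>] x by metis
    ultimately consider S where "S \<in> rep_supports" "eqv x (tens S)" | t n where "t^2 - 4 * n \<noteq> 0" "eqv x (quad_tensor t n)"
      unfolding classified_def by blast
    then obtain S where S: "S \<in> insert quad_support rep_supports" "eqv x (tens S)"
      by cases (meson insertI2, meson insertI1 eqv_trans quad_tensor_alg_closed)
    obtain \<beta>' where \<beta>': "(\<beta>', S) \<in> strata_table" using strata_table_ex[OF S(1)] by blast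
    then show ?thesis using stratum_eqv_tens[OF \<beta> x S(2) \<beta>'] DomainI by metis
  qed
  note fst = this
  have BB: "\<beta> \<in> \<BB> \<and> (stratum \<beta> :: 'k alg_closure tensor set) \<noteq> {}" if "(\<beta>, S) \<in> strata_table" for \<beta> S
    using strata_table_BB[OF that] strata_table_stratum[OF that] by blast
  show ?thesis
  proof (intro subset_antisym subsetI)
    fix \<beta> assume "\<beta> \<in> Domain strata_table"
    then obtain S where "(\<beta>, S) \<in> strata_table" by (rule DomainE)
    then show "\<beta> \<in> {\<beta> \<in> \<BB>. (stratum \<beta> :: 'k alg_closure tensor set) \<noteq> {}}" using BB by blast
  qed (use fst in blast)
qed

section \<open>Orbits of rational points\<close>

definition orbit :: "'a::field tensor \<Rightarrow> 'a tensor set" where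
  "orbit v = {w. eqv v w}"

lemma G_orbits_eq: "G_orbits A = orbit ` A"
  unfolding G_orbits_def orbit_def eqv_def by (rule image_cong) auto

lemma orbit_eq_iff: "orbit v = orbit w \<longleftrightarrow> eqv v w"
  unfolding orbit_def using eqv_refl eqv_sym eqv_trans by blast

lemma is_singleton_G_orbits:
  fixes \<beta> :: wt
  assumes perfect: "perfect_field TYPE('k::field)"
    and \<beta>: "(\<beta>, S) \<in> strata_table" "\<beta> \<noteq> \<beta>_quad"
  shows "is_singleton (G_orbits (rational_stratum \<beta> :: 'k tensor set))"
proof -
  have "orbit v = orbit (tens S)" if v: "v \<in> rational_stratum \<beta>" for v :: "'k tensor"
  proof (rule rational_stratum_cases[OF perfect strata_table_BB[OF \<beta>(1)] v])
    fix S' assume "(\<beta>, S') \<in> strata_table" "eqv v (tens S')"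
    then show ?thesis using strata_table_inj[OF \<beta>(1)] by (simp add: orbit_eq_iff)
  qed (use \<beta>(2) in blast)
  moreover have "tens S \<in> (rational_stratum \<beta> :: 'k tensor set)"
    using strata_table_stratum[OF \<beta>(1)] by (simp add: rational_stratum_iff lift_tens)
  ultimately have "G_orbits (rational_stratum \<beta>) = {orbit (tens S :: 'k tensor)}" unfolding G_orbits_eq by blast
  then show ?thesis by (simp add: is_singleton_def)
qed

text \<open>The members of \<open>rep_supports\<close> containing \<open>(2,2,1)\<close> also
  contain \<open>(1,2,2)\<close>.\<close>

lemma quad_support_not_rep: "quad_support \<notin> rep_supports"
proof
  assume q: "quad_support \<in> rep_supports"
  have "(1,2,2) \<in> S" if "S \<in> rep_supports" "(2,2,1) \<in> S" for S
    using that unfolding rep_supports_def insert_iff empty_iff by (elim disjE FalseE) simp_all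
  from this[OF q] show False by simp
qed

lemma rational_stratum_quad:
  assumes perfect: "perfect_field TYPE('k::field)"
  shows "(rational_stratum \<beta>_quad :: 'k tensor set) = {v. \<exists>t n. t^2 - 4 * n \<noteq> 0 \<and> eqv v (quad_tensor t n)}"
proof (rule Set.set_eqI, unfold mem_Collect_eq, rule iffI)
  fix v :: "'k tensor" assume v: "v \<in> rational_stratum \<beta>_quad"
  show "\<exists>t n. t^2 - 4 * n \<noteq> 0 \<and> eqv v (quad_tensor t n)"
  proof (rule rational_stratum_cases[OF perfect strata_table_BB[OF quad_in_strata_table] v])
    fix S assume S: "S \<in> rep_supports" "(\<beta>_quad, S) \<in> strata_table"
    have "quad_support = S" by (rule strata_table_inj[OF quad_in_strata_table S(2)])
    then have "quad_support \<in> rep_supports" using S(1) by (rule ssubst)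
    then show ?thesis using quad_support_not_rep by (rule notE[rotated])
  qed blast
next
  fix v :: "'k tensor" assume "\<exists>t n. t^2 - 4 * n \<noteq> 0 \<and> eqv v (quad_tensor t n)"
  then obtain t n where tn: "t^2 - 4 * n \<noteq> 0" "eqv v (quad_tensor t n)" by blast
  have "eqv (lift v) (tens quad_support)" by (rule eqv_trans[OF lift_eqv[OF tn(2)] lift_quad_eqv[OF tn(1)]])
  then show "v \<in> rational_stratum \<beta>_quad"
    unfolding rational_stratum_iff by (rule stratum_eqv[THEN iffD2, OF _ strata_table_stratum[OF quad_in_strata_table]])
qed

text \<open>The choice does not matter on the orbits in question, since \<open>eqv_quad_iff\<close>
  shows that equivalent members of the family have the same field.\<close>

definition orbit_field :: "'k::field tensor set \<Rightarrow> 'k alg_closure set" where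
  "orbit_field Q = (SOME F. \<exists>t n \<alpha>. quad_tensor t n \<in> Q \<and> t^2 - 4 * n \<noteq> 0 \<and> quad_root t n \<alpha> \<and> F = simple_ext \<alpha>)"

lemma orbit_field_quad:
  fixes t n :: "'k::field"
  assumes d: "t^2 - 4 * n \<noteq> 0" and q: "quad_root t n \<alpha>"
  shows "orbit_field (orbit (quad_tensor t n)) = simple_ext \<alpha>"
  unfolding orbit_field_def
proof (rule some_equality)
  show "\<exists>t' n' \<alpha>'. quad_tensor t' n' \<in> orbit (quad_tensor t n) \<and> t'^2 - 4 * n' \<noteq> 0 \<and> quad_root t' n' \<alpha>' \<and>
      simple_ext \<alpha> = simple_ext \<alpha>'"
    unfolding orbit_def mem_Collect_eq
    by (rule exI[of _ t], rule exI[of _ n], rule exI[of _ \<alpha>]) (use d q eqv_refl in blast)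
  fix F assume "\<exists>t' n' \<alpha>'. quad_tensor t' n' \<in> orbit (quad_tensor t n) \<and> t'^2 - 4 * n' \<noteq> 0 \<and> quad_root t' n' \<alpha>' \<and>
      F = simple_ext \<alpha>'"
  then show "F = simple_ext \<alpha>" using eqv_quad_iff[OF q _ d] unfolding orbit_def by blast
qed

text \<open>The classes in \<open>Ex2\<close> are singletons by \<open>Ex2_eq\<close>, so an orbit
  is sent to the set consisting of its field alone.\<close>

lemma bij_betw_orbits_Ex2:
  assumes perfect: "perfect_field TYPE('k::field)"
  shows "bij_betw (\<lambda>Q. {orbit_field Q}) (G_orbits (rational_stratum \<beta>_quad :: 'k tensor set)) Ex2"
proof -
  have orbits: "\<exists>t n \<alpha>. t^2 - 4 * n \<noteq> 0 \<and> quad_root t n \<alpha> \<and> Q = orbit (quad_tensor t n)"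
    if "Q \<in> G_orbits (rational_stratum \<beta>_quad :: 'k tensor set)" for Q
    using that quad_root_exists orbit_eq_iff unfolding G_orbits_eq rational_stratum_quad[OF perfect] by blast
  have mem: "orbit (quad_tensor t n) \<in> G_orbits (rational_stratum \<beta>_quad :: 'k tensor set)"
    if "t^2 - 4 * n \<noteq> 0" for t n
    using that eqv_refl unfolding G_orbits_eq rational_stratum_quad[OF perfect] by blast
  show ?thesis unfolding bij_betw_def
  proof
    show "inj_on (\<lambda>Q. {orbit_field Q}) (G_orbits (rational_stratum \<beta>_quad :: 'k tensor set))"
    proof (rule inj_onI)
      fix Q Q' :: "'k tensor set"
      assume QQ: "Q \<in> G_orbits (rational_stratum \<beta>_quad)" "Q' \<in> G_orbits (rational_stratum \<beta>_quad)"
        and eq: "{orbit_field Q} = {orbit_field Q'}"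
      obtain t n \<alpha> where 1: "t^2 - 4 * n \<noteq> 0" "quad_root t n \<alpha>" "Q = orbit (quad_tensor t n)"
        using orbits[OF QQ(1)] by blast
      obtain t' n' \<alpha>' where 2: "t'^2 - 4 * n' \<noteq> 0" "quad_root t' n' \<alpha>'" "Q' = orbit (quad_tensor t' n')"
        using orbits[OF QQ(2)] by blast
      show "Q = Q'"
        using eq eqv_quad_iff[OF 1(2) 2(2) 1(1) 2(1)] by (simp add: 1(3) 2(3) orbit_field_quad[OF 1(1,2)] orbit_field_quad[OF 2(1,2)] orbit_eq_iff)
    qed
    show "(\<lambda>Q. {orbit_field Q}) ` G_orbits (rational_stratum \<beta>_quad :: 'k tensor set) = Ex2"
    proof
      show "(\<lambda>Q. {orbit_field Q}) ` G_orbits (rational_stratum \<beta>_quad :: 'k tensor set) \<subseteq> Ex2"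
        using orbits orbit_field_quad separable_ext_simple_ext unfolding Ex2_eq by fastforce
      show "Ex2 \<subseteq> (\<lambda>Q. {orbit_field Q}) ` G_orbits (rational_stratum \<beta>_quad :: 'k tensor set)"
      proof
        fix E :: "'k alg_closure set set" assume "E \<in> Ex2"
        then obtain F where F: "E = {F}" "separable_ext_le2 F" unfolding Ex2_eq by blast
        obtain t n \<alpha> where "quad_root t n \<alpha>" "t^2 - 4 * n \<noteq> 0" "F = simple_ext \<alpha>" using separable_ext_le2_cases[OF F(2)] by metis
        then have "E = {orbit_field (orbit (quad_tensor t n))}" "t^2 - 4 * n \<noteq> 0"
          by (simp_all add: F(1) orbit_field_quad)
        then show "E \<in> (\<lambda>Q. {orbit_field Q}) ` G_orbits (rational_stratum \<beta>_quad)" using mem by blast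
      qed
    qed
  qed
qed

theorem theorem1p1:
  assumes "perfect_field TYPE('k::field)"
  shows "card {\<beta> \<in> \<BB>. (stratum \<beta> :: 'k alg_closure tensor set) \<noteq> {}} = 16 \<and>
    (\<exists>\<beta>0\<in>\<BB>. (stratum \<beta>0 :: 'k alg_closure tensor set) \<noteq> {} \<and>
       (\<forall>\<beta>\<in>\<BB>. \<beta> \<noteq> \<beta>0 \<and> (stratum \<beta> :: 'k alg_closure tensor set) \<noteq> {} \<longrightarrow>
          is_singleton (G_orbits (rational_stratum \<beta> :: 'k tensor set))) \<and>
       (\<exists>f. bij_betw f (G_orbits (rational_stratum \<beta>0 :: 'k tensor set))
          (Ex2 :: 'k alg_closure set set set)))"
proof (intro conjI bexI[of _ \<beta>_quad])
  show "card {\<beta> \<in> \<BB>. (stratum \<beta> :: 'k alg_closure tensor set) \<noteq> {}} = 16"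
    unfolding nonempty_strata by (rule card_strata_table)
  show "\<beta>_quad \<in> \<BB>" by (rule strata_table_BB[OF quad_in_strata_table])
  show "(stratum \<beta>_quad :: 'k alg_closure tensor set) \<noteq> {}" using strata_table_stratum[OF quad_in_strata_table] by blast
  show "\<forall>\<beta>\<in>\<BB>. \<beta> \<noteq> \<beta>_quad \<and> (stratum \<beta> :: 'k alg_closure tensor set) \<noteq> {} \<longrightarrow>
      is_singleton (G_orbits (rational_stratum \<beta> :: 'k tensor set))"
  proof (intro ballI impI)
    fix \<beta> assume "\<beta> \<in> \<BB>" and \<beta>: "\<beta> \<noteq> \<beta>_quad \<and> (stratum \<beta> :: 'k alg_closure tensor set) \<noteq> {}"
    then have "\<beta> \<in> Domain strata_table" unfolding nonempty_strata[where 'k = 'k, symmetric] by blast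
    then obtain S where "(\<beta>, S) \<in> strata_table" by (rule DomainE)
    then show "is_singleton (G_orbits (rational_stratum \<beta> :: 'k tensor set))"
      using is_singleton_G_orbits[OF assms] \<beta> by blast
  qed
  show "\<exists>f. bij_betw f (G_orbits (rational_stratum \<beta>_quad :: 'k tensor set)) (Ex2 :: 'k alg_closure set set set)"
    by (rule exI) (rule bij_betw_orbits_Ex2[OF assms])
qed

end
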